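(* Let $(\eta,\beta)\in Z^1_c(Q;\hat V)\times Z^2(Q;V)$ be a compatible pair of cocycles with $\eta$ essentially bijective, let $G$ be the extension of $V$ by $Q$ defined by $\beta$, let $b\colon Q\times Q\to\mathbb T$ be a Borel map with $\psi=\partial b$, and let $\pi$ be the projective representation of $G$ on $L^2(Q)$ given by $(\pi(q,v)\varphi)(q_0)=e^{-i\langle\eta(q_0),v\rangle}\,b(q_0^{-1},q)\,\varphi(q^{-1}q_0)$. For every $f\in C_c(G)$, let $\mathrm{Op}(f)$ be the sesquilinear form on $C_c(Q)$ given by $$\mathrm{Op}(f)[\varphi_1,\varphi_2]:=\int_G f(g)\,\bigg(\int_Q(\pi(g)^*\varphi_1)(q_0)\,|q_0|^{-1/2}\,dq_0\bigg)\overline{(\pi(g)^*\varphi_2)(e)}\,dg .$$ Then $$\mathrm{Op}(f)[\varphi_1,\varphi_2]=\int_{Q\times Q}K(f)(q_0,q)\,\varphi_1(q)\,\overline{\varphi_2(q_0)}\,dq_0\,dq,$$ where $$K(f)(q_0,q)=|q_0q|^{-1/2}\,b(q_0^{-1},q_0)\,\overline{b(q^{-1},q_0)}\,(\mathcal F_Vf)(q_0,\eta(q_0)-\eta(q)).$$ Consequently, the map $\mathrm{Op}$ extends to a unitary operator $L^2(G)\to\mathrm{HS}(L^2(Q))$ that intertwines the representations $\lambda$ and $\mathrm{Ad}\,\pi$ of $G$.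
   Context: Groups. $Q$ and $V$ are second countable locally compact groups, $V$ is abelian (written additively), and $Q$ acts on $V$ through a continuous homomorphism $Q\to\mathrm{Aut}(V)$. $\hat V$ is the Pontryagin dual (written additively), the pairing of $\hat V$ and $V$ is written $e^{i\langle\xi,v\rangle}\in\mathbb T$ (notation only), and $Q$ acts on $\hat V$ by the dual action $e^{i\langle q^\flat\xi,v\rangle}=e^{i\langle\xi,q^{-1}v\rangle}$. Cohomology is Moore cohomology with Borel cochains. $\beta\in Z^2(Q;V)$ is a Borel map $Q\times Q\to V$ with $\beta(q_1,q_2)+\beta(q_1q_2,q_3)=q_1\beta(q_2,q_3)+\beta(q_1,q_2q_3)$; $G$ is $Q\times V$ as a Borel space, with product $(q_1,v_1)(q_2,v_2)=(q_1q_2,v_1+q_1v_2+\beta(q_1,q_2))$ and the corresponding second countable locally compact group topology. Cocycles. $Z^1_c(Q;\hat V)$ is the set of continuous maps $\eta\colon Q\to\hat V$ with $\eta(q_1q_2)=\eta(q_1)+q_1^\flat\eta(q_2)$. $\eta$ is essentially bijective if it is a measure class isomorphism $Q\to\hat V$ (with respect to Haar measures; i.e. after removing null sets it is a Borel isomorphism preserving null sets in both directions). Put $\psi(q_1,q_2,q_3):=e^{i\langle\eta(q_1^{-1}),\beta(q_2,q_3)\rangle}\in Z^3(Q;\mathbb T)$. The pair $(\eta,\beta)$ is compatible if $[\psi]=[1]$ in $H^3(Q;\mathbb T)$. The coboundary convention is $(\partial b)(q_1,q_2,q_3)=\dfrac{b(q_2,q_3)\,b(q_1,q_2q_3)}{b(q_1,q_2)\,b(q_1q_2,q_3)}$.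 Measures. $|q|=|q|_V$ is defined by $\int_V f(qv)\,dv=|q|^{-1}\int_V f(v)\,dv$. $dq$ is a left Haar measure on $Q$; the left Haar measure of $G$ is $d(q,v)=|q|^{-1}dq\,dv$. Given a Haar measure $d\xi$ on $\hat V$, $dq$ is normalized by $\int_Q f(\eta(q))\,|q|^{-1}dq=\int_{\hat V}f(\xi)\,d\xi$ for positive Borel $f$, and $dv$ is normalized so that the Fourier transform is unitary $L^2(V)\to L^2(\hat V)$. $\mathcal F_V$ is the partial Fourier transform in the variable $v$: $(\mathcal F_Vf)(q,\xi)=\int_Ve^{-i\langle\xi,v\rangle}f(q,v)\,dv$. Other notation. $\pi(g)^*\varphi$ for $\varphi\in C_c(Q)$ is understood pointwise: $(\pi(q,v)^*\varphi)(q_0)=e^{i\langle\eta(qq_0),v\rangle}\,\overline{b((qq_0)^{-1},q)}\,\varphi(qq_0)$. $\mathrm{HS}(L^2(Q))$ is the Hilbert space of Hilbert--Schmidt operators, identified with $L^2(Q\times Q)$ by assigning to $k$ the operator with kernel $k$, $(T\varphi)(q_0)=\int_Qk(q_0,q)\varphi(q)\,dq$; a sesquilinear form given by a kernel $k\in L^2(Q\times Q)$ is identified with this operator. $\lambda$ is the left regular representation of $G$ on $L^2(G)$, and $\mathrm{Ad}\,\pi(g)$ acts on $\mathrm{HS}(L^2(Q))$ by $T\mapsto\pi(g)T\pi(g)^*$. *)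

theory Defs
  imports "HOL-Analysis.Analysis"
begin

text \<open>
  Locally compact groups are types of class \<^class>\<open>topological_group_add\<close>; this class is not
  assumed commutative. So the group \<open>Q\<close> is written additively: \<open>q\<^sub>1 + q\<^sub>2\<close>, \<open>- q\<close> and \<open>0\<close> are
  the product, the inverse and the neutral element \<open>e\<close> of \<open>Q\<close>.
\<close>

section \<open>The Pontryagin dual\<close>

typedef (overloaded) ('v::topological_ab_group_add) dual =
  "{h :: 'v \<Rightarrow> complex. continuous_on UNIV h \<and> (\<forall>v. cmod (h v) = 1) \<and>
      (\<forall>v w. h (v + w) = h v * h w)}"
  morphisms pairing Abs_dual
  by (rule exI[of _ "\<lambda>_. 1"]) auto

text \<open>\<open>pairing \<xi> v\<close> is the number written \<open>exp (i \<langle>\<xi>, v\<rangle>)\<close>; hence the dual, whose group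
  operation is the pointwise product of characters, is written additively.\<close>

setup_lifting type_definition_dual

instantiation dual :: (topological_ab_group_add) ab_group_add
begin

lift_definition zero_dual :: "'a dual" is "\<lambda>_. 1" by auto

lift_definition plus_dual :: "'a dual \<Rightarrow> 'a dual \<Rightarrow> 'a dual" is "\<lambda>h h' v. h v * h' v"
  by (auto simp: norm_mult intro!: continuous_intros)

lift_definition uminus_dual :: "'a dual \<Rightarrow> 'a dual" is "\<lambda>h v. cnj (h v)"
  by (auto intro!: continuous_intros)

definition minus_dual :: "'a dual \<Rightarrow> 'a dual \<Rightarrow> 'a dual" where
  "minus_dual \<xi> \<eta> = \<xi> + - \<eta>"

instance
proof
  fix a b c :: "'a dual"
  show "a + b + c = a + (b + c)" by transfer (simp add: mult.assoc)
  show "a + b = b + a" by transfer (simp add: mult.commute)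
  show "0 + a = a" by transfer simp
  show "- a + a = 0"
  proof transfer
    fix h :: "'a \<Rightarrow> complex"
    assume "continuous_on UNIV h \<and> (\<forall>v. cmod (h v) = 1) \<and> (\<forall>v w. h (v + w) = h v * h w)"
    then show "(\<lambda>v. cnj (h v) * h v) = (\<lambda>_. 1)"
      by (metis complex_norm_square mult.commute of_real_1 one_power2)
  qed
  show "a - b = a + - b" by (rule minus_dual_def)
qed

end

text \<open>The compact-open topology.\<close>

instantiation dual :: (topological_ab_group_add) topological_space
begin

definition open_dual :: "'a dual set \<Rightarrow> bool" where
  "open_dual =
     generate_topology {{\<xi>. pairing \<xi> ` K \<subseteq> W} | K W. compact K \<and> open W}"

instance using topological_space_generate_topology
  by intro_classes (auto simp: open_dual_def class.topological_space_def)

end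

lemma pairing_zero [simp]: "pairing 0 v = 1"
  by (simp add: zero_dual.rep_eq)

lemma pairing_plus: "pairing (\<xi> + \<zeta>) v = pairing \<xi> v * pairing \<zeta> v"
  by (simp add: plus_dual.rep_eq)

lemma pairing_uminus: "pairing (- \<xi>) v = cnj (pairing \<xi> v)"
  by (simp add: uminus_dual.rep_eq)

lemma continuous_on_pairing: "continuous_on UNIV (pairing \<xi>)"
  using pairing[of \<xi>] by simp

lemma norm_pairing [simp]: "cmod (pairing \<xi> v) = 1"
  using pairing[of \<xi>] by simp

lemma pairing_add_right: "pairing \<xi> (v + w) = pairing \<xi> v * pairing \<xi> w"
  using pairing[of \<xi>] by simp


section \<open>Continuous actions by automorphisms\<close>

definition Aut :: "('v::topological_ab_group_add \<Rightarrow> 'v) set" where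
  "Aut = {h. bij h \<and> continuous_on UNIV h \<and> continuous_on UNIV (inv h) \<and>
             (\<forall>v w. h (v + w) = h v + h w)}"

text \<open>The usual (Braconnier) topology of the automorphism group: uniform convergence on compact sets
  of \<open>h\<close> and of its inverse.\<close>

definition Aut_topology :: "('v::topological_ab_group_add \<Rightarrow> 'v) topology" where
  "Aut_topology = topology_generated_by
     ({{h \<in> Aut. h ` K \<subseteq> U} | K U. compact K \<and> open U} \<union>
      {{h \<in> Aut. inv h ` K \<subseteq> U} | K U. compact K \<and> open U})"

definition continuous_action ::
  "('q::topological_group_add \<Rightarrow> 'v::topological_ab_group_add \<Rightarrow> 'v) \<Rightarrow> bool" where
  "continuous_action act \<longleftrightarrow>
     continuous_map euclidean Aut_topology act \<and> (\<forall>q r. act (q + r) = act q \<circ> act r)"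

definition dual_act ::
  "('q::topological_group_add \<Rightarrow> 'v::topological_ab_group_add \<Rightarrow> 'v) \<Rightarrow> 'q \<Rightarrow> 'v dual \<Rightarrow> 'v dual"
  where "dual_act act q \<xi> = Abs_dual (\<lambda>v. pairing \<xi> (act (- q) v))"

lemma topspace_Aut_topology [simp]: "topspace Aut_topology = Aut"
proof -
  let ?S = "{{h \<in> Aut. h ` K \<subseteq> U} | K U. compact K \<and> open U} \<union>
      {{h \<in> Aut. inv h ` K \<subseteq> U} | K U. compact K \<and> open (U :: 'a set)}"
  have "Aut = {h \<in> Aut. h ` {} \<subseteq> (UNIV :: 'a set)}" by simp
  then have "Aut \<in> ?S" using compact_empty open_UNIV by blast
  moreover have "X \<subseteq> Aut" if "X \<in> ?S" for X using that by blast
  ultimately have "\<Union> ?S = Aut" by (intro subset_antisym Union_least Union_upper)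
  then show ?thesis unfolding Aut_topology_def topology_generated_by_topspace .
qed

lemma continuous_action_Aut:
  assumes "continuous_action act"
  shows "act q \<in> Aut"
  using continuous_map_image_subset_topspace[of euclidean Aut_topology act] assms
  by (auto simp: continuous_action_def)

lemma continuous_action_add:
  assumes "continuous_action act"
  shows "act q (v + w) = act q v + act q w" "act (q + r) v = act q (act r v)" "act 0 v = v"
proof -
  show "act q (v + w) = act q v + act q w"
    using continuous_action_Aut[OF assms, of q] by (simp add: Aut_def)
  show add: "act (q + r) v = act q (act r v)" for q r v
    using assms by (simp add: continuous_action_def)
  have "inj (act 0)" using continuous_action_Aut[OF assms, of 0] by (simp add: Aut_def bij_is_inj)
  moreover have "act 0 (act 0 v) = act 0 v" by (metis add add_0)
  ultimately show "act 0 v = v" by (rule injD)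
qed

lemma pairing_dual_act:
  assumes "continuous_action act"
  shows "pairing (dual_act act q \<xi>) v = pairing \<xi> (act (- q) v)"
proof -
  have "continuous_on UNIV (act (- q))"
    using continuous_action_Aut[OF assms, of "- q"] by (simp add: Aut_def)
  then have "continuous_on UNIV (\<lambda>v. pairing \<xi> (act (- q) v))"
    using continuous_on_compose2[OF continuous_on_pairing] by blast
  then show ?thesis
    unfolding dual_act_def
    by (subst Abs_dual_inverse)
      (auto simp: continuous_action_add(1)[OF assms] pairing_add_right)
qed


section \<open>Haar measures\<close>

text \<open>In second countable locally compact Hausdorff groups a Borel measure that is finite on compact
  sets is automatically regular.\<close>

definition left_haar_measure :: "'a::{topological_space, group_add} measure \<Rightarrow> bool" where
  "left_haar_measure M \<longleftrightarrow> sets M = sets borel \<and> emeasure M UNIV \<noteq> 0 \<and>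
     (\<forall>K. compact K \<longrightarrow> emeasure M K < \<infinity>) \<and> (\<forall>x. distr M borel (\<lambda>y. x + y) = M)"

text \<open>\<open>modulus MV act q\<close> is \<open>|q|\<close>, where \<open>MV\<close> is a Haar measure on \<open>V\<close>.\<close>

definition modulus ::
  "'v::topological_space measure \<Rightarrow> ('q \<Rightarrow> 'v \<Rightarrow> 'v) \<Rightarrow> 'q \<Rightarrow> real" where
  "modulus MV act q = (THE c. c > 0 \<and> (\<forall>f\<in>borel_measurable borel.
     (\<integral>\<^sup>+ v. f (act q v) \<partial>MV) = ennreal (inverse c) * (\<integral>\<^sup>+ v. f v \<partial>MV)))"


section \<open>Cocycles\<close>

definition Z1c ::
  "('q::topological_group_add \<Rightarrow> 'v::topological_ab_group_add \<Rightarrow> 'v) \<Rightarrow> ('q \<Rightarrow> 'v dual) set" where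
  "Z1c act = {\<eta>. continuous_on UNIV \<eta> \<and>
     (\<forall>q\<^sub>1 q\<^sub>2. \<eta> (q\<^sub>1 + q\<^sub>2) = \<eta> q\<^sub>1 + dual_act act q\<^sub>1 (\<eta> q\<^sub>2))}"

definition Z2 ::
  "('q::topological_group_add \<Rightarrow> 'v::topological_ab_group_add \<Rightarrow> 'v) \<Rightarrow> ('q \<Rightarrow> 'q \<Rightarrow> 'v) set" where
  "Z2 act = {\<beta>. (\<lambda>(q\<^sub>1, q\<^sub>2). \<beta> q\<^sub>1 q\<^sub>2) \<in> borel_measurable borel \<and>
     (\<forall>q\<^sub>1 q\<^sub>2 q\<^sub>3. \<beta> q\<^sub>1 q\<^sub>2 + \<beta> (q\<^sub>1 + q\<^sub>2) q\<^sub>3 = act q\<^sub>1 (\<beta> q\<^sub>2 q\<^sub>3) + \<beta> q\<^sub>1 (q\<^sub>2 + q\<^sub>3))}"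

text \<open>Borel 2-cochains with values in the circle, and their coboundaries.\<close>

definition C2_circle :: "('q::topological_space \<Rightarrow> 'q \<Rightarrow> complex) set" where
  "C2_circle = {b. (\<lambda>(q\<^sub>1, q\<^sub>2). b q\<^sub>1 q\<^sub>2) \<in> borel_measurable borel \<and> (\<forall>q\<^sub>1 q\<^sub>2. cmod (b q\<^sub>1 q\<^sub>2) = 1)}"

definition coboundary :: "('q::group_add \<Rightarrow> 'q \<Rightarrow> complex) \<Rightarrow> 'q \<Rightarrow> 'q \<Rightarrow> 'q \<Rightarrow> complex" where
  "coboundary b q\<^sub>1 q\<^sub>2 q\<^sub>3 =
     (b q\<^sub>2 q\<^sub>3 * b q\<^sub>1 (q\<^sub>2 + q\<^sub>3)) / (b q\<^sub>1 q\<^sub>2 * b (q\<^sub>1 + q\<^sub>2) q\<^sub>3)"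

definition psi ::
  "('q::group_add \<Rightarrow> 'v::topological_ab_group_add dual) \<Rightarrow> ('q \<Rightarrow> 'q \<Rightarrow> 'v) \<Rightarrow>
     'q \<Rightarrow> 'q \<Rightarrow> 'q \<Rightarrow> complex" where
  "psi \<eta> \<beta> q\<^sub>1 q\<^sub>2 q\<^sub>3 = pairing (\<eta> (- q\<^sub>1)) (\<beta> q\<^sub>2 q\<^sub>3)"

text \<open>The class of \<open>psi \<eta> \<beta>\<close> in \<open>H\<^sup>3(Q; T)\<close> (trivial action on the circle) is trivial.\<close>

definition compatible ::
  "('q::{topological_space, group_add} \<Rightarrow> 'v::topological_ab_group_add dual) \<Rightarrow>
     ('q \<Rightarrow> 'q \<Rightarrow> 'v) \<Rightarrow> bool" where
  "compatible \<eta> \<beta> \<longleftrightarrow> (\<exists>b\<in>C2_circle. psi \<eta> \<beta> = coboundary b)"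

definition essentially_bijective :: "'a measure \<Rightarrow> 'b measure \<Rightarrow> ('a \<Rightarrow> 'b) \<Rightarrow> bool" where
  "essentially_bijective M N h \<longleftrightarrow> (\<exists>A\<in>null_sets M. \<exists>B\<in>null_sets N.
     bij_betw h (space M - A) (space N - B) \<and>
     h \<in> restrict_space M (space M - A) \<rightarrow>\<^sub>M restrict_space N (space N - B) \<and>
     the_inv_into (space M - A) h \<in>
       restrict_space N (space N - B) \<rightarrow>\<^sub>M restrict_space M (space M - A) \<and>
     (\<forall>E\<in>sets M. E \<subseteq> space M - A \<longrightarrow> (E \<in> null_sets M \<longleftrightarrow> h ` E \<in> null_sets N)))"


section \<open>The extension\<close>

definition ext_mult ::
  "('q::group_add \<Rightarrow> 'v::ab_group_add \<Rightarrow> 'v) \<Rightarrow> ('q \<Rightarrow> 'q \<Rightarrow> 'v) \<Rightarrow> 'q \<times> 'v \<Rightarrow> 'q \<times> 'v \<Rightarrow> 'q \<times> 'v"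
  where "ext_mult act \<beta> = (\<lambda>(q\<^sub>1, v\<^sub>1) (q\<^sub>2, v\<^sub>2). (q\<^sub>1 + q\<^sub>2, v\<^sub>1 + act q\<^sub>1 v\<^sub>2 + \<beta> q\<^sub>1 q\<^sub>2))"

text \<open>The cocycle is not assumed to be normalized, so the neutral element need not be \<open>(0, 0)\<close>.\<close>

definition ext_one :: "('q::group_add \<Rightarrow> 'q \<Rightarrow> 'v::ab_group_add) \<Rightarrow> 'q \<times> 'v" where
  "ext_one \<beta> = (0, - \<beta> 0 0)"

definition ext_inv ::
  "('q::group_add \<Rightarrow> 'v::ab_group_add \<Rightarrow> 'v) \<Rightarrow> ('q \<Rightarrow> 'q \<Rightarrow> 'v) \<Rightarrow> 'q \<times> 'v \<Rightarrow> 'q \<times> 'v" where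
  "ext_inv act \<beta> = (\<lambda>(q, v). (- q, - act (- q) v - \<beta> (- q) q - \<beta> 0 0))"

lemma group_ext:
  assumes act: "continuous_action act" and \<beta>: "\<beta> \<in> Z2 act"
  shows "group (ext_mult act \<beta>) (ext_one \<beta>) (ext_inv act \<beta>)"
proof
  note act = continuous_action_add[OF act]
  have cocycle: "\<beta> q\<^sub>1 q\<^sub>2 + \<beta> (q\<^sub>1 + q\<^sub>2) q\<^sub>3 = act q\<^sub>1 (\<beta> q\<^sub>2 q\<^sub>3) + \<beta> q\<^sub>1 (q\<^sub>2 + q\<^sub>3)" for q\<^sub>1 q\<^sub>2 q\<^sub>3
    using \<beta> by (simp add: Z2_def)
  have zero: "\<beta> 0 q = \<beta> 0 0" for q
    using cocycle[of 0 0 q] unfolding act(3) add_0 by (rule add_right_imp_eq[THEN sym])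
  fix g h k :: "'a \<times> 'b"
  obtain q v r w s x where g: "g = (q, v)" and h: "h = (r, w)" and k: "k = (s, x)"
    by (metis surj_pair)
  have "v + act q w + \<beta> q r + act (q + r) x + \<beta> (q + r) s =
      v + act q w + act q (act r x) + (\<beta> q r + \<beta> (q + r) s)"
    by (simp add: act(2) add.assoc)
  also have "\<dots> = v + (act q w + act q (act r x) + act q (\<beta> r s)) + \<beta> q (r + s)"
    unfolding cocycle by (simp add: add.assoc)
  finally show "ext_mult act \<beta> (ext_mult act \<beta> g h) k = ext_mult act \<beta> g (ext_mult act \<beta> h k)"
    by (simp add: g h k ext_mult_def act(1) add.assoc)
  show "ext_mult act \<beta> (ext_one \<beta>) g = g"
    by (simp add: g ext_mult_def ext_one_def act(3) zero[of q])
  show "ext_mult act \<beta> (ext_inv act \<beta> g) g = ext_one \<beta>"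
    by (simp add: g ext_mult_def ext_one_def ext_inv_def)
qed

text \<open>The group topology of the extension: the unique second countable locally compact group
  topology whose Borel sets are those of the product \<open>Q \<times> V\<close>. In general it is not the product
  topology, since \<open>\<beta>\<close> is only Borel.\<close>

definition ext_topology ::
  "('q::{topological_group_add, second_countable_topology} \<Rightarrow>
      'v::{topological_ab_group_add, second_countable_topology} \<Rightarrow> 'v) \<Rightarrow>
     ('q \<Rightarrow> 'q \<Rightarrow> 'v) \<Rightarrow> ('q \<times> 'v) topology \<Rightarrow> bool" where
  "ext_topology act \<beta> T \<longleftrightarrow> topspace T = UNIV \<and>
     Hausdorff_space T \<and> locally_compact_space T \<and> second_countable T \<and>
     continuous_map (prod_topology T T) T (\<lambda>(g, h). ext_mult act \<beta> g h) \<and>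
     continuous_map T T (ext_inv act \<beta>) \<and>
     sigma_sets UNIV {U. openin T U} = sets (borel :: ('q \<times> 'v) measure)"

text \<open>The left Haar measure \<open>|q|\<^sup>-\<^sup>1 dq dv\<close> of the extension.\<close>

definition ext_haar ::
  "'q measure \<Rightarrow> 'v::topological_space measure \<Rightarrow> ('q \<Rightarrow> 'v \<Rightarrow> 'v) \<Rightarrow> ('q \<times> 'v) measure" where
  "ext_haar MQ MV act =
     density (MQ \<Otimes>\<^sub>M MV) (\<lambda>(q, v). ennreal (inverse (modulus MV act q)))"

definition ext_regular ::
  "('q::group_add \<Rightarrow> 'v::ab_group_add \<Rightarrow> 'v) \<Rightarrow> ('q \<Rightarrow> 'q \<Rightarrow> 'v) \<Rightarrow> 'q \<times> 'v \<Rightarrow>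
     ('q \<times> 'v \<Rightarrow> complex) \<Rightarrow> 'q \<times> 'v \<Rightarrow> complex" where
  "ext_regular act \<beta> g f = (\<lambda>h. f (ext_mult act \<beta> (ext_inv act \<beta> g) h))"


section \<open>Function spaces\<close>

definition Cc :: "'a topology \<Rightarrow> ('a \<Rightarrow> complex) set" where
  "Cc T = {f. continuous_map T euclidean f \<and>
     (\<exists>K. compactin T K \<and> (\<forall>x\<in>topspace T - K. f x = 0))}"

text \<open>Elements of \<open>L\<^sup>2\<close> spaces are represented by functions; equality in \<open>L\<^sup>2\<close> is equality almost
  everywhere.\<close>

definition L2 :: "'a measure \<Rightarrow> ('a \<Rightarrow> complex) set" where
  "L2 M = {f \<in> borel_measurable M. integrable M (\<lambda>x. (cmod (f x))\<^sup>2)}"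

text \<open>A linear isometry maps almost everywhere equal functions to almost everywhere equal functions,
  so \<open>U\<close> descends to \<open>L\<^sup>2\<close>.\<close>

definition unitary_L2 ::
  "'a measure \<Rightarrow> 'b measure \<Rightarrow> (('a \<Rightarrow> complex) \<Rightarrow> 'b \<Rightarrow> complex) \<Rightarrow> bool" where
  "unitary_L2 M N U \<longleftrightarrow>
     (\<forall>f\<in>L2 M. U f \<in> L2 N) \<and>
     (\<forall>f\<in>L2 M. \<forall>g\<in>L2 M. AE y in N. U (\<lambda>x. f x + g x) y = U f y + U g y) \<and>
     (\<forall>c. \<forall>f\<in>L2 M. AE y in N. U (\<lambda>x. c * f x) y = c * U f y) \<and>
     (\<forall>f\<in>L2 M. (\<integral>y. (cmod (U f y))\<^sup>2 \<partial>N) = (\<integral>x. (cmod (f x))\<^sup>2 \<partial>M)) \<and>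
     (\<forall>h\<in>L2 N. \<exists>f\<in>L2 M. AE y in N. U f y = h y)"

definition fourier ::
  "'v::topological_ab_group_add measure \<Rightarrow> ('v \<Rightarrow> complex) \<Rightarrow> 'v dual \<Rightarrow> complex" where
  "fourier MV f \<xi> = (\<integral>v. cnj (pairing \<xi> v) * f v \<partial>MV)"

definition fourier_unitary ::
  "'v::topological_ab_group_add measure \<Rightarrow> 'v dual measure \<Rightarrow> bool" where
  "fourier_unitary MV MX \<longleftrightarrow> (\<exists>U. unitary_L2 MV MX U \<and>
     (\<forall>f\<in>L2 MV. integrable MV f \<longrightarrow> (AE \<xi> in MX. U f \<xi> = fourier MV f \<xi>)))"

definition partial_fourier ::
  "'v::topological_ab_group_add measure \<Rightarrow> ('q \<times> 'v \<Rightarrow> complex) \<Rightarrow> 'q \<times> 'v dual \<Rightarrow> complex" where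
  "partial_fourier MV f = (\<lambda>(q, \<xi>). fourier MV (\<lambda>v. f (q, v)) \<xi>)"

text \<open>Hilbert--Schmidt operators on \<open>L\<^sup>2 M\<close> are identified with their kernels in
  \<open>L\<^sup>2 (M \<Otimes> M)\<close>; \<open>kernel_op M k\<close> is the operator and \<open>kernel_form M k\<close> the sesquilinear form
  given by the kernel \<open>k\<close>.\<close>

definition kernel_op :: "'a measure \<Rightarrow> ('a \<times> 'a \<Rightarrow> complex) \<Rightarrow> ('a \<Rightarrow> complex) \<Rightarrow> 'a \<Rightarrow> complex" where
  "kernel_op M k \<phi> x = (\<integral>y. k (x, y) * \<phi> y \<partial>M)"

definition kernel_form ::
  "'a measure \<Rightarrow> ('a \<times> 'a \<Rightarrow> complex) \<Rightarrow> ('a \<Rightarrow> complex) \<Rightarrow> ('a \<Rightarrow> complex) \<Rightarrow> complex" where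
  "kernel_form M k \<phi>\<^sub>1 \<phi>\<^sub>2 = (\<integral>(x, y). k (x, y) * \<phi>\<^sub>1 y * cnj (\<phi>\<^sub>2 x) \<partial>(M \<Otimes>\<^sub>M M))"


section \<open>The quantization map\<close>

definition proj_rep ::
  "('q::group_add \<Rightarrow> 'v::topological_ab_group_add dual) \<Rightarrow> ('q \<Rightarrow> 'q \<Rightarrow> complex) \<Rightarrow> 'q \<times> 'v \<Rightarrow>
     ('q \<Rightarrow> complex) \<Rightarrow> 'q \<Rightarrow> complex" where
  "proj_rep \<eta> b = (\<lambda>(q, v) \<phi> q\<^sub>0. cnj (pairing (\<eta> q\<^sub>0) v) * b (- q\<^sub>0) q * \<phi> (- q + q\<^sub>0))"

text \<open>The adjoint of \<open>proj_rep \<eta> b (q, v)\<close>.\<close>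

definition proj_rep_adj ::
  "('q::group_add \<Rightarrow> 'v::topological_ab_group_add dual) \<Rightarrow> ('q \<Rightarrow> 'q \<Rightarrow> complex) \<Rightarrow> 'q \<times> 'v \<Rightarrow>
     ('q \<Rightarrow> complex) \<Rightarrow> 'q \<Rightarrow> complex" where
  "proj_rep_adj \<eta> b =
     (\<lambda>(q, v) \<phi> q\<^sub>0. pairing (\<eta> (q + q\<^sub>0)) v * cnj (b (- (q + q\<^sub>0)) q) * \<phi> (q + q\<^sub>0))"

text \<open>The integrands of the inner integral (over \<open>Q\<close>) and of the outer integral (over the extension)
  in the definition of \<open>Op f [\<phi>\<^sub>1, \<phi>\<^sub>2]\<close>.\<close>

definition Op_inner ::
  "'v::topological_ab_group_add measure \<Rightarrow> ('q::group_add \<Rightarrow> 'v \<Rightarrow> 'v) \<Rightarrow> ('q \<Rightarrow> 'v dual) \<Rightarrow>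
     ('q \<Rightarrow> 'q \<Rightarrow> complex) \<Rightarrow> ('q \<Rightarrow> complex) \<Rightarrow> 'q \<times> 'v \<Rightarrow> 'q \<Rightarrow> complex" where
  "Op_inner MV act \<eta> b \<phi>\<^sub>1 g q\<^sub>0 =
     proj_rep_adj \<eta> b g \<phi>\<^sub>1 q\<^sub>0 * complex_of_real (modulus MV act q\<^sub>0 powr (- 1 / 2))"

definition Op_outer ::
  "'q::group_add measure \<Rightarrow> 'v::topological_ab_group_add measure \<Rightarrow> ('q \<Rightarrow> 'v \<Rightarrow> 'v) \<Rightarrow>
     ('q \<Rightarrow> 'v dual) \<Rightarrow> ('q \<Rightarrow> 'q \<Rightarrow> complex) \<Rightarrow> ('q \<times> 'v \<Rightarrow> complex) \<Rightarrow>
     ('q \<Rightarrow> complex) \<Rightarrow> ('q \<Rightarrow> complex) \<Rightarrow> 'q \<times> 'v \<Rightarrow> complex" where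
  "Op_outer MQ MV act \<eta> b f \<phi>\<^sub>1 \<phi>\<^sub>2 g =
     f g * (\<integral>q\<^sub>0. Op_inner MV act \<eta> b \<phi>\<^sub>1 g q\<^sub>0 \<partial>MQ) * cnj (proj_rep_adj \<eta> b g \<phi>\<^sub>2 0)"

definition Op ::
  "'q::group_add measure \<Rightarrow> 'v::topological_ab_group_add measure \<Rightarrow> ('q \<Rightarrow> 'v \<Rightarrow> 'v) \<Rightarrow>
     ('q \<Rightarrow> 'v dual) \<Rightarrow> ('q \<Rightarrow> 'q \<Rightarrow> complex) \<Rightarrow> ('q \<times> 'v \<Rightarrow> complex) \<Rightarrow>
     ('q \<Rightarrow> complex) \<Rightarrow> ('q \<Rightarrow> complex) \<Rightarrow> complex" where
  "Op MQ MV act \<eta> b f \<phi>\<^sub>1 \<phi>\<^sub>2 = (\<integral>g. Op_outer MQ MV act \<eta> b f \<phi>\<^sub>1 \<phi>\<^sub>2 g \<partial>(ext_haar MQ MV act))"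

definition Op_kernel ::
  "'v::topological_ab_group_add measure \<Rightarrow> ('q::group_add \<Rightarrow> 'v \<Rightarrow> 'v) \<Rightarrow> ('q \<Rightarrow> 'v dual) \<Rightarrow>
     ('q \<Rightarrow> 'q \<Rightarrow> complex) \<Rightarrow> ('q \<times> 'v \<Rightarrow> complex) \<Rightarrow> 'q \<times> 'q \<Rightarrow> complex" where
  "Op_kernel MV act \<eta> b f = (\<lambda>(q\<^sub>0, q).
     complex_of_real (modulus MV act (q\<^sub>0 + q) powr (- 1 / 2)) *
     b (- q\<^sub>0) q\<^sub>0 * cnj (b (- q) q\<^sub>0) * partial_fourier MV f (q\<^sub>0, \<eta> q\<^sub>0 - \<eta> q))"

end

theory Submission
  imports Defs
begin

text \<open>
  The kernel map is the composition of two unitaries: the partial Fourier--Plancherel transform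
  \<open>L\<^sup>2(G) \<rightarrow> L\<^sup>2(|q|\<^sup>-\<^sup>1 dq \<otimes> d\<xi>)\<close> and the substitution \<open>\<xi> = \<eta>(q\<^sub>0) - \<eta>(q)\<close>, which carries
  \<open>|q|\<^sup>-\<^sup>1 dq\<close> to \<open>d\<xi>\<close> and is essentially invertible because \<open>\<eta>\<close> is. On integrable functions the
  kernels of \<open>Op (\<lambda>(g) f)\<close> and \<open>\<pi>(g) Op(f) \<pi>(g)\<^sup>*\<close> agree pointwise: the phases cancel since
  \<open>\<psi> = \<partial>b\<close>, once at \<open>\<eta>(q\<^sub>0)\<close> and once at \<open>\<eta>(q)\<close>. The formula for \<open>Op\<close> is Fubini's theorem. That
  \<open>C\<^sub>c(G)\<close> lies in \<open>L\<^sup>1 \<inter> L\<^sup>2\<close> is not immediate, because the topology of \<open>G\<close> is only known through its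
  Borel sets; it needs that a \<open>\<sigma>\<close>-finite invariant Borel measure is finite on compact sets.
\<close>

section \<open>Invariant measures on abelian groups\<close>

text \<open>The Fourier integral is defined only for integrable functions, so all explicit formulas
  live on L^1 \<inter> L^2, which is dense, invariant under translations and contains C_c(G).
  Operators on all of L^2 are then obtained by closing an isometric graph, and identities between
  them extend because both sides are isometries. The exponent -1/2 in the kernel is forced by
  unitarity: its square gives |q_0|^{-1} |q|^{-1}, where the first factor is the density of the Haar
  measure of G and the second is the density with which \<eta> carries dq to d\<xi>. The dual group
  is handled through its Borel sets: measurability is tested on evaluations, and \<sigma>-finiteness
  of d\<xi> is pulled across \<eta>. Accordingly, uniqueness and reflection invariance of Haar
  measure are proved for \<sigma>-finite invariant measures on abelian groups whose operations are
  merely Borel.\<close>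

lemma invariant_measure_exchange:
  fixes M N :: "'a::{ab_group_add, topological_space} measure"
  assumes "sigma_finite_measure M" "sigma_finite_measure N"
    and sets: "sets M = sets borel" "sets N = sets borel"
    and add: "(\<lambda>(x, y). x + y :: 'a) \<in> borel \<Otimes>\<^sub>M borel \<rightarrow>\<^sub>M borel"
    and neg: "(uminus :: 'a \<Rightarrow> 'a) \<in> borel \<rightarrow>\<^sub>M borel"
    and M: "\<And>x. distr M borel (\<lambda>y. x + y) = M" and N: "\<And>x. distr N borel (\<lambda>y. x + y) = N"
    and f [measurable]: "f \<in> borel_measurable borel" and g [measurable]: "g \<in> borel_measurable borel"
  shows "(\<integral>\<^sup>+x. f x \<partial>M) * (\<integral>\<^sup>+y. g y \<partial>N) = (\<integral>\<^sup>+x. g x \<partial>M) * (\<integral>\<^sup>+y. f (- y) \<partial>N)"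
proof -
  interpret M: sigma_finite_measure M by fact
  interpret N: sigma_finite_measure N by fact
  interpret P: pair_sigma_finite M N ..
  note [measurable_cong] = sets
  note [measurable] = neg
  have plus [measurable (raw)]: "(\<lambda>z. p z + q z) \<in> K \<rightarrow>\<^sub>M borel" if "p \<in> K \<rightarrow>\<^sub>M borel" "q \<in> K \<rightarrow>\<^sub>M borel"
    for p q :: "'b \<Rightarrow> 'a" and K :: "'b measure"
    using measurable_compose[OF measurable_Pair[OF that] add] by simp
  have minus [measurable (raw)]: "(\<lambda>z. p z - q z) \<in> K \<rightarrow>\<^sub>M borel" if [measurable]: "p \<in> K \<rightarrow>\<^sub>M borel" "q \<in> K \<rightarrow>\<^sub>M borel"
    for p q :: "'b \<Rightarrow> 'a" and K :: "'b measure"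
    unfolding diff_conv_add_uminus by measurable
  have inv: "(\<integral>\<^sup>+y. h (x + y) \<partial>K) = (\<integral>\<^sup>+y. h y \<partial>K)"
    if [measurable_cong]: "sets K = sets borel" and K: "\<And>x. distr K borel (\<lambda>y. x + y) = K"
      and [measurable]: "h \<in> borel_measurable borel" for h x and K :: "'a measure"
    by (subst (2) K[of x, symmetric], subst nn_integral_distr) auto
  \<comment> \<open>Both sides evaluate the double integral of f(x) g(x + y): translating the inner
    variable y gives the left side, while shifting first x by -y and then y by x gives the right
    side.\<close>
  have "(\<integral>\<^sup>+x. f x \<partial>M) * (\<integral>\<^sup>+y. g y \<partial>N) = (\<integral>\<^sup>+x. f x * (\<integral>\<^sup>+y. g (x + y) \<partial>N) \<partial>M)"
    by (simp add: inv[OF sets(2) N] nn_integral_multc)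
  also have "\<dots> = (\<integral>\<^sup>+x. (\<integral>\<^sup>+y. f x * g (x + y) \<partial>N) \<partial>M)"
    by (simp add: nn_integral_cmult)
  also have "\<dots> = (\<integral>\<^sup>+y. (\<integral>\<^sup>+x. f x * g (x + y) \<partial>M) \<partial>N)"
    by (subst P.Fubini') auto
  also have "\<dots> = (\<integral>\<^sup>+y. (\<integral>\<^sup>+x. f (- y + x) * g (- y + x + y) \<partial>M) \<partial>N)"
    by (rule nn_integral_cong, rule inv[OF sets(1) M, symmetric]) measurable
  also have "\<dots> = (\<integral>\<^sup>+y. (\<integral>\<^sup>+x. f (x - y) * g x \<partial>M) \<partial>N)"
    by (simp add: algebra_simps)
  also have "\<dots> = (\<integral>\<^sup>+x. (\<integral>\<^sup>+y. f (x - y) * g x \<partial>N) \<partial>M)"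
    by (subst P.Fubini') auto
  also have "\<dots> = (\<integral>\<^sup>+x. g x * (\<integral>\<^sup>+y. f (x - y) \<partial>N) \<partial>M)"
    by (subst nn_integral_multc) (auto simp: mult.commute)
  also have "\<dots> = (\<integral>\<^sup>+x. g x * (\<integral>\<^sup>+y. f (- y) \<partial>N) \<partial>M)"
  proof (rule nn_integral_cong)
    fix x
    have "(\<integral>\<^sup>+y. f (x - y) \<partial>N) = (\<integral>\<^sup>+y. f (x - (x + y)) \<partial>N)"
      by (rule inv[OF sets(2) N, symmetric]) measurable
    then show "g x * (\<integral>\<^sup>+y. f (x - y) \<partial>N) = g x * (\<integral>\<^sup>+y. f (- y) \<partial>N)" by simp
  qed
  also have "\<dots> = (\<integral>\<^sup>+x. g x \<partial>M) * (\<integral>\<^sup>+y. f (- y) \<partial>N)"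
    by (rule nn_integral_multc) auto
  finally show ?thesis .
qed

lemma (in sigma_finite_measure) exists_finite_positive:
  assumes "A \<in> sets M" "emeasure M A \<noteq> 0"
  obtains B where "B \<in> sets M" "B \<subseteq> A" "0 < emeasure M B" "emeasure M B < \<infinity>"
proof -
  obtain F :: "nat \<Rightarrow> 'a set" where F: "range F \<subseteq> sets M" "(\<Union>i. F i) = space M" "\<And>i. emeasure M (F i) \<noteq> \<infinity>"
    using sigma_finite by metis
  have "\<exists>i. emeasure M (F i \<inter> A) \<noteq> 0"
  proof (rule ccontr)
    assume "\<not> ?thesis"
    then have "emeasure M (\<Union>i. F i \<inter> A) = 0"
      using F assms by (intro emeasure_UN_eq_0) auto
    moreover have "(\<Union>i. F i \<inter> A) = A" using F(2) sets.sets_into_space[OF assms(1)] by auto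
    ultimately show False using assms by simp
  qed
  then obtain i where i: "emeasure M (F i \<inter> A) \<noteq> 0" ..
  have "emeasure M (F i \<inter> A) \<le> emeasure M (F i)" using F assms by (intro emeasure_mono) auto
  then show ?thesis using i F assms(1)
    by (intro that[of "F i \<inter> A"]) (auto simp: less_top zero_less_iff_neq_zero top.not_eq_extremum intro: le_less_trans)
qed

text \<open>Exchanging \<open>M\<close> with itself against the indicator of a set of positive
  finite measure leaves a finite nonzero factor that cancels. The zero measure, which the hypotheses
  admit, is treated apart.\<close>

lemma invariant_measure_uminus:
  fixes M :: "'a::{ab_group_add, topological_space} measure"
  assumes "sigma_finite_measure M" "sets M = sets borel"
    and add: "(\<lambda>(x, y). x + y :: 'a) \<in> borel \<Otimes>\<^sub>M borel \<rightarrow>\<^sub>M borel"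
    and neg: "(uminus :: 'a \<Rightarrow> 'a) \<in> borel \<rightarrow>\<^sub>M borel"
    and M: "\<And>x. distr M borel (\<lambda>y. x + y) = M"
    and f: "f \<in> borel_measurable borel"
  shows "(\<integral>\<^sup>+x. f (- x) \<partial>M) = (\<integral>\<^sup>+x. f x \<partial>M)"
proof (cases "emeasure M (space M) = 0")
  case True
  then have "AE x in M. P x" for P by (intro emeasure_0_AE)
  then have "(\<integral>\<^sup>+x. h x \<partial>M) = 0" for h
    by (subst nn_integral_cong_AE[where v="\<lambda>_. 0"]) auto
  then show ?thesis by simp
next
  case False
  then obtain B where B: "B \<in> sets M" "0 < emeasure M B" "emeasure M B < \<infinity>"
    using sigma_finite_measure.exists_finite_positive[OF assms(1) sets.top] by metis
  have "(\<integral>\<^sup>+x. f x \<partial>M) * (\<integral>\<^sup>+x. indicator B x \<partial>M) = (\<integral>\<^sup>+x. indicator B x \<partial>M) * (\<integral>\<^sup>+x. f (- x) \<partial>M)"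
    using B(1) assms(2) by (intro invariant_measure_exchange[OF assms(1,1,2,2) add neg M M f]) auto
  then have "emeasure M B * (\<integral>\<^sup>+x. f (- x) \<partial>M) = emeasure M B * (\<integral>\<^sup>+x. f x \<partial>M)"
    using B(1) by (simp add: mult.commute)
  then show ?thesis using B(2,3) unfolding ennreal_mult_cancel_left by auto
qed

text \<open>Once \<open>invariant_measure_uminus\<close> has removed the reflection, the exchange
  identity is symmetric in f and g, so the ratio of the two integrals is the same for all functions.
  The constant is N(A) / M(A) for a set A of positive finite \<open>M\<close>-measure.\<close>

lemma invariant_measure_unique:
  fixes M N :: "'a::{ab_group_add, topological_space} measure"
  assumes "sigma_finite_measure M" "sigma_finite_measure N"
    and sets: "sets M = sets borel" "sets N = sets borel"
    and add: "(\<lambda>(x, y). x + y :: 'a) \<in> borel \<Otimes>\<^sub>M borel \<rightarrow>\<^sub>M borel"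
    and neg: "(uminus :: 'a \<Rightarrow> 'a) \<in> borel \<rightarrow>\<^sub>M borel"
    and M: "\<And>x. distr M borel (\<lambda>y. x + y) = M" and N: "\<And>x. distr N borel (\<lambda>y. x + y) = N"
    and nz: "emeasure M UNIV \<noteq> 0" "emeasure N UNIV \<noteq> 0"
  obtains c :: real where "c > 0"
    "\<And>f. f \<in> borel_measurable borel \<Longrightarrow> (\<integral>\<^sup>+x. f x \<partial>N) = ennreal c * (\<integral>\<^sup>+x. f x \<partial>M)"
proof -
  have eq: "(\<integral>\<^sup>+x. f x \<partial>M) * (\<integral>\<^sup>+y. g y \<partial>N) = (\<integral>\<^sup>+x. g x \<partial>M) * (\<integral>\<^sup>+y. f y \<partial>N)"
    if "f \<in> borel_measurable borel" "g \<in> borel_measurable borel" for f g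
    using invariant_measure_exchange[OF assms(1-8) that] invariant_measure_uminus[OF assms(2,4) add neg N that(1)]
    by simp
  obtain A where A: "A \<in> sets M" "0 < emeasure M A" "emeasure M A < \<infinity>"
    using sigma_finite_measure.exists_finite_positive[OF assms(1), of UNIV] nz sets by auto
  obtain B where B: "B \<in> sets N" "0 < emeasure N B" "emeasure N B < \<infinity>"
    using sigma_finite_measure.exists_finite_positive[OF assms(2), of UNIV] nz sets by auto
  \<comment> \<open>\<open>B\<close> serves as a comparison set: the left side is positive and
    finite by the choice of \<open>A\<close> and \<open>B\<close>, hence N(A) on the right is
    neither 0 nor infinite.\<close>
  have AB: "emeasure M A * emeasure N B = emeasure M B * emeasure N A"
    using eq[of "indicator A" "indicator B"] A B sets by simp
  have pos: "emeasure M A * emeasure N B > 0" using A B by (simp add: ennreal_zero_less_mult_iff)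
  have fin: "emeasure M A * emeasure N B < top" using A B by (simp add: ennreal_mult_less_top)
  have NA: "0 < emeasure N A" "emeasure N A < top"
    using pos fin unfolding AB by (auto simp: ennreal_zero_less_mult_iff ennreal_mult_less_top)
  obtain a where a: "emeasure M A = ennreal a" "a > 0" using A by (cases "emeasure M A") auto
  obtain n where n: "emeasure N A = ennreal n" "n > 0" using NA by (cases "emeasure N A") auto
  show ?thesis
  proof (rule that[of "n / a"])
    show "n / a > 0" using a n by simp
    fix f :: "'a \<Rightarrow> ennreal" assume f: "f \<in> borel_measurable borel"
    have "ennreal a * (\<integral>\<^sup>+x. f x \<partial>N) = (\<integral>\<^sup>+x. f x \<partial>M) * ennreal n"
      using eq[OF _ f, of "indicator A"] A(1) sets by (simp add: a n)
    also have "\<dots> = ennreal a * (ennreal (n / a) * (\<integral>\<^sup>+x. f x \<partial>M))"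
      using a n by (simp add: mult.assoc[symmetric] ennreal_mult[symmetric] mult.commute)
    finally show "(\<integral>\<^sup>+x. f x \<partial>N) = ennreal (n / a) * (\<integral>\<^sup>+x. f x \<partial>M)"
      using a by (simp add: ennreal_mult_cancel_left)
  qed
qed

section \<open>Continuous actions and the modulus\<close>

lemma locally_compact_nhdE:
  fixes W :: "'a::t2_space set"
  assumes "locally_compact_space (euclidean :: 'a topology)" "open W" "x \<in> W"
  obtains U K where "open U" "compact K" "x \<in> U" "U \<subseteq> K" "K \<subseteq> W"
proof -
  have "Hausdorff_space (euclidean :: 'a topology)"
    unfolding Hausdorff_space_def disjnt_def by simp (metis hausdorff)
  then have "neighbourhood_base_of (compactin euclidean) (euclidean :: 'a topology)"
    using locally_compact_space_neighbourhood_base[of "euclidean :: 'a topology"] assms(1) by simp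
  then show ?thesis using assms(2,3) that
    by (simp add: neighbourhood_base_of) (metis)
qed

text \<open>Every point has a basic neighbourhood inside a compact set, so the countably many basic
  open sets of finite measure already cover.\<close>

lemma sigma_finite_left_haar_measure:
  fixes M :: "'a::{group_add, second_countable_topology, t2_space} measure"
  assumes lc: "locally_compact_space (euclidean :: 'a topology)" and M: "left_haar_measure M"
  shows "sigma_finite_measure M"
proof
  have sets: "sets M = sets borel" and fin: "\<And>K. compact K \<Longrightarrow> emeasure M K < \<infinity>"
    using M by (auto simp: left_haar_measure_def)
  obtain \<B> :: "'a set set" where \<B>: "countable \<B>" "topological_basis \<B>"
    using ex_countable_basis by auto
  let ?A = "{U \<in> \<B>. emeasure M U < \<infinity>}"
  have cov: "x \<in> \<Union>?A" for x
  proof -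
    obtain U K where UK: "open U" "compact K" "x \<in> U" "U \<subseteq> K"
      using locally_compact_nhdE[OF lc open_UNIV UNIV_I] by metis
    obtain V where V: "V \<in> \<B>" "x \<in> V" "V \<subseteq> U"
      using topological_basisE[OF \<B>(2) UK(1,3)] by metis
    have "emeasure M V \<le> emeasure M K"
      using V UK sets by (intro emeasure_mono) (auto intro: borel_compact)
    then show ?thesis using V fin[OF UK(2)] by auto
  qed
  have sub: "?A \<subseteq> sets M"
    using topological_basis_open[OF \<B>(2)] sets by auto
  show "\<exists>A. countable A \<and> A \<subseteq> sets M \<and> \<Union>A = space M \<and> (\<forall>a\<in>A. emeasure M a \<noteq> \<infinity>)"
  proof (intro exI conjI)
    show "countable ?A" using \<B>(1) by simp
    show "?A \<subseteq> sets M" by (rule sub)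
    have "space M = UNIV" using sets_eq_imp_space_eq[OF sets] by simp
    then show "\<Union>?A = space M" using cov by blast
  qed auto
qed

text \<open>Local compactness upgrades continuity into the automorphism group to joint continuity:
  near (q, v) one keeps v in a compact neighbourhood K with q K inside W, and h K \<subseteq> W is
  an open condition on the automorphism h.\<close>

lemma continuous_action_continuous_on:
  fixes act :: "'q::topological_group_add \<Rightarrow> 'v::{topological_ab_group_add, t2_space} \<Rightarrow> 'v"
  assumes lc: "locally_compact_space (euclidean :: 'v topology)" and act: "continuous_action act"
  shows "continuous_on UNIV (\<lambda>(q, v). act q v)"
proof (subst continuous_on_open_vimage, simp, intro allI impI)
  fix W :: "'v set" assume W: "open W"
  show "open ((\<lambda>(q, v). act q v) -` W \<inter> UNIV)"
  proof (subst open_subopen, intro ballI)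
    fix z assume z: "z \<in> (\<lambda>(q, v). act q v) -` W \<inter> UNIV"
    obtain q v where qv: "z = (q, v)" by (cases z)
    have "continuous_on UNIV (act q)" using continuous_action_Aut[OF act, of q] by (simp add: Aut_def)
    then have "open (act q -` W)" using W by (simp add: open_vimage)
    then obtain U K where UK: "open U" "compact K" "v \<in> U" "U \<subseteq> K" "K \<subseteq> act q -` W"
      using locally_compact_nhdE[OF lc, of "act q -` W" v] z qv by auto
    let ?S = "{h \<in> Aut. h ` K \<subseteq> W}"
    have "openin Aut_topology ?S"
      unfolding Aut_topology_def using UK(2) W by (intro topology_generated_by_Basis) blast
    then have "open {r. act r \<in> ?S}"
      using act openin_continuous_map_preimage[of euclidean Aut_topology act ?S]
      by (auto simp: continuous_action_def)
    moreover have "q \<in> {r. act r \<in> ?S}"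
      using continuous_action_Aut[OF act, of q] UK(5) by auto
    moreover have "p \<in> (\<lambda>(q, v). act q v) -` W" if "p \<in> {r. act r \<in> ?S} \<times> U" for p
    proof (cases p)
      case (Pair r u)
      then have "act r ` K \<subseteq> W" "u \<in> K" using that UK(4) by blast+
      then have "act r u \<in> W" by blast
      then show ?thesis by (simp add: Pair)
    qed
    ultimately show "\<exists>T. open T \<and> z \<in> T \<and> T \<subseteq> (\<lambda>(q, v). act q v) -` W \<inter> UNIV"
      using UK(1,3) qv
      by (intro exI[of _ "{r. act r \<in> ?S} \<times> U"] conjI subsetI) (simp_all add: open_Times)
  qed
qed

lemma borel_measurable_group_add:
  "(\<lambda>(x, y). x + y :: 'a::{topological_group_add, second_countable_topology}) \<in> borel \<Otimes>\<^sub>M borel \<rightarrow>\<^sub>M borel"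
  "(uminus :: 'a \<Rightarrow> 'a) \<in> borel \<rightarrow>\<^sub>M borel"
  by (measurable, rule borel_measurable_continuous_onI, intro continuous_intros)

locale haar_action =
  fixes act :: "'q::{topological_group_add, second_countable_topology, t2_space} \<Rightarrow>
                'v::{topological_ab_group_add, second_countable_topology, t2_space} \<Rightarrow> 'v"
    and MQ :: "'q measure" and MV :: "'v measure"
  assumes lcQ: "locally_compact_space (euclidean :: 'q topology)"
    and lcV: "locally_compact_space (euclidean :: 'v topology)"
    and act: "continuous_action act"
    and MQ: "left_haar_measure MQ" and MV: "left_haar_measure MV"
begin

sublocale Q: sigma_finite_measure MQ by (rule sigma_finite_left_haar_measure[OF lcQ MQ])
sublocale V: sigma_finite_measure MV by (rule sigma_finite_left_haar_measure[OF lcV MV])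

lemma sets_Q [measurable_cong, simp]: "sets MQ = sets borel"
  and sets_V [measurable_cong, simp]: "sets MV = sets borel"
  using MQ MV by (auto simp: left_haar_measure_def)

lemma space_Q [simp]: "space MQ = UNIV" and space_V [simp]: "space MV = UNIV"
  using sets_eq_imp_space_eq[OF sets_Q] sets_eq_imp_space_eq[OF sets_V] by auto

lemmas act_simps = continuous_action_add[OF act]

lemma act_zero: "act q 0 = 0"
  using act_simps(1)[of q 0 0] by simp

lemma act_uminus_act [simp]: "act (- q) (act q v) = v" "act q (act (- q) v) = v"
  by (simp_all add: act_simps(2)[symmetric] act_simps(3))

lemma act_minus: "act q (- v) = - act q v"
  using act_simps(1)[of q v "- v"] by (simp add: act_zero eq_neg_iff_add_eq_0 add.commute)

lemma act_diff: "act q (v - w) = act q v - act q w"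
  using act_simps(1)[of q v "- w"] by (simp add: act_minus)

lemma measurable_act [measurable (raw)]:
  assumes [measurable]: "p \<in> K \<rightarrow>\<^sub>M borel" "f \<in> K \<rightarrow>\<^sub>M borel"
  shows "(\<lambda>z. act (p z) (f z)) \<in> K \<rightarrow>\<^sub>M borel"
proof -
  have "(\<lambda>(q, v). act q v) \<in> borel \<Otimes>\<^sub>M borel \<rightarrow>\<^sub>M borel"
    unfolding borel_prod
    by (rule borel_measurable_continuous_onI[OF continuous_action_continuous_on[OF lcV act]])
  from measurable_compose[OF measurable_Pair[OF assms] this] show ?thesis by simp
qed

lemma measurable_uminus_group [measurable (raw)]:
  fixes p :: "'a \<Rightarrow> 'b::{topological_group_add, second_countable_topology}"
  assumes "p \<in> K \<rightarrow>\<^sub>M borel"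
  shows "(\<lambda>z. - p z) \<in> K \<rightarrow>\<^sub>M borel"
  using measurable_compose[OF assms borel_measurable_group_add(2)] .

lemma measurable_diff_group [measurable (raw)]:
  fixes p :: "'a \<Rightarrow> 'b::{topological_group_add, second_countable_topology}"
  assumes [measurable]: "p \<in> K \<rightarrow>\<^sub>M borel" "r \<in> K \<rightarrow>\<^sub>M borel"
  shows "(\<lambda>z. p z - r z) \<in> K \<rightarrow>\<^sub>M borel"
  unfolding diff_conv_add_uminus by measurable

lemma distr_Q: "distr MQ borel ((+) q) = MQ" and distr_V: "distr MV borel ((+) v) = MV"
  using MQ MV by (auto simp: left_haar_measure_def)

lemma nn_integral_translate_Q:
  assumes [measurable]: "f \<in> borel_measurable borel"
  shows "(\<integral>\<^sup>+q. f (r + q) \<partial>MQ) = (\<integral>\<^sup>+q. f q \<partial>MQ)"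
  by (subst (2) distr_Q[of r, symmetric], subst nn_integral_distr) auto

lemma nn_integral_translate_V:
  assumes [measurable]: "f \<in> borel_measurable borel"
  shows "(\<integral>\<^sup>+v. f (w + v) \<partial>MV) = (\<integral>\<^sup>+v. f v \<partial>MV)"
  by (subst (2) distr_V[of w, symmetric], subst nn_integral_distr) auto

lemma integral_translate_Q:
  fixes f :: "'q \<Rightarrow> complex"
  assumes [measurable]: "f \<in> borel_measurable borel"
  shows "(\<integral>q. f (r + q) \<partial>MQ) = (\<integral>q. f q \<partial>MQ)"
  by (subst (2) distr_Q[of r, symmetric], subst integral_distr) auto

lemma integral_translate_V:
  fixes f :: "'v \<Rightarrow> complex"
  assumes [measurable]: "f \<in> borel_measurable borel"
  shows "(\<integral>v. f (w + v) \<partial>MV) = (\<integral>v. f v \<partial>MV)"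
  by (subst (2) distr_V[of w, symmetric], subst integral_distr) auto

text \<open>This justifies the definite description in \<open>modulus\<close>. The image of dv under
  \<open>act q\<close> is again invariant, because w + q v = q (q^{-1} w + v), so it is a multiple
  of dv.\<close>

lemma modulus_ex1:
  "\<exists>!c. c > 0 \<and> (\<forall>f\<in>borel_measurable borel.
     (\<integral>\<^sup>+ v. f (act q v) \<partial>MV) = ennreal (inverse c) * (\<integral>\<^sup>+ v. f v \<partial>MV))"
proof -
  let ?N = "distr MV borel (act q)"
  have N: "(\<integral>\<^sup>+v. f v \<partial>?N) = (\<integral>\<^sup>+v. f (act q v) \<partial>MV)" if [measurable]: "f \<in> borel_measurable borel"
    for f :: "'v \<Rightarrow> ennreal"
    by (subst nn_integral_distr) auto
  have sf: "sigma_finite_measure ?N"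
  proof (rule sigma_finite_measure.intro, goal_cases)
    case 1
    obtain A :: "nat \<Rightarrow> 'v set" where A: "range A \<subseteq> sets MV" "(\<Union>i. A i) = space MV" "\<And>i. emeasure MV (A i) \<noteq> \<infinity>"
      using V.sigma_finite by metis
    \<comment> \<open>The image of an exhaustion under \<open>act q\<close> consists of Borel sets,
      being a preimage under \<open>act (- q)\<close>, and its measures for the image measure are
      those of the original sets.\<close>
    have 1: "act q ` A i = act (- q) -` A i" for i
    proof (intro set_eqI iffI)
      fix v assume "v \<in> act (- q) -` A i"
      then show "v \<in> act q ` A i" using act_uminus_act(2)[of q v] by (metis image_eqI vimageD)
    qed auto
    then have 2: "act q ` A i \<in> sets borel" for i
      using measurable_sets[of "act (- q)" borel borel "A i"] A(1) by auto
    have "act q -` (act q ` A i) = A i" for i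
    proof (intro set_eqI iffI)
      fix v assume "v \<in> act q -` (act q ` A i)"
      then show "v \<in> A i" by (metis act_uminus_act(1) imageE vimageE)
    qed auto
    then have 3: "emeasure ?N (act q ` A i) = emeasure MV (A i)" for i
      by (subst emeasure_distr) (use 2 in auto)
    have "(\<Union>i. act q ` A i) = act q ` UNIV" unfolding image_UN[symmetric] A(2) space_V ..
    also have "\<dots> = UNIV" by (metis act_uminus_act(2) surjI)
    finally show ?case
      using A(3) by (intro exI[of _ "range (\<lambda>i. act q ` A i)"] conjI) (auto simp: 2 3)
  qed
  have inv: "distr ?N borel ((+) w) = ?N" for w
  proof -
    have "distr ?N borel ((+) w) = distr MV borel (\<lambda>v. w + act q v)"
      by (subst distr_distr) (auto simp: comp_def)
    also have "(\<lambda>v. w + act q v) = act q \<circ> (\<lambda>v. act (- q) w + v)"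
      by (auto simp: act_simps(1))
    also have "distr MV borel \<dots> = distr (distr MV borel (\<lambda>v. act (- q) w + v)) borel (act q)"
      by (subst distr_distr) auto
    finally show ?thesis by (simp add: distr_V)
  qed
  have nz: "emeasure MV UNIV \<noteq> 0" using MV by (simp add: left_haar_measure_def)
  have nzN: "emeasure ?N UNIV \<noteq> 0"
    using nz by (subst emeasure_distr) auto
  obtain c :: real where c: "c > 0"
    "\<And>f. f \<in> borel_measurable borel \<Longrightarrow> (\<integral>\<^sup>+x. f x \<partial>?N) = ennreal c * (\<integral>\<^sup>+x. f x \<partial>MV)"
    by (rule invariant_measure_unique[OF V.sigma_finite_measure_axioms sf sets_V sets_distr
          borel_measurable_group_add distr_V inv nz nzN]) (rule that)
  \<comment> \<open>One set of positive finite measure determines the constant and so gives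
    uniqueness.\<close>
  obtain B where B: "B \<in> sets MV" "0 < emeasure MV B" "emeasure MV B < \<infinity>"
    using V.exists_finite_positive[OF _ nz] by (metis sets.top space_V)
  have key: "(\<integral>\<^sup>+ v. f (act q v) \<partial>MV) = ennreal c * (\<integral>\<^sup>+ v. f v \<partial>MV)"
    if "f \<in> borel_measurable borel" for f
    using N[OF that] c(2)[OF that] by (rule trans[OF sym])
  show ?thesis
  proof (rule ex1I[of _ "inverse c"])
    show "inverse c > 0 \<and> (\<forall>f\<in>borel_measurable borel.
     (\<integral>\<^sup>+ v. f (act q v) \<partial>MV) = ennreal (inverse (inverse c)) * (\<integral>\<^sup>+ v. f v \<partial>MV))"
      using c(1) key by simp
    fix d assume d: "d > 0 \<and> (\<forall>f\<in>borel_measurable borel.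
     (\<integral>\<^sup>+ v. f (act q v) \<partial>MV) = ennreal (inverse d) * (\<integral>\<^sup>+ v. f v \<partial>MV))"
    have ind: "indicator B \<in> borel_measurable (borel :: 'v measure)" using B(1) by simp
    have "ennreal (inverse d) * emeasure MV B = (\<integral>\<^sup>+ v. indicator B (act q v) \<partial>MV)"
      using d ind B(1) by simp
    also have "\<dots> = ennreal c * emeasure MV B"
      using key[OF ind] B(1) by simp
    finally have "ennreal (inverse d) * emeasure MV B = ennreal c * emeasure MV B" .
    then have "emeasure MV B * ennreal (inverse d) = emeasure MV B * ennreal c"
      by (simp add: mult.commute)
    then have "ennreal (inverse d) = ennreal c"
      using B(2,3) unfolding ennreal_mult_cancel_left by auto
    then have "inverse d = c"
      using d c(1) by (subst (asm) ennreal_inj) auto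
    then show "d = inverse c" by auto
  qed
qed

abbreviation "m \<equiv> modulus MV act"

lemma modulus_pos [simp]: "m q > 0"
  and nn_integral_act: "f \<in> borel_measurable borel \<Longrightarrow>
    (\<integral>\<^sup>+ v. f (act q v) \<partial>MV) = ennreal (inverse (m q)) * (\<integral>\<^sup>+ v. f v \<partial>MV)"
proof -
  have *: "m q > 0 \<and> (\<forall>f\<in>borel_measurable borel.
     (\<integral>\<^sup>+ v. f (act q v) \<partial>MV) = ennreal (inverse (m q)) * (\<integral>\<^sup>+ v. f v \<partial>MV))"
    unfolding modulus_def by (rule theI'[OF modulus_ex1])
  show "m q > 0" using * by (rule conjunct1)
  show "(\<integral>\<^sup>+ v. f (act q v) \<partial>MV) = ennreal (inverse (m q)) * (\<integral>\<^sup>+ v. f v \<partial>MV)"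
    if "f \<in> borel_measurable borel" using conjunct2[OF *] that by (rule bspec)
qed

lemma modulus_nonneg [simp]: "m q \<ge> 0" and modulus_neq_0 [simp]: "m q \<noteq> 0"
  using modulus_pos[of q] by linarith+

lemma modulusI:
  assumes "c > 0" "\<And>f. f \<in> borel_measurable borel \<Longrightarrow>
    (\<integral>\<^sup>+ v. f (act q v) \<partial>MV) = ennreal (inverse c) * (\<integral>\<^sup>+ v. f v \<partial>MV)"
  shows "m q = c"
  unfolding modulus_def
  by (rule the1_equality[OF modulus_ex1]) (use assms in blast)

lemma modulus_add: "m (q + r) = m q * m r"
proof (rule modulusI)
  fix f :: "'v \<Rightarrow> ennreal" assume [measurable]: "f \<in> borel_measurable borel"
  have "(\<integral>\<^sup>+ v. f (act (q + r) v) \<partial>MV) = (\<integral>\<^sup>+ v. (\<lambda>w. f (act q w)) (act r v) \<partial>MV)"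
    by (simp add: act_simps)
  also have "\<dots> = ennreal (inverse (m r)) * (ennreal (inverse (m q)) * (\<integral>\<^sup>+ v. f v \<partial>MV))"
    by (subst nn_integral_act) (simp_all add: nn_integral_act)
  finally show "(\<integral>\<^sup>+ v. f (act (q + r) v) \<partial>MV) = ennreal (inverse (m q * m r)) * (\<integral>\<^sup>+ v. f v \<partial>MV)"
    by (simp add: ennreal_mult mult_ac)
qed simp

lemma modulus_0 [simp]: "m 0 = 1"
  using modulus_add[of 0 0] by simp

lemma modulus_uminus: "m (- q) = inverse (m q)"
  using modulus_add[of q "- q"] by (simp add: field_simps)

lemma integral_act:
  fixes f :: "'v \<Rightarrow> complex"
  assumes [measurable]: "f \<in> borel_measurable borel"
  shows "(\<integral>v. f (act q v) \<partial>MV) = of_real (inverse (m q)) * (\<integral>v. f v \<partial>MV)"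
proof -
  have "distr MV borel (act q) = density MV (\<lambda>_. ennreal (inverse (m q)))"
  proof (rule measure_eqI)
    fix A assume "A \<in> sets (distr MV borel (act q))"
    then have [measurable]: "A \<in> sets borel" by simp
    show "emeasure (distr MV borel (act q)) A = emeasure (density MV (\<lambda>_. ennreal (inverse (m q)))) A"
      using nn_integral_act[of "indicator A" q]
      by (subst nn_integral_indicator[symmetric], simp, subst nn_integral_distr)
        (auto simp: emeasure_density nn_integral_cmult_indicator)
  qed auto
  moreover have "(\<integral>v. f (act q v) \<partial>MV) = (\<integral>v. f v \<partial>(distr MV borel (act q)))"
    by (subst integral_distr) auto
  ultimately show ?thesis
    by (simp add: integral_density scaleR_conv_of_real)
qed

text \<open>Measuring the preimage of one fixed set of positive finite measure recovers
  \<open>m q\<close>, and this measure is a partial integral of a jointly measurable function, hence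
  Borel in q.\<close>

lemma borel_measurable_modulus [measurable]: "m \<in> borel_measurable borel"
proof -
  have nz: "emeasure MV UNIV \<noteq> 0" using MV by (simp add: left_haar_measure_def)
  obtain B where B [measurable]: "B \<in> sets MV" and "0 < emeasure MV B" "emeasure MV B < \<infinity>"
    using V.exists_finite_positive[OF _ nz] by (metis sets.top space_V)
  then obtain r where r: "emeasure MV B = ennreal r" "r > 0" by (cases "emeasure MV B") auto
  have eq: "m q = r / enn2real (\<integral>\<^sup>+ v. indicator B (act q v) \<partial>MV)" for q
    using nn_integral_act[of "indicator B" q] B r
    by (simp add: ennreal_mult[symmetric] enn2real_ennreal) (simp add: field_simps)
  show ?thesis unfolding eq by measurable
qed

text \<open>Stands in for continuity of the modulus. If U is an open neighbourhood of 0 inside a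
  compact set C, then q U lies in the compact set L C for all q in L, so |q| is at most the quotient
  of the measures of L C and U. Applying this to K and to its inverse gives both bounds.\<close>

lemma modulus_bounded:
  assumes "compact K"
  obtains c where "c > 0" "\<And>q. q \<in> K \<Longrightarrow> m q \<le> c" "\<And>q. q \<in> K \<Longrightarrow> inverse (m q) \<le> c"
proof -
  have *: "\<exists>c. \<forall>q\<in>L. m q \<le> c" if L: "compact L" for L
  proof -
    obtain U C where UC: "open U" "compact C" "(0::'v) \<in> U" "U \<subseteq> C"
      using locally_compact_nhdE[OF lcV open_UNIV UNIV_I] by metis
    \<comment> \<open>A null neighbourhood of 0 would make the whole group null: its translates are
      open and null, and by the Lindeloef property countably many of them cover.\<close>
    have nz: "emeasure MV U \<noteq> 0"
    proof
      assume 0: "emeasure MV U = 0"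
      have tr: "emeasure MV ((\<lambda>u. v + u) -` U) = 0" for v
        using emeasure_distr[of "(+) v" MV borel U] UC(1) distr_V[of v] 0 by simp
      let ?F = "(\<lambda>v. (\<lambda>u. v + u) -` U) ` UNIV"
      have op: "open S" if S: "S \<in> ?F" for S
        proof -
        obtain v where v: "S = (+) v -` U" using S by blast
        have "continuous_on UNIV ((+) v)" by (intro continuous_intros)
        then show ?thesis unfolding v using UC(1) by (rule open_vimage[rotated])
      qed
      obtain F where F: "F \<subseteq> ?F" "countable F" "\<Union>F = \<Union>?F"
        using Lindelof[of ?F] op by metis
      have "v \<in> (+) (- v) -` U" for v using UC(3) by simp
      then have "\<Union>?F = UNIV" by blast
      moreover have "emeasure MV (\<Union>F) = 0"
      proof -
        have "\<Union>F \<in> null_sets MV"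
        proof -
          have "S \<in> null_sets MV" if "S \<in> F" for S
            using that F(1) tr op[of S] by (auto simp: null_sets_def)
          then show ?thesis using null_sets_UN'[OF F(2), of "\<lambda>x. x" MV] by simp
        qed
        then show ?thesis by auto
      qed
      ultimately show False using F MV by (simp add: left_haar_measure_def)
    qed
    let ?D = "(\<lambda>(q, v). act q v) ` (L \<times> C)"
    have D: "compact ?D"
      using continuous_on_subset[OF continuous_action_continuous_on[OF lcV act]]
      by (intro compact_continuous_image compact_Times L UC) auto
    then have fin: "emeasure MV ?D < \<infinity>" "?D \<in> sets borel"
      using MV by (simp_all add: left_haar_measure_def borel_compact)
    have *: "ennreal (m q) * emeasure MV U \<le> emeasure MV ?D" if q: "q \<in> L" for q
    proof -
      have "ennreal (m q) * emeasure MV U = (\<integral>\<^sup>+ v. indicator U (act (- q) v) \<partial>MV)"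
        using nn_integral_act[of "indicator U" "- q"] UC(1) by (simp add: modulus_uminus)
      also have "\<dots> \<le> (\<integral>\<^sup>+ v. indicator ?D v \<partial>MV)"
      proof (rule nn_integral_mono)
        fix v
        have "v \<in> ?D" if "act (- q) v \<in> U"
          by (rule image_eqI[of _ _ "(q, act (- q) v)"]) (use that q UC(4) in auto)
        then show "indicator U (act (- q) v) \<le> (indicator ?D v :: ennreal)"
          by (simp add: indicator_def)
      qed
      finally show ?thesis using fin by simp
    qed
    obtain d where d: "emeasure MV ?D = ennreal d" "d \<ge> 0" using fin by (cases "emeasure MV ?D") auto
    have "emeasure MV U \<le> emeasure MV C" using UC by (intro emeasure_mono) (auto intro: borel_compact)
    then have "emeasure MV U < \<infinity>" using MV UC(2) by (auto simp: left_haar_measure_def intro: le_less_trans)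
    then obtain u where u: "emeasure MV U = ennreal u" "u > 0" using nz
      by (cases "emeasure MV U") (auto simp: ennreal_eq_0_iff not_le)
    have "m q \<le> d / u" if "q \<in> L" for q
      using *[OF that] d u by (simp add: ennreal_mult[symmetric] field_simps)
    then show ?thesis by blast
  qed
  obtain c where c: "\<forall>q\<in>K. m q \<le> c" using *[OF assms] ..
  have "compact (uminus ` K)" by (intro compact_continuous_image assms continuous_intros)
  from *[OF this] obtain d where d: "\<forall>q\<in>uminus ` K. m q \<le> d" ..
  \<comment> \<open>The maximum with 1 keeps the constant positive even if the two bounds are not,
    as may happen for empty \<open>K\<close>.\<close>
  show ?thesis
  proof (rule that[of "max 1 (max c d)"])
    fix q assume q: "q \<in> K"
    show "m q \<le> max 1 (max c d)" using bspec[OF c q] by simp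
    show "inverse (m q) \<le> max 1 (max c d)" using bspec[OF d imageI[OF q]] by (simp add: modulus_uminus)
  qed simp
qed

end

section \<open>Borel structure of the dual\<close>

text \<open>With \<open>B\<close> compact and \<open>C\<close> open this is a subbasic set of the
  compact-open topology; with \<open>B\<close> open and \<open>C\<close> closed it is a condition on
  countably many evaluations. Both readings are used.\<close>

definition dual_nbhd :: "'v::topological_ab_group_add set \<Rightarrow> complex set \<Rightarrow> 'v dual set" where
  "dual_nbhd B C = {\<xi>. pairing \<xi> ` B \<subseteq> C}"

text \<open>Replaces a condition on an arbitrary open set by one taken from countable bases. The
  passage through a closed ball leaves room for the closure of \<open>C\<close> inside
  \<open>W\<close>.\<close>

lemma pairing_nbhd_ex:
  fixes v :: "'v::topological_ab_group_add"
  assumes \<B>: "topological_basis \<B>" and \<C>: "topological_basis \<C>"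
    and W: "open W" "pairing \<xi> v \<in> W"
  shows "\<exists>B\<in>\<B>. \<exists>C\<in>\<C>. v \<in> B \<and> closure C \<subseteq> W \<and> \<xi> \<in> dual_nbhd B (closure C)"
proof -
  obtain e where e: "e > 0" "cball (pairing \<xi> v) e \<subseteq> W"
    using W open_contains_cball by metis
  obtain C where C: "C \<in> \<C>" "pairing \<xi> v \<in> C" "C \<subseteq> ball (pairing \<xi> v) e"
    using topological_basisE[OF \<C> open_ball, of "pairing \<xi> v" "pairing \<xi> v" e] e(1)
    by (metis centre_in_ball)
  have cl: "closure C \<subseteq> W"
    using closure_minimal[of C "cball (pairing \<xi> v) e"] C(3) e(2) ball_subset_cball[of "pairing \<xi> v" e]
    by (meson closed_cball order_trans)
  have "open (pairing \<xi> -` C)"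
    using topological_basis_open[OF \<C> C(1)] continuous_on_pairing[of \<xi>] by (rule open_vimage)
  then obtain B where B: "B \<in> \<B>" "v \<in> B" "B \<subseteq> pairing \<xi> -` C"
    by (rule topological_basisE[OF \<B>]) (use C(2) in auto)
  have "\<xi> \<in> dual_nbhd B (closure C)"
    using B(3) closure_subset[of C] by (auto simp: dual_nbhd_def)
  then show ?thesis using B C cl by blast
qed

lemma open_dual_nbhd: "compact K \<Longrightarrow> open W \<Longrightarrow> open (dual_nbhd K W)"
  unfolding open_dual_def dual_nbhd_def by (rule generate_topology.Basis) blast

lemma measurable_pairing_left: "(\<lambda>\<xi>. pairing \<xi> v) \<in> borel_measurable borel"
proof (rule borel_measurableI)
  fix W :: "complex set" assume "open W"
  moreover have "(\<lambda>\<xi>. pairing \<xi> v) -` W \<inter> space borel = dual_nbhd {v} W"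
    by (auto simp: dual_nbhd_def)
  ultimately show "(\<lambda>\<xi>. pairing \<xi> v) -` W \<inter> space borel \<in> sets borel"
    using open_dual_nbhd[of "{v}" W] by simp
qed

text \<open>If a character leaves the closed set \<open>C\<close> somewhere in the open set
  \<open>B\<close>, it does so on a nonempty open subset, hence at a point of a countable dense set.
  So countably many evaluations decide membership.\<close>

lemma sets_dual_nbhd:
  fixes B :: "'v::{topological_ab_group_add, second_countable_topology} set" and M :: "'a measure"
  assumes f: "\<And>v. (\<lambda>x. pairing (f x) v) \<in> borel_measurable M" and B: "open B" and C: "closed C"
  shows "f -` dual_nbhd B C \<inter> space M \<in> sets M"
proof -
  obtain D :: "'v set" where D: "countable D" "\<And>U. open U \<Longrightarrow> U \<noteq> {} \<Longrightarrow> \<exists>d\<in>D. d \<in> U"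
    using countable_dense_setE by blast
  have "dual_nbhd B C = (\<Inter>v\<in>D \<inter> B. {\<xi>. pairing \<xi> v \<in> C})"
  proof (intro set_eqI iffI)
    fix \<xi> assume \<xi>: "\<xi> \<in> (\<Inter>v\<in>D \<inter> B. {\<xi>. pairing \<xi> v \<in> C})"
    have "pairing \<xi> v \<in> C" if v: "v \<in> B" for v
    proof (rule ccontr)
      assume "pairing \<xi> v \<notin> C"
      moreover have "open (B \<inter> pairing \<xi> -` (- C))"
        using B C continuous_on_pairing[of \<xi>] by (intro open_Int open_vimage) auto
      ultimately obtain d where "d \<in> D" "d \<in> B \<inter> pairing \<xi> -` (- C)"
        using D(2)[of "B \<inter> pairing \<xi> -` (- C)"] v by blast
      then show False using \<xi> by auto
    qed
    then show "\<xi> \<in> dual_nbhd B C" by (auto simp: dual_nbhd_def)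
  qed (auto simp: dual_nbhd_def)
  then have "f -` dual_nbhd B C \<inter> space M =
      space M - (\<Union>v\<in>D \<inter> B. (\<lambda>x. pairing (f x) v) -` (- C) \<inter> space M)"
    by auto
  also have "\<dots> \<in> sets M"
    using D(1) C f by (intro sets.Diff sets.top sets.countable_UN' image_subsetI measurable_sets[of _ M borel]) auto
  finally show ?thesis .
qed

text \<open>A countable family of closed conditions on evaluations refines the compact-open topology.\<close>

lemma measurable_dual:
  fixes f :: "'a \<Rightarrow> 'v::{topological_ab_group_add, second_countable_topology} dual"
  assumes f: "\<And>v. (\<lambda>x. pairing (f x) v) \<in> borel_measurable M"
  shows "f \<in> M \<rightarrow>\<^sub>M borel"
proof (rule borel_measurableI)
  obtain \<B> :: "'v set set" where \<B>: "countable \<B>" "topological_basis \<B>"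
    using ex_countable_basis by auto
  obtain \<C> :: "complex set set" where \<C>: "countable \<C>" "topological_basis \<C>"
    using ex_countable_basis by auto
  define N where "N F = (\<Inter>(B, C)\<in>F. dual_nbhd B (closure C) :: 'v dual set)" for F
  define \<F> where "\<F> = {F. finite F \<and> F \<subseteq> \<B> \<times> \<C>}"
  fix U :: "'v dual set" assume "open U"
  \<comment> \<open>It suffices to cover each open set by members of the countable family of all
    \<open>N F\<close>; the induction follows the generation of the compact-open topology.\<close>
  then have "\<xi> \<in> U \<Longrightarrow> \<exists>F\<in>\<F>. \<xi> \<in> N F \<and> N F \<subseteq> U" for \<xi>
    unfolding open_dual_def
  proof (induction arbitrary: \<xi> rule: generate_topology.induct)
    case UNIV
    show ?case by (intro bexI[of _ "{}"]) (auto simp: \<F>_def N_def)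
  next
    case (Int U1 U2)
    have "\<xi> \<in> U1" "\<xi> \<in> U2" using Int.prems by auto
    then obtain F1 F2 where F: "F1 \<in> \<F>" "\<xi> \<in> N F1 \<and> N F1 \<subseteq> U1" "F2 \<in> \<F>" "\<xi> \<in> N F2 \<and> N F2 \<subseteq> U2"
      using Int.IH(1)[of \<xi>] Int.IH(2)[of \<xi>] by (elim bexE meta_impE) blast+
    show ?case
    proof (intro bexI[of _ "F1 \<union> F2"] conjI)
      have "N (F1 \<union> F2) = N F1 \<inter> N F2" unfolding N_def by (rule INT_Un)
      then show "\<xi> \<in> N (F1 \<union> F2)" "N (F1 \<union> F2) \<subseteq> U1 \<inter> U2" using F(2,4) by blast+
      show "F1 \<union> F2 \<in> \<F>" using F by (auto simp: \<F>_def)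
    qed
  next
    case (UN K)
    then obtain k where k: "k \<in> K" "\<xi> \<in> k" by blast
    then obtain F where F: "F \<in> \<F>" "\<xi> \<in> N F \<and> N F \<subseteq> k"
      using UN.IH[OF k] by (elim bexE)
    show ?case
    proof (rule bexI[OF _ F(1)], rule conjI)
      show "\<xi> \<in> N F" using F(2) by (rule conjunct1)
      show "N F \<subseteq> \<Union>K" using conjunct2[OF F(2)] k(1) by (rule order_trans[OF _ Union_upper])
    qed
  next
    case (Basis S)
    then obtain K W where KW: "S = {\<xi>. pairing \<xi> ` K \<subseteq> W}" "compact K" "open W" by blast
    have "\<exists>B C. B \<in> \<B> \<and> C \<in> \<C> \<and> v \<in> B \<and> closure C \<subseteq> W \<and> \<xi> \<in> dual_nbhd B (closure C)"
      if "v \<in> K" for v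
    proof -
      have "pairing \<xi> v \<in> W" using that Basis(2) KW(1) by auto
      from pairing_nbhd_ex[OF \<B>(2) \<C>(2) KW(3) this] show ?thesis by blast
    qed
    then obtain B C where BC: "\<And>v. v \<in> K \<Longrightarrow> B v \<in> \<B> \<and> C v \<in> \<C> \<and> v \<in> B v \<and> closure (C v) \<subseteq> W \<and>
        \<xi> \<in> dual_nbhd (B v) (closure (C v))" by metis
    have "\<And>v. v \<in> K \<Longrightarrow> open (B v)" using BC topological_basis_open[OF \<B>(2)] by blast
    moreover have "K \<subseteq> (\<Union>v\<in>K. B v)" using BC by blast
    \<comment> \<open>Each point of \<open>K\<close> comes with its own condition; compactness keeps
      finitely many, which together still force all of \<open>K\<close> into
      \<open>W\<close>.\<close>
    ultimately obtain L where L: "L \<subseteq> K" "finite L" "K \<subseteq> (\<Union>v\<in>L. B v)"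
      using compactE_image[OF KW(2), of K B] by metis
    show ?case
    proof (intro bexI[of _ "(\<lambda>v. (B v, C v)) ` L"] conjI subsetI)
      show "\<xi> \<in> N ((\<lambda>v. (B v, C v)) ` L)" using BC L(1) by (auto simp: N_def)
      fix \<zeta> assume \<zeta>: "\<zeta> \<in> N ((\<lambda>v. (B v, C v)) ` L)"
      have "pairing \<zeta> v \<in> W" if v: "v \<in> K" for v
      proof -
        obtain w where w: "w \<in> L" "v \<in> B w" using L(3) v by auto
        then have "pairing \<zeta> v \<in> closure (C w)" using \<zeta> by (auto simp: N_def dual_nbhd_def)
        then show ?thesis using BC[of w] w(1) L(1) by blast
      qed
      then show "\<zeta> \<in> S" by (auto simp: KW(1))
    next
      show "(\<lambda>v. (B v, C v)) ` L \<in> \<F>" using BC L(1,2) by (auto simp: \<F>_def)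
    qed
  qed
  then have "U = \<Union>(N ` {F \<in> \<F>. N F \<subseteq> U})" by blast
  then have "f -` U \<inter> space M = (\<Union>F\<in>{F \<in> \<F>. N F \<subseteq> U}. f -` N F \<inter> space M)" by blast
  also have "\<dots> \<in> sets M"
  proof (rule sets.countable_UN')
    have "countable \<F>"
      unfolding \<F>_def using countable_Collect_finite_subset[OF countable_SIGMA[OF \<B>(1), of "\<lambda>_. \<C>"]] \<C>(1)
      by auto
    then show "countable {F \<in> \<F>. N F \<subseteq> U}" by (rule countable_subset[rotated]) auto
    show "(\<lambda>F. f -` N F \<inter> space M) ` {F \<in> \<F>. N F \<subseteq> U} \<subseteq> sets M"
    proof clarify
      fix F assume F: "F \<in> \<F>"
      \<comment> \<open>The extra index contributes the trivial condition and keeps the index set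
        nonempty, as \<open>sets.finite_INT\<close> demands.\<close>
      have "N F = (\<Inter>z\<in>insert ({}, {}) F. dual_nbhd (fst z) (closure (snd z)))"
        by (simp add: N_def dual_nbhd_def split_beta)
      then have "f -` N F \<inter> space M =
          (\<Inter>z\<in>insert ({}, {}) F. f -` dual_nbhd (fst z) (closure (snd z)) \<inter> space M)"
        by (simp only: vimage_INT) blast
      also have "\<dots> \<in> sets M"
      proof (rule sets.finite_INT)
        fix z assume "z \<in> insert ({}, {}) F"
        then have "open (fst z)" using F topological_basis_open[OF \<B>(2)] by (auto simp: \<F>_def)
        then show "f -` dual_nbhd (fst z) (closure (snd z)) \<inter> space M \<in> sets M"
          by (intro sets_dual_nbhd f) auto
      qed (use F in \<open>auto simp: \<F>_def\<close>)
      finally show "f -` N F \<inter> space M \<in> sets M" .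
    qed
  qed
  finally show "f -` U \<inter> space M \<in> sets M" .
qed

text \<open>Joint measurability of evaluation: that the value lies in \<open>W\<close> is witnessed
  by a closed condition on the character over a basic neighbourhood of the argument, and there are
  only countably many such witnesses.\<close>

lemma borel_measurable_pairing [measurable (raw)]:
  fixes g :: "'a \<Rightarrow> 'v::{topological_ab_group_add, second_countable_topology}"
  assumes [measurable]: "f \<in> M \<rightarrow>\<^sub>M borel" "g \<in> M \<rightarrow>\<^sub>M borel"
  shows "(\<lambda>x. pairing (f x) (g x)) \<in> borel_measurable M"
proof (rule borel_measurableI)
  obtain \<B> :: "'v set set" where \<B>: "countable \<B>" "topological_basis \<B>"
    using ex_countable_basis by auto
  obtain \<C> :: "complex set set" where \<C>: "countable \<C>" "topological_basis \<C>"
    using ex_countable_basis by auto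
  fix W :: "complex set" assume W: "open W"
  let ?I = "{z \<in> \<B> \<times> \<C>. closure (snd z) \<subseteq> W}"
  let ?S = "\<lambda>z. (f -` dual_nbhd (fst z) (closure (snd z)) \<inter> space M) \<inter> (g -` fst z \<inter> space M)"
  have "(\<lambda>x. pairing (f x) (g x)) -` W \<inter> space M = (\<Union>z\<in>?I. ?S z)"
  proof (intro set_eqI iffI)
    fix x assume x: "x \<in> (\<lambda>x. pairing (f x) (g x)) -` W \<inter> space M"
    then have "pairing (f x) (g x) \<in> W" by auto
    from pairing_nbhd_ex[OF \<B>(2) \<C>(2) W this] obtain B C
      where "B \<in> \<B>" "C \<in> \<C>" "g x \<in> B" "closure C \<subseteq> W" "f x \<in> dual_nbhd B (closure C)" by blast
    then show "x \<in> (\<Union>z\<in>?I. ?S z)" using x by (intro UN_I[of "(B, C)"]) auto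
  next
    fix x assume "x \<in> (\<Union>z\<in>?I. ?S z)"
    then obtain z where "closure (snd z) \<subseteq> W" "f x \<in> dual_nbhd (fst z) (closure (snd z))"
      "g x \<in> fst z" "x \<in> space M" by blast
    then show "x \<in> (\<lambda>x. pairing (f x) (g x)) -` W \<inter> space M" unfolding dual_nbhd_def by blast
  qed
  also have "\<dots> \<in> sets M"
  proof (rule sets.countable_UN')
    show "countable ?I"
      using countable_SIGMA[OF \<B>(1), of "\<lambda>_. \<C>"] \<C>(1) by (intro countable_subset[of ?I "\<B> \<times> \<C>"]) auto
    show "?S ` ?I \<subseteq> sets M"
    proof clarify
      fix B C assume "B \<in> \<B>"
      then have B: "open B" by (rule topological_basis_open[OF \<B>(2)])
      have "f -` dual_nbhd B (closure C) \<inter> space M \<in> sets M"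
        by (intro sets_dual_nbhd B measurable_compose[OF assms(1) measurable_pairing_left]) auto
      moreover have "g -` B \<inter> space M \<in> sets M" using B by measurable
      ultimately show "(f -` dual_nbhd (fst (B, C)) (closure (snd (B, C))) \<inter> space M) \<inter>
          (g -` fst (B, C) \<inter> space M) \<in> sets M" by auto
    qed
  qed
  finally show "(\<lambda>x. pairing (f x) (g x)) -` W \<inter> space M \<in> sets M" .
qed

lemma pairing_minus: "pairing (\<xi> - \<zeta>) v = pairing \<xi> v * cnj (pairing \<zeta> v)"
  unfolding minus_dual_def pairing_plus pairing_uminus ..

lemma borel_measurable_dual_arith [measurable (raw)]:
  fixes f g :: "'a \<Rightarrow> 'v::{topological_ab_group_add, second_countable_topology} dual"
  assumes [measurable]: "f \<in> M \<rightarrow>\<^sub>M borel" "g \<in> M \<rightarrow>\<^sub>M borel"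
  shows "(\<lambda>x. f x + g x) \<in> M \<rightarrow>\<^sub>M borel" "(\<lambda>x. f x - g x) \<in> M \<rightarrow>\<^sub>M borel" "(\<lambda>x. - f x) \<in> M \<rightarrow>\<^sub>M borel"
proof -
  have cnj [measurable (raw)]: "(\<lambda>x. cnj (h x)) \<in> borel_measurable M" if "h \<in> borel_measurable M" for h
    using that by (rule measurable_compose) (intro borel_measurable_continuous_onI continuous_intros)
  show "(\<lambda>x. f x + g x) \<in> M \<rightarrow>\<^sub>M borel" "(\<lambda>x. f x - g x) \<in> M \<rightarrow>\<^sub>M borel" "(\<lambda>x. - f x) \<in> M \<rightarrow>\<^sub>M borel"
    by (rule measurable_dual, simp only: pairing_plus pairing_minus pairing_uminus, measurable)+
qed

lemma measurable_dual_add: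
  "(\<lambda>(x, y). x + y :: 'v::{topological_ab_group_add, second_countable_topology} dual)
     \<in> borel \<Otimes>\<^sub>M borel \<rightarrow>\<^sub>M borel"
  "(uminus :: 'v dual \<Rightarrow> 'v dual) \<in> borel \<rightarrow>\<^sub>M borel"
  using borel_measurable_dual_arith(3)[of "\<lambda>x. x" borel "\<lambda>x. x"] by auto

section \<open>Extension of isometries between L2 spaces\<close>

text \<open>A pseudometric on functions, whose zero distance is equality almost everywhere. Since
  the integral of a non-integrable function is 0, the triangle inequality and the zero criterion are
  stated on \<open>L2\<close>.\<close>

definition l2dist :: "'a measure \<Rightarrow> ('a \<Rightarrow> complex) \<Rightarrow> ('a \<Rightarrow> complex) \<Rightarrow> real" where
  "l2dist M f g = sqrt (\<integral>x. (cmod (f x - g x))\<^sup>2 \<partial>M)"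

lemma L2_measurable [measurable_dest]: "f \<in> L2 M \<Longrightarrow> f \<in> borel_measurable M"
  and L2_integrable: "f \<in> L2 M \<Longrightarrow> integrable M (\<lambda>x. (cmod (f x))\<^sup>2)"
  by (auto simp: L2_def)

lemma L2_bound:
  assumes f: "f \<in> L2 M" and g [measurable]: "g \<in> borel_measurable M"
    and le: "AE x in M. cmod (g x) \<le> c * cmod (f x)"
  shows "g \<in> L2 M"
proof -
  have "integrable M (\<lambda>x. c\<^sup>2 * (cmod (f x))\<^sup>2)"
    using L2_integrable[OF f] by (rule integrable_mult_right)
  then have "integrable M (\<lambda>x. (cmod (g x))\<^sup>2)"
    by (rule Bochner_Integration.integrable_bound)
      (measurable, use le in eventually_elim,
        auto simp flip: power_mult_distrib intro: power_mono)
  then show ?thesis using g by (simp add: L2_def)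
qed

text \<open>The right side exceeds (|a| + |b|)^2 by the square (t |a| - |b|)^2 / t. The free weight
  \<open>t\<close> is what later yields the sharp triangle inequality.\<close>

lemma power2_norm_add_le:
  assumes "t > 0"
  shows "(cmod (a + b))\<^sup>2 \<le> (1 + t) * (cmod a)\<^sup>2 + (1 + 1 / t) * (cmod b)\<^sup>2"
proof -
  have "(cmod (a + b))\<^sup>2 \<le> (cmod a + cmod b)\<^sup>2"
    by (intro power_mono norm_triangle_ineq) auto
  also have "\<dots> = (1 + t) * (cmod a)\<^sup>2 + (1 + 1 / t) * (cmod b)\<^sup>2 - (t * cmod a - cmod b)\<^sup>2 / t"
    using assms by (simp add: power2_eq_square field_simps)
  also have "\<dots> \<le> (1 + t) * (cmod a)\<^sup>2 + (1 + 1 / t) * (cmod b)\<^sup>2"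
    using assms by simp
  finally show ?thesis .
qed

lemma L2_add:
  assumes f: "f \<in> L2 M" and g: "g \<in> L2 M"
  shows "(\<lambda>x. f x + g x) \<in> L2 M"
proof -
  note [measurable] = L2_measurable[OF f] L2_measurable[OF g]
  have "integrable M (\<lambda>x. 2 * (cmod (f x))\<^sup>2 + 2 * (cmod (g x))\<^sup>2)"
    using L2_integrable[OF f] L2_integrable[OF g] by simp
  then have "integrable M (\<lambda>x. (cmod (f x + g x))\<^sup>2)"
    by (rule Bochner_Integration.integrable_bound)
      (use f g power2_norm_add_le[of 1] in \<open>auto simp: abs_of_nonneg\<close>)
  then show ?thesis by (simp add: L2_def)
qed

lemma L2_cmult: "f \<in> L2 M \<Longrightarrow> (\<lambda>x. c * f x) \<in> L2 M"
  by (rule L2_bound[where c="cmod c"]) (auto simp: norm_mult L2_def)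

lemma L2_zero [simp]: "(\<lambda>_. 0) \<in> L2 M"
  by (simp add: L2_def)

lemma L2_diff: "f \<in> L2 M \<Longrightarrow> g \<in> L2 M \<Longrightarrow> (\<lambda>x. f x - g x) \<in> L2 M"
  using L2_add[OF _ L2_cmult[of g M "-1"], of f] by simp

lemma L2_sum: "(\<And>i. i \<in> I \<Longrightarrow> f i \<in> L2 M) \<Longrightarrow> (\<lambda>x. \<Sum>i\<in>I. f i x) \<in> L2 M"
  by (induction I rule: infinite_finite_induct) (auto intro: L2_add)

lemma l2dist_nonneg [simp]: "l2dist M f g \<ge> 0"
  by (simp add: l2dist_def)

lemma l2dist_commute: "l2dist M f g = l2dist M g f"
  by (simp add: l2dist_def norm_minus_commute)

lemma l2dist_zero_right: "l2dist M f (\<lambda>_. 0) = sqrt (\<integral>x. (cmod (f x))\<^sup>2 \<partial>M)"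
  by (simp add: l2dist_def)

lemma l2dist_diff: "l2dist M (\<lambda>x. f x - g x) (\<lambda>_. 0) = l2dist M f g"
  by (simp add: l2dist_def)

lemma l2dist_cong_AE:
  assumes "f \<in> borel_measurable M" "f' \<in> borel_measurable M" "g \<in> borel_measurable M" "g' \<in> borel_measurable M"
    and "AE x in M. f x = f' x" "AE x in M. g x = g' x"
  shows "l2dist M f g = l2dist M f' g'"
  unfolding l2dist_def using assms by (intro arg_cong[of _ _ sqrt] integral_cong_AE) auto

lemma l2dist_eq_0_iff:
  assumes "f \<in> L2 M" "g \<in> L2 M"
  shows "l2dist M f g = 0 \<longleftrightarrow> (AE x in M. f x = g x)"
  using integral_nonneg_eq_0_iff_AE[OF L2_integrable[OF L2_diff[OF assms]]] by (simp add: l2dist_def)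

lemma nn_integral_l2dist:
  assumes "f \<in> L2 M" "g \<in> L2 M"
  shows "(\<integral>\<^sup>+x. ennreal ((cmod (f x - g x))\<^sup>2) \<partial>M) = ennreal ((l2dist M f g)\<^sup>2)"
  using nn_integral_eq_integral[OF L2_integrable[OF L2_diff[OF assms]]] by (simp add: l2dist_def)

lemma L2I_nn_integral:
  assumes [measurable]: "f \<in> borel_measurable M" "g \<in> L2 M"
    and le: "(\<integral>\<^sup>+x. ennreal ((cmod (f x - g x))\<^sup>2) \<partial>M) \<le> ennreal (e\<^sup>2)" and "e \<ge> 0"
  shows "f \<in> L2 M" "l2dist M f g \<le> e"
proof -
  have "integrable M (\<lambda>x. (cmod (f x - g x))\<^sup>2)"
    using le by (intro integrableI_bounded) (auto intro: le_less_trans)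
  then have d: "(\<lambda>x. f x - g x) \<in> L2 M" by (simp add: L2_def)
  from L2_add[OF d assms(2)] show f: "f \<in> L2 M" by simp
  show "l2dist M f g \<le> e"
    using le nn_integral_l2dist[OF f assms(2)] \<open>e \<ge> 0\<close> by (simp add: power2_le_iff_abs_le)
qed

lemma l2dist_add_le:
  assumes f: "f \<in> L2 M" and g: "g \<in> L2 M"
  shows "l2dist M (\<lambda>x. f x + g x) (\<lambda>_. 0) \<le> l2dist M f (\<lambda>_. 0) + l2dist M g (\<lambda>_. 0)"
proof -
  let ?n = "\<lambda>f. l2dist M f (\<lambda>_. 0)"
  have sq: "(?n f)\<^sup>2 = (\<integral>x. (cmod (f x))\<^sup>2 \<partial>M)" for f by (simp add: l2dist_def)
  consider "?n f = 0" | "?n g = 0" | "?n f > 0" "?n g > 0"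
    using l2dist_nonneg[of M f "\<lambda>_. 0"] l2dist_nonneg[of M g "\<lambda>_. 0"] by linarith
  then show ?thesis
  proof cases
    case 1
    then have "AE x in M. f x = 0" using l2dist_eq_0_iff[OF f L2_zero] by simp
    then have "?n (\<lambda>x. f x + g x) = ?n g" using f g by (intro l2dist_cong_AE) auto
    then show ?thesis using 1 by simp
  next
    case 2
    then have "AE x in M. g x = 0" using l2dist_eq_0_iff[OF g L2_zero] by simp
    then have "?n (\<lambda>x. f x + g x) = ?n f" using f g by (intro l2dist_cong_AE) auto
    then show ?thesis using 2 by simp
  next
    case 3
    \<comment> \<open>The optimal weight: if a and b are the two norms and t = b / a, then (1 + t)
      a^2 + (1 + 1/t) b^2 is exactly (a + b)^2.\<close>
    define t where "t = ?n g / ?n f"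
    have t: "t > 0" using 3 by (simp add: t_def)
    note fi = L2_integrable[OF f] and gi = L2_integrable[OF g]
    have "(?n (\<lambda>x. f x + g x))\<^sup>2 \<le> (\<integral>x. (1 + t) * (cmod (f x))\<^sup>2 + (1 + 1 / t) * (cmod (g x))\<^sup>2 \<partial>M)"
      unfolding sq using power2_norm_add_le[OF t] fi gi L2_integrable[OF L2_add[OF f g]]
      by (intro integral_mono) auto
    also have "\<dots> = (1 + t) * (?n f)\<^sup>2 + (1 + 1 / t) * (?n g)\<^sup>2"
      unfolding sq using fi gi by simp
    also have "\<dots> = (?n f + ?n g)\<^sup>2"
      using 3 unfolding t_def by (simp add: field_simps power2_eq_square)
    finally show ?thesis by (rule power2_le_imp_le) simp
  qed
qed

lemma l2dist_triangle:
  assumes "f \<in> L2 M" "g \<in> L2 M" "h \<in> L2 M"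
  shows "l2dist M f h \<le> l2dist M f g + l2dist M g h"
  using l2dist_add_le[OF L2_diff[OF assms(1,2)] L2_diff[OF assms(2,3)]] by (simp add: l2dist_diff)

lemma l2dist_triangle3:
  assumes "f \<in> L2 M" "g \<in> L2 M" "h \<in> L2 M" "k \<in> L2 M"
  shows "l2dist M f k \<le> l2dist M f g + l2dist M g h + l2dist M h k"
  using l2dist_triangle[OF assms(1,2,4)] l2dist_triangle[OF assms(2,3,4)] by simp

lemma l2dist_add:
  assumes "f \<in> L2 M" "g \<in> L2 M" "f' \<in> L2 M" "g' \<in> L2 M"
  shows "l2dist M (\<lambda>x. f x + f' x) (\<lambda>x. g x + g' x) \<le> l2dist M f g + l2dist M f' g'"
  using l2dist_add_le[OF L2_diff[OF assms(1,2)] L2_diff[OF assms(3,4)]]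
  by (simp add: l2dist_def algebra_simps)

lemma l2dist_cmult: "l2dist M (\<lambda>x. c * f x) (\<lambda>x. c * g x) = cmod c * l2dist M f g"
  by (simp add: l2dist_def norm_mult power_mult_distrib real_sqrt_mult flip: right_diff_distrib)

lemma l2dist_tendsto_dominated:
  assumes f: "f \<in> L2 M" and s [measurable]: "\<And>i. s i \<in> borel_measurable M"
    and lim: "AE x in M. (\<lambda>i. s i x) \<longlonglongrightarrow> f x"
    and le: "\<And>i. AE x in M. cmod (s i x) \<le> c * cmod (f x)"
  shows "(\<lambda>i. l2dist M (s i) f) \<longlonglongrightarrow> 0"
proof -
  have "(\<lambda>i. \<integral>x. (cmod (s i x - f x))\<^sup>2 \<partial>M) \<longlonglongrightarrow> (\<integral>x. 0 \<partial>M)"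
  proof (rule integral_dominated_convergence)
    show "integrable M (\<lambda>x. (c + 1)\<^sup>2 * (cmod (f x))\<^sup>2)"
      using L2_integrable[OF f] by (rule integrable_mult_right)
    show "AE x in M. norm ((cmod (s i x - f x))\<^sup>2) \<le> (c + 1)\<^sup>2 * (cmod (f x))\<^sup>2" for i
      using le[of i]
    proof eventually_elim
      case (elim x)
      have "cmod (s i x - f x) \<le> (c + 1) * cmod (f x)"
        using norm_triangle_ineq4[of "s i x" "f x"] elim by (simp add: algebra_simps)
      then have "(cmod (s i x - f x))\<^sup>2 \<le> ((c + 1) * cmod (f x))\<^sup>2" by (intro power_mono) auto
      then show ?case by (simp add: power_mult_distrib)
    qed
    show "AE x in M. (\<lambda>i. (cmod (s i x - f x))\<^sup>2) \<longlonglongrightarrow> 0"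
      using lim by eventually_elim (auto intro!: tendsto_eq_intros)
  qed (use f in measurable)
  from tendsto_real_sqrt[OF this] show ?thesis by (simp add: l2dist_def)
qed

text \<open>Riesz--Fischer: a subsequence with geometrically small increments converges almost
  everywhere, and Fatou's lemma turns the Cauchy bounds into bounds on the distance to the pointwise
  limit.\<close>

lemma L2_complete:
  assumes F: "\<And>n. F n \<in> L2 M"
    and cauchy: "\<And>e. e > 0 \<Longrightarrow> \<exists>n\<^sub>0. \<forall>m\<ge>n\<^sub>0. \<forall>n\<ge>n\<^sub>0. l2dist M (F m) (F n) < e"
  obtains f where "f \<in> L2 M" "(\<lambda>n. l2dist M (F n) f) \<longlonglongrightarrow> 0"
proof -
  note [measurable] = F[THEN L2_measurable]
  have "\<forall>k. \<exists>n\<^sub>0. \<forall>m\<ge>n\<^sub>0. \<forall>n\<ge>n\<^sub>0. l2dist M (F m) (F n) < (1 / 2) ^ k"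
    by (intro allI cauchy) simp
  then obtain N where N: "\<And>k m n. m \<ge> N k \<Longrightarrow> n \<ge> N k \<Longrightarrow> l2dist M (F m) (F n) < (1 / 2) ^ k"
    by metis
  \<comment> \<open>Partial sums of the thresholds give indices that are monotone and still beyond
    each \<open>N k\<close>.\<close>
  define r where "r k = (\<Sum>i\<le>k. N i)" for k
  have r_mono: "r k \<le> r j" if "k \<le> j" for k j
    unfolding r_def using that by (intro sum_mono2) auto
  have r_ge: "N k \<le> r k" for k
    unfolding r_def by (rule member_le_sum[of k "{..k}" N]) auto
  define d where "d k x = F (r (Suc k)) x - F (r k) x" for k x
  have [measurable]: "d k \<in> borel_measurable M" for k unfolding d_def by measurable
  \<comment> \<open>The squared distance is below 4^{-k}, so the integrals stay summable even after
    the weight 2^k.\<close>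
  have dk: "(\<integral>\<^sup>+x. ennreal (2 ^ k * (cmod (d k x))\<^sup>2) \<partial>M) \<le> ennreal ((1 / 2) ^ k)" for k
  proof -
    have lt: "l2dist M (F (r (Suc k))) (F (r k)) < (1 / 2) ^ k"
      using r_ge[of k] r_mono[of k "Suc k"] by (intro N) auto
    have "(\<integral>\<^sup>+x. ennreal (2 ^ k * (cmod (d k x))\<^sup>2) \<partial>M)
        = ennreal (2 ^ k) * (\<integral>\<^sup>+x. ennreal ((cmod (d k x))\<^sup>2) \<partial>M)"
      by (subst nn_integral_cmult[symmetric]) (auto simp: ennreal_mult)
    also have "\<dots> = ennreal (2 ^ k * (l2dist M (F (r (Suc k))) (F (r k)))\<^sup>2)"
      unfolding d_def nn_integral_l2dist[OF F F] by (simp add: ennreal_mult)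
    also have "\<dots> \<le> ennreal (2 ^ k * ((1 / 2) ^ k)\<^sup>2)"
      using lt by (intro ennreal_leI mult_left_mono power_mono) auto
    also have "2 ^ k * ((1 / 2) ^ k)\<^sup>2 = (1 / 2 :: real) ^ k"
      by (simp add: power2_eq_square flip: power_mult_distrib mult.assoc)
    finally show ?thesis .
  qed
  have "(\<integral>\<^sup>+x. (\<Sum>k. ennreal (2 ^ k * (cmod (d k x))\<^sup>2)) \<partial>M)
      = (\<Sum>k. \<integral>\<^sup>+x. ennreal (2 ^ k * (cmod (d k x))\<^sup>2) \<partial>M)"
    by (rule nn_integral_suminf) measurable
  also have "\<dots> \<le> (\<Sum>k. ennreal ((1 / 2) ^ k))"
    by (intro suminf_le dk) auto
  also have "\<dots> < \<infinity>"
    by (subst suminf_ennreal2) (auto intro: summable_geometric)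
  finally have "AE x in M. (\<Sum>k. ennreal (2 ^ k * (cmod (d k x))\<^sup>2)) \<noteq> \<infinity>"
    by (intro nn_integral_noteq_infinite) auto
  then have conv: "AE x in M. convergent (\<lambda>k. F (r k) x)"
  proof eventually_elim
    case (elim x)
    then have "summable (\<lambda>k. 2 ^ k * (cmod (d k x))\<^sup>2)"
      by (intro summable_suminf_not_top) auto
    then have "summable (\<lambda>k. (1 / 2) ^ k + 2 ^ k * (cmod (d k x))\<^sup>2)"
      by (intro summable_add summable_geometric) auto
    \<comment> \<open>This is s \<le> 1 + s^2 for s = 2^k |d_k(x)|, divided by 2^k. It bounds the
      increment itself by summable terms, so the telescoping series converges.\<close>
    moreover have "norm (d k x) \<le> (1 / 2) ^ k + 2 ^ k * (cmod (d k x))\<^sup>2" for k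
    proof -
      define t where "t = (2::real) ^ k"
      have t: "t > 0" "(1 / 2) ^ k = 1 / t" by (auto simp: t_def power_one_over)
      have "cmod (d k x) * t \<le> 1 + (cmod (d k x) * t)\<^sup>2"
        using zero_le_power2[of "cmod (d k x) * t - 1"] mult_nonneg_nonneg[OF norm_ge_zero less_imp_le[OF t(1)], of "d k x"]
        unfolding power2_diff one_power2 mult_1_right by linarith
      then show ?thesis unfolding t(2) t_def[symmetric] using t(1)
        by (simp add: field_simps power2_eq_square)
    qed
    ultimately have "summable (\<lambda>k. d k x)" by (rule summable_comparison_test'[where N=0])
    then have "(\<lambda>n. F (r 0) x + (\<Sum>k<n. d k x)) \<longlonglongrightarrow> F (r 0) x + (\<Sum>k. d k x)"
      by (intro tendsto_intros summable_LIMSEQ)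
    moreover have "F (r 0) x + (\<Sum>k<n. d k x) = F (r n) x" for n
      unfolding d_def using sum_lessThan_telescope[of "\<lambda>k. F (r k) x" n] by simp
    ultimately show ?case unfolding convergent_def by auto
  qed
  define f where "f x = lim (\<lambda>k. F (r k) x)" for x
  have [measurable]: "f \<in> borel_measurable M" unfolding f_def by measurable
  have near: "(\<integral>\<^sup>+x. ennreal ((cmod (f x - F n x))\<^sup>2) \<partial>M) \<le> ennreal (((1 / 2) ^ k)\<^sup>2)" if n: "n \<ge> N k" for n k
  proof -
    have "(\<integral>\<^sup>+x. ennreal ((cmod (f x - F n x))\<^sup>2) \<partial>M)
        = (\<integral>\<^sup>+x. liminf (\<lambda>j. ennreal ((cmod (F (r j) x - F n x))\<^sup>2)) \<partial>M)"
    proof (rule nn_integral_cong_AE, use conv in eventually_elim)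
      case (elim x)
      then have "(\<lambda>j. F (r j) x) \<longlonglongrightarrow> f x" unfolding f_def by (simp add: convergent_LIMSEQ_iff)
      then have "(\<lambda>j. ennreal ((cmod (F (r j) x - F n x))\<^sup>2)) \<longlonglongrightarrow> ennreal ((cmod (f x - F n x))\<^sup>2)"
        by (intro tendsto_intros)
      then show ?case by (intro lim_imp_Liminf[symmetric]) auto
    qed
    also have "\<dots> \<le> liminf (\<lambda>j. \<integral>\<^sup>+x. ennreal ((cmod (F (r j) x - F n x))\<^sup>2) \<partial>M)"
      by (rule nn_integral_liminf) measurable
    also have "\<dots> \<le> ennreal (((1 / 2) ^ k)\<^sup>2)"
    proof (rule Liminf_le, simp, rule eventually_sequentiallyI[of k])
      fix j assume "k \<le> j"
      then have "l2dist M (F (r j)) (F n) < (1 / 2) ^ k"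
        using r_ge[of k] r_mono[of k j] n by (intro N) auto
      then show "(\<integral>\<^sup>+x. ennreal ((cmod (F (r j) x - F n x))\<^sup>2) \<partial>M) \<le> ennreal (((1 / 2) ^ k)\<^sup>2)"
        unfolding nn_integral_l2dist[OF F F] by (intro ennreal_leI power_mono) auto
    qed
    finally show ?thesis .
  qed
  show ?thesis
  proof (rule that)
    show "f \<in> L2 M" using L2I_nn_integral(1)[OF _ F near[of 0 "N 0"]] by simp
    show "(\<lambda>n. l2dist M (F n) f) \<longlonglongrightarrow> 0"
    proof (rule LIMSEQ_I)
      fix e :: real assume "e > 0"
      then obtain k where k: "(1 / 2) ^ k < e" using real_arch_pow_inv[of e "1 / 2"] by auto
      have "l2dist M (F n) f \<le> (1 / 2) ^ k" if "n \<ge> N k" for n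
        using L2I_nn_integral(2)[OF _ F near[OF that]] by (simp add: l2dist_commute)
      then show "\<exists>n0. \<forall>n\<ge>n0. norm (l2dist M (F n) f - 0) < e"
        using k by (intro exI[of _ "N k"]) (auto intro: le_less_trans)
    qed
  qed
qed

section \<open>Isometries and unitaries between L2 spaces\<close>

definition l2_isometry :: "'a measure \<Rightarrow> 'b measure \<Rightarrow> (('a \<Rightarrow> complex) \<Rightarrow> 'b \<Rightarrow> complex) \<Rightarrow> bool" where
  "l2_isometry M N U \<longleftrightarrow>
     (\<forall>f\<in>L2 M. U f \<in> L2 N) \<and> (\<forall>f\<in>L2 M. \<forall>g\<in>L2 M. l2dist N (U f) (U g) = l2dist M f g)"

lemma unitary_L2D:
  assumes "unitary_L2 M N U"
  shows "f \<in> L2 M \<Longrightarrow> U f \<in> L2 N"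
    "f \<in> L2 M \<Longrightarrow> g \<in> L2 M \<Longrightarrow> AE y in N. U (\<lambda>x. f x + g x) y = U f y + U g y"
    "f \<in> L2 M \<Longrightarrow> AE y in N. U (\<lambda>x. c * f x) y = c * U f y"
    "f \<in> L2 M \<Longrightarrow> (\<integral>y. (cmod (U f y))\<^sup>2 \<partial>N) = (\<integral>x. (cmod (f x))\<^sup>2 \<partial>M)"
    "h \<in> L2 N \<Longrightarrow> \<exists>f\<in>L2 M. AE y in N. U f y = h y"
  using assms unfolding unitary_L2_def by blast+

lemma unitary_L2_imp_isometry:
  assumes U: "unitary_L2 M N U"
  shows "l2_isometry M N U"
  unfolding l2_isometry_def
proof (intro conjI ballI)
  fix f g assume f: "f \<in> L2 M" and g: "g \<in> L2 M"
  note UL = unitary_L2D[OF U]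
  show Uf: "U f \<in> L2 N" using f by (rule UL(1))
  have Ug: "U g \<in> L2 N" using g by (rule UL(1))
  let ?h = "\<lambda>x. f x + (- 1) * g x"
  have mg: "(\<lambda>x. (- 1) * g x) \<in> L2 M" using g by (rule L2_cmult)
  have h: "?h \<in> L2 M" using f mg by (rule L2_add)
  have Uh: "U ?h \<in> L2 N" using h by (rule UL(1))
  have 1: "AE y in N. U ?h y = U f y + U (\<lambda>x. (- 1) * g x) y" using f mg by (rule UL(2))
  have 2: "AE y in N. U (\<lambda>x. (- 1) * g x) y = (- 1) * U g y" using g by (rule UL(3))
  have 3: "AE y in N. U ?h y = U f y - U g y" using 1 2 by eventually_elim simp
  have "(l2dist N (U f) (U g))\<^sup>2 = (\<integral>y. (cmod (U f y - U g y))\<^sup>2 \<partial>N)"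
    by (simp add: l2dist_def)
  also have "\<dots> = (\<integral>y. (cmod (U ?h y))\<^sup>2 \<partial>N)"
    using 3 L2_measurable[OF Uf] L2_measurable[OF Ug] L2_measurable[OF Uh]
    by (intro integral_cong_AE) (measurable, auto)
  also have "\<dots> = (\<integral>x. (cmod (?h x))\<^sup>2 \<partial>M)" using h by (rule UL(4))
  also have "\<dots> = (l2dist M f g)\<^sup>2" by (simp add: l2dist_def)
  finally show "l2dist N (U f) (U g) = l2dist M f g" by (simp add: power2_eq_iff_nonneg)
qed

text \<open>For \<open>g\<close> in \<open>D\<close> near \<open>f\<close>, the distance of
  \<open>U f\<close> and \<open>V f\<close> is at most twice the distance of \<open>f\<close> and
  \<open>g\<close>.\<close>

lemma l2_isometry_unique:
  assumes U: "l2_isometry M N U" and V: "l2_isometry M N V"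
    and D: "D \<subseteq> L2 M" "\<And>g. g \<in> D \<Longrightarrow> AE y in N. U g y = V g y"
    and dense: "\<And>e. e > 0 \<Longrightarrow> \<exists>g\<in>D. l2dist M f g < e"
    and f: "f \<in> L2 M"
  shows "AE y in N. U f y = V f y"
proof -
  have *: "U h \<in> L2 N" "V h \<in> L2 N" if "h \<in> L2 M" for h
    using that U V by (auto simp: l2_isometry_def)
  have le: "l2dist N (U f) (V f) \<le> 0 + e" if e: "e > 0" for e
  proof -
    obtain g where g: "g \<in> D" "l2dist M f g < e / 2" using dense half_gt_zero[OF e] by blast
    have gL: "g \<in> L2 M" using g D by auto
    have 0: "l2dist N (U g) (V g) = 0"
      using l2dist_eq_0_iff[OF *[OF gL]] D(2)[OF g(1)] by simp
    have "l2dist N (U f) (V f) \<le> l2dist N (U f) (U g) + l2dist N (U g) (V g) + l2dist N (V g) (V f)"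
      using * f gL by (intro l2dist_triangle3) auto
    also have "\<dots> = l2dist M f g + l2dist M g f"
      using U V f gL unfolding l2_isometry_def 0 by simp
    finally show ?thesis using g(2) by (simp add: l2dist_commute)
  qed
  have "l2dist N (U f) (V f) \<le> 0" using le by (rule field_le_epsilon)
  then have "l2dist N (U f) (V f) = 0" using l2dist_nonneg[of N "U f" "V f"] by linarith
  then show ?thesis using l2dist_eq_0_iff *[OF f] by blast
qed

lemma unitary_L2_compose:
  assumes U: "unitary_L2 M N U" and V: "unitary_L2 N P V"
  shows "unitary_L2 M P (\<lambda>f. V (U f))"
proof -
  note UL = unitary_L2D[OF U] and VL = unitary_L2D[OF V]
  have L: "U f \<in> L2 N" if "f \<in> L2 M" for f using that by (rule UL(1))
  have LV: "V f \<in> L2 P" if "f \<in> L2 N" for f using that by (rule VL(1))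
  \<comment> \<open>The operators act on functions, and \<open>U\<close> is linear only up to null
    sets; being isometric, \<open>V\<close> does not see the difference.\<close>
  have cong: "AE z in P. V h z = V k z" if h: "h \<in> L2 N" and k: "k \<in> L2 N" and "AE y in N. h y = k y" for h k
  proof -
    have "l2dist P (V h) (V k) = l2dist N h k"
      using unitary_L2_imp_isometry[OF V] h k by (auto simp: l2_isometry_def)
    then show ?thesis using that l2dist_eq_0_iff[OF h k] l2dist_eq_0_iff[OF LV[OF h] LV[OF k]] by simp
  qed
  show ?thesis unfolding unitary_L2_def
  proof (intro conjI ballI allI)
    fix f assume f: "f \<in> L2 M"
    show "V (U f) \<in> L2 P" using L LV f by blast
    show "(\<integral>y. (cmod (V (U f) y))\<^sup>2 \<partial>P) = (\<integral>x. (cmod (f x))\<^sup>2 \<partial>M)"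
      unfolding VL(4)[OF L[OF f]] UL(4)[OF f] ..
    fix g assume g: "g \<in> L2 M"
    have "AE z in P. V (U (\<lambda>x. f x + g x)) z = V (\<lambda>y. U f y + U g y) z"
      by (intro cong L L2_add UL(2) f g)
    moreover have "AE z in P. V (\<lambda>y. U f y + U g y) z = V (U f) z + V (U g) z"
      by (intro VL(2) L f g)
    ultimately show "AE z in P. V (U (\<lambda>x. f x + g x)) z = V (U f) z + V (U g) z"
      by eventually_elim simp
  next
    fix c f assume f: "f \<in> L2 M"
    have "AE z in P. V (U (\<lambda>x. c * f x)) z = V (\<lambda>y. c * U f y) z"
      by (intro cong L L2_cmult UL(3) f)
    moreover have "AE z in P. V (\<lambda>y. c * U f y) z = c * V (U f) z"
      by (intro VL(3) L f)
    ultimately show "AE z in P. V (U (\<lambda>x. c * f x)) z = c * V (U f) z"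
      by eventually_elim simp
  next
    fix h assume "h \<in> L2 P"
    then obtain k where k: "k \<in> L2 N" "AE z in P. V k z = h z" using VL(5) by blast
    then obtain f where f: "f \<in> L2 M" "AE y in N. U f y = k y" using UL(5) by blast
    have "AE z in P. V (U f) z = V k z" using L[OF f(1)] k(1) f(2) by (rule cong)
    with k(2) have "AE z in P. V (U f) z = h z" by eventually_elim simp
    then show "\<exists>f\<in>L2 M. AE z in P. V (U f) z = h z" using f(1) by blast
  qed
qed

text \<open>The closure of the graph of \<open>K\<close> is again the graph of an isometry, up to
  null sets. Completeness of L2 and density of the domain make it total, density of the range makes
  it surjective.\<close>

lemma unitary_L2_extension:
  assumes D: "D \<subseteq> L2 M" and D_add: "\<And>f g. f \<in> D \<Longrightarrow> g \<in> D \<Longrightarrow> (\<lambda>x. f x + g x) \<in> D"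
    and D_cmult: "\<And>c f. f \<in> D \<Longrightarrow> (\<lambda>x. c * f x) \<in> D"
    and K: "\<And>f. f \<in> D \<Longrightarrow> K f \<in> L2 N"
    and K_add: "\<And>f g. f \<in> D \<Longrightarrow> g \<in> D \<Longrightarrow> AE y in N. K (\<lambda>x. f x + g x) y = K f y + K g y"
    and K_cmult: "\<And>c f. f \<in> D \<Longrightarrow> AE y in N. K (\<lambda>x. c * f x) y = c * K f y"
    and K_norm: "\<And>f. f \<in> D \<Longrightarrow> (\<integral>y. (cmod (K f y))\<^sup>2 \<partial>N) = (\<integral>x. (cmod (f x))\<^sup>2 \<partial>M)"
    and dense: "\<And>f e. f \<in> L2 M \<Longrightarrow> e > 0 \<Longrightarrow> \<exists>g\<in>D. l2dist M f g < e"
    and range_dense: "\<And>h e. h \<in> L2 N \<Longrightarrow> e > 0 \<Longrightarrow> \<exists>g\<in>D. l2dist N h (K g) < e"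
  obtains U where "unitary_L2 M N U" "\<And>f. f \<in> D \<Longrightarrow> AE y in N. U f y = K f y"
proof -
  have DL: "f \<in> L2 M" if "f \<in> D" for f using that D by blast
  have K_dist: "l2dist N (K f) (K g) = l2dist M f g" if f: "f \<in> D" and g: "g \<in> D" for f g
  proof -
    let ?h = "\<lambda>x. f x + (- 1) * g x"
    have mg: "(\<lambda>x. (- 1) * g x) \<in> D" using g by (rule D_cmult)
    have h: "?h \<in> D" using f mg by (rule D_add)
    have 3: "AE y in N. K ?h y = K f y - K g y"
      using K_add[OF f mg] K_cmult[OF g, of "- 1"] by eventually_elim simp
    have "(l2dist N (K f) (K g))\<^sup>2 = (\<integral>y. (cmod (K f y - K g y))\<^sup>2 \<partial>N)"
      by (simp add: l2dist_def)
    also have "\<dots> = (\<integral>y. (cmod (K ?h y))\<^sup>2 \<partial>N)"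
      using 3 L2_measurable[OF K[OF f]] L2_measurable[OF K[OF g]] L2_measurable[OF K[OF h]]
      by (intro integral_cong_AE) (measurable, auto)
    also have "\<dots> = (\<integral>x. (cmod (?h x))\<^sup>2 \<partial>M)" using h by (rule K_norm)
    also have "\<dots> = (l2dist M f g)\<^sup>2" by (simp add: l2dist_def)
    finally show ?thesis by (simp add: power2_eq_iff_nonneg)
  qed
  \<comment> \<open>\<open>P f h\<close> says that (f, h) is a limit of points of the graph of
    \<open>K\<close>.\<close>
  define P where "P f h \<longleftrightarrow> f \<in> L2 M \<and> h \<in> L2 N \<and>
    (\<forall>e>0. \<exists>g\<in>D. l2dist M f g < e \<and> l2dist N h (K g) < e)" for f h
  have PL: "f \<in> L2 M" "h \<in> L2 N" if "P f h" for f h using that by (auto simp: P_def)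
  have PE: "\<exists>g\<in>D. l2dist M f g < e \<and> l2dist N h (K g) < e" if "P f h" "e > 0" for f h e
    using that by (auto simp: P_def)
  have P_dist: "l2dist N h h' = l2dist M f f'" if P: "P f h" "P f' h'" for f h f' h'
  proof -
    \<comment> \<open>Four approximation errors enter, two in each space, whence e / 4.\<close>
    have le: "\<bar>l2dist N h h' - l2dist M f f'\<bar> \<le> 0 + e" if e: "e > 0" for e
    proof -
      obtain g where g: "g \<in> D" "l2dist M f g < e / 4" "l2dist N h (K g) < e / 4"
        using PE[OF P(1), of "e / 4"] e by auto
      obtain g' where g': "g' \<in> D" "l2dist M f' g' < e / 4" "l2dist N h' (K g') < e / 4"
        using PE[OF P(2), of "e / 4"] e by auto
      note L = PL[OF P(1)] PL[OF P(2)] DL[OF g(1)] DL[OF g'(1)] K[OF g(1)] K[OF g'(1)]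
      have "l2dist N h h' \<le> l2dist N h (K g) + l2dist N (K g) (K g') + l2dist N (K g') h'"
        "l2dist N (K g) (K g') \<le> l2dist N (K g) h + l2dist N h h' + l2dist N h' (K g')"
        using L by (auto intro!: l2dist_triangle3)
      moreover have "l2dist M f f' \<le> l2dist M f g + l2dist M g g' + l2dist M g' f'"
        "l2dist M g g' \<le> l2dist M g f + l2dist M f f' + l2dist M f' g'"
        using L by (auto intro!: l2dist_triangle3)
      ultimately show ?thesis
        using g(2,3) g'(2,3) K_dist[OF g(1) g'(1)]
          l2dist_commute[of N "K g'" h'] l2dist_commute[of N "K g" h]
          l2dist_commute[of M g' f'] l2dist_commute[of M g f] by linarith
    qed
    have "\<bar>l2dist N h h' - l2dist M f f'\<bar> \<le> 0" using le by (rule field_le_epsilon)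
    then show ?thesis by simp
  qed
  have lim_unique: "P f h" if f: "f \<in> L2 M" and h: "h \<in> L2 N" and g: "\<And>n. g n \<in> D"
    and "(\<lambda>n. l2dist M (g n) f) \<longlonglongrightarrow> 0" "(\<lambda>n. l2dist N (K (g n)) h) \<longlonglongrightarrow> 0" for f h g
    unfolding P_def
  proof (intro conjI f h allI impI)
    fix e :: real assume e: "e > 0"
    from order_tendstoD(2)[OF that(4) e] order_tendstoD(2)[OF that(5) e]
    have "\<forall>\<^sub>F n in sequentially. l2dist M (g n) f < e \<and> l2dist N (K (g n)) h < e"
      by eventually_elim simp
    then obtain n where "l2dist M (g n) f < e \<and> l2dist N (K (g n)) h < e"
      by (auto simp: eventually_sequentially)
    then show "\<exists>g\<in>D. l2dist M f g < e \<and> l2dist N h (K g) < e"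
      using g[of n] by (auto simp: l2dist_commute)
  qed
  have cauchy: "\<exists>n\<^sub>0. \<forall>m\<ge>n\<^sub>0. \<forall>n\<ge>n\<^sub>0. l2dist R (F m) (F n) < e"
    if F: "\<And>n. F n \<in> L2 R" and f: "f \<in> L2 R" and lt: "\<And>n. l2dist R f (F n) < inverse (Suc n)" and e: "e > 0"
    for R :: "'c measure" and F :: "nat \<Rightarrow> 'c \<Rightarrow> complex" and f e
  proof -
    obtain k where k: "inverse (real (Suc k)) < e / 2" using reals_Archimedean[of "e / 2"] e by auto
    have "l2dist R (F m) (F n) < e" if "m \<ge> k" "n \<ge> k" for m n
    proof -
      have "l2dist R (F m) (F n) \<le> l2dist R (F m) f + l2dist R f (F n)"
        using F f by (intro l2dist_triangle)
      moreover have "inverse (real (Suc m)) \<le> inverse (real (Suc k))" "inverse (real (Suc n)) \<le> inverse (real (Suc k))"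
        using that by (auto intro!: le_imp_inverse_le)
      ultimately show ?thesis
        using lt[of m] lt[of n] k l2dist_commute[of R f "F m"] by linarith
    qed
    then show ?thesis by blast
  qed
  have lt_tendsto: "(\<lambda>n. l2dist R (F n) f) \<longlonglongrightarrow> 0" if lt: "\<And>n. l2dist R f (F n) < inverse (Suc n)"
    for R :: "'c measure" and F :: "nat \<Rightarrow> 'c \<Rightarrow> complex" and f
    using lt by (intro tendsto_sandwich[OF _ _ tendsto_const LIMSEQ_inverse_real_of_nat])
      (auto intro!: always_eventually less_imp_le simp: l2dist_commute[of R _ f])
  have ex: "\<exists>h. P f h" if f: "f \<in> L2 M" for f
  proof -
    have "\<forall>n. \<exists>g\<in>D. l2dist M f g < inverse (Suc n)" using dense[OF f] by simp
    then obtain g where g: "\<And>n. g n \<in> D" "\<And>n. l2dist M f (g n) < inverse (Suc n)" by metis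
    have "\<exists>n\<^sub>0. \<forall>m\<ge>n\<^sub>0. \<forall>n\<ge>n\<^sub>0. l2dist N (K (g m)) (K (g n)) < e" if "e > 0" for e
      using cauchy[of g M f e] g f that by (simp add: K_dist DL)
    then obtain h where "h \<in> L2 N" "(\<lambda>n. l2dist N (K (g n)) h) \<longlonglongrightarrow> 0"
      using L2_complete[of "\<lambda>n. K (g n)" N] K g(1) by metis
    then show ?thesis using lim_unique[OF f _ g(1) lt_tendsto[OF g(2)]] by blast
  qed
  \<comment> \<open>A choice of representative; any two choices agree almost everywhere, since
    \<open>P\<close> is isometric.\<close>
  define U where "U f = (SOME h. P f h)" for f
  have PU: "P f (U f)" if "f \<in> L2 M" for f
    unfolding U_def using ex[OF that] by (rule someI_ex)
  have P_unique: "AE y in N. U f y = h y" if "P f h" for f h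
  proof -
    have P': "P f (U f)" using PU PL(1)[OF that] .
    have "l2dist N (U f) h = 0" unfolding P_dist[OF P' that] by (simp add: l2dist_def)
    then show ?thesis using l2dist_eq_0_iff PL(2)[OF P'] PL(2)[OF that] by blast
  qed
  have P_K: "P f (K f)" if "f \<in> D" for f
    unfolding P_def using that DL K by (auto intro!: bexI[of _ f] simp: l2dist_def)
  have P_add: "P (\<lambda>x. f x + f' x) (\<lambda>y. h y + h' y)" if P: "P f h" "P f' h'" for f f' h h'
    unfolding P_def
  proof (intro conjI L2_add PL[OF P(1)] PL[OF P(2)] allI impI)
    fix e :: real assume e: "e > 0"
    obtain g where g: "g \<in> D" "l2dist M f g < e / 2" "l2dist N h (K g) < e / 2"
      using PE[OF P(1), of "e / 2"] e by auto
    obtain g' where g': "g' \<in> D" "l2dist M f' g' < e / 2" "l2dist N h' (K g') < e / 2"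
      using PE[OF P(2), of "e / 2"] e by auto
    note L = PL[OF P(1)] PL[OF P(2)] DL[OF g(1)] DL[OF g'(1)] K[OF g(1)] K[OF g'(1)]
    have sum: "(\<lambda>x. g x + g' x) \<in> D" using g g' by (intro D_add)
    have "l2dist N (\<lambda>y. h y + h' y) (K (\<lambda>x. g x + g' x)) = l2dist N (\<lambda>y. h y + h' y) (\<lambda>y. K g y + K g' y)"
      using L K_add[OF g(1) g'(1)] K[OF sum] by (intro l2dist_cong_AE L2_measurable L2_add) auto
    also have "\<dots> \<le> l2dist N h (K g) + l2dist N h' (K g')" using L by (intro l2dist_add)
    finally have 1: "l2dist N (\<lambda>y. h y + h' y) (K (\<lambda>x. g x + g' x)) < e" using g g' by linarith
    have "l2dist M (\<lambda>x. f x + f' x) (\<lambda>x. g x + g' x) \<le> l2dist M f g + l2dist M f' g'"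
      using L by (intro l2dist_add)
    then have 2: "l2dist M (\<lambda>x. f x + f' x) (\<lambda>x. g x + g' x) < e" using g g' by linarith
    show "\<exists>g\<in>D. l2dist M (\<lambda>x. f x + f' x) g < e \<and> l2dist N (\<lambda>y. h y + h' y) (K g) < e"
      using 1 2 sum by blast
  qed
  have P_cmult: "P (\<lambda>x. c * f x) (\<lambda>y. c * h y)" if P: "P f h" for c f h
    unfolding P_def
  proof (intro conjI L2_cmult PL[OF P] allI impI)
    fix e :: real assume e: "e > 0"
    \<comment> \<open>The added 1 avoids a division by 0 when \<open>c\<close> vanishes.\<close>
    have c: "cmod c + 1 > 0" by (simp add: add_nonneg_pos)
    obtain g where g: "g \<in> D" "l2dist M f g < e / (cmod c + 1)" "l2dist N h (K g) < e / (cmod c + 1)"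
      using PE[OF P, of "e / (cmod c + 1)"] e c by auto
    note L = PL[OF P] DL[OF g(1)] K[OF g(1)]
    have cg: "(\<lambda>x. c * g x) \<in> D" using g by (intro D_cmult)
    have lt: "cmod c * r < e" if "r < e / (cmod c + 1)" "r \<ge> 0" for r
    proof -
      have "cmod c * r \<le> (cmod c + 1) * r" using that by (simp add: algebra_simps)
      also have "\<dots> < e" using that c by (simp add: field_simps)
      finally show ?thesis .
    qed
    have "l2dist N (\<lambda>y. c * h y) (K (\<lambda>x. c * g x)) = l2dist N (\<lambda>y. c * h y) (\<lambda>y. c * K g y)"
      using L K_cmult[OF g(1)] K[OF cg] by (intro l2dist_cong_AE L2_measurable L2_cmult) auto
    then have 1: "l2dist N (\<lambda>y. c * h y) (K (\<lambda>x. c * g x)) < e"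
      using lt[OF g(3)] by (simp add: l2dist_cmult)
    have 2: "l2dist M (\<lambda>x. c * f x) (\<lambda>x. c * g x) < e"
      using lt[OF g(2)] by (simp add: l2dist_cmult)
    show "\<exists>g\<in>D. l2dist M (\<lambda>x. c * f x) g < e \<and> l2dist N (\<lambda>y. c * h y) (K g) < e"
      using 1 2 cg by blast
  qed
  have P0: "P (\<lambda>_. 0) (\<lambda>_. 0)" using P_cmult[OF PU[OF L2_zero], of 0] by simp
  have "unitary_L2 M N U"
    unfolding unitary_L2_def
  proof (intro conjI ballI allI)
    fix f assume f: "f \<in> L2 M"
    show "U f \<in> L2 N" using PL(2)[OF PU[OF f]] .
    show "(\<integral>y. (cmod (U f y))\<^sup>2 \<partial>N) = (\<integral>x. (cmod (f x))\<^sup>2 \<partial>M)"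
      using P_dist[OF PU[OF f] P0] by (simp add: l2dist_zero_right)
    show "AE y in N. U (\<lambda>x. f x + g x) y = U f y + U g y" if g: "g \<in> L2 M" for g
      by (rule P_unique[OF P_add[OF PU[OF f] PU[OF g]]])
  next
    fix c f assume f: "f \<in> L2 M"
    show "AE y in N. U (\<lambda>x. c * f x) y = c * U f y"
      by (rule P_unique[OF P_cmult[OF PU[OF f]]])
  next
    fix h assume h: "h \<in> L2 N"
    have "\<forall>n. \<exists>g\<in>D. l2dist N h (K g) < inverse (Suc n)" using range_dense[OF h] by simp
    then obtain g where g: "\<And>n. g n \<in> D" "\<And>n. l2dist N h (K (g n)) < inverse (Suc n)" by metis
    have "\<exists>n\<^sub>0. \<forall>m\<ge>n\<^sub>0. \<forall>n\<ge>n\<^sub>0. l2dist M (g m) (g n) < e" if "e > 0" for e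
      using cauchy[of "\<lambda>n. K (g n)" N h e] g h that K by (simp add: K_dist DL)
    \<comment> \<open>The \<open>g n\<close> form a Cauchy sequence because \<open>K\<close>
      preserves distances; their limit is the preimage of \<open>h\<close>.\<close>
    then obtain f where f: "f \<in> L2 M" "(\<lambda>n. l2dist M (g n) f) \<longlonglongrightarrow> 0"
      using L2_complete[of g M] DL g(1) by metis
    then have "P f h" using lim_unique[OF _ h g(1) _ lt_tendsto[OF g(2)]] by blast
    then show "\<exists>f\<in>L2 M. AE y in N. U f y = h y" using P_unique f(1) by blast
  qed
  then show ?thesis using that P_unique P_K by blast
qed

section \<open>Invariant measures are finite on compact sets\<close>

lemma (in finite_measure) finite_union_approx:
  fixes F :: "nat \<Rightarrow> 'a set"
  assumes F [measurable]: "\<And>i. F i \<in> sets M" and e: "e > 0"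
  obtains n where "measure M (\<Union>i. F i) < measure M (\<Union>i<n. F i) + e"
    "measure M ((\<Union>i. F i) - (\<Union>i<n. F i)) < e"
proof -
  have "(\<lambda>n. measure M (\<Union>i<n. F i)) \<longlonglongrightarrow> measure M (\<Union>n. \<Union>i<n. F i)"
    by (rule finite_Lim_measure_incseq) (auto simp: incseq_def intro: less_le_trans)
  also have "(\<Union>n. \<Union>i<n. F i) = (\<Union>i. F i)" by blast
  finally have "\<forall>\<^sub>F n in sequentially. measure M (\<Union>i. F i) - e < measure M (\<Union>i<n. F i)"
    by (rule order_tendstoD(1)) (use e in simp)
  then obtain n where n: "measure M (\<Union>i. F i) < measure M (\<Union>i<n. F i) + e"
    by (auto simp: eventually_sequentially algebra_simps)
  moreover have "measure M ((\<Union>i. F i) - (\<Union>i<n. F i)) = measure M (\<Union>i. F i) - measure M (\<Union>i<n. F i)"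
    by (rule finite_measure_Diff) auto
  ultimately show ?thesis using that[of n] by simp
qed

text \<open>In a regular space each point of \<open>U\<close> has a basic neighbourhood whose
  closure stays in \<open>U\<close>, so countably many closures fill \<open>U\<close>.\<close>

lemma second_countable_open_Union_closed:
  assumes "regular_space T" "second_countable T" and U: "openin T U"
  obtains C :: "nat \<Rightarrow> 'a set" where "\<And>i. closedin T (C i)" "U = (\<Union>i. C i)"
proof -
  obtain \<B> where \<B>: "countable \<B>" "\<And>V. V \<in> \<B> \<Longrightarrow> openin T V"
    "\<And>U x. openin T U \<Longrightarrow> x \<in> U \<Longrightarrow> \<exists>V\<in>\<B>. x \<in> V \<and> V \<subseteq> U"
    using assms(2) unfolding second_countable_def by metis
  \<comment> \<open>The empty set keeps the family nonempty, so that it can be enumerated.\<close>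
  let ?\<C> = "insert {} {T closure_of V | V. V \<in> \<B> \<and> T closure_of V \<subseteq> U}"
  have countable: "countable ?\<C>"
    using countable_image[OF \<B>(1), of "(closure_of) T"]
    by (auto elim!: countable_subset[rotated])
  define C where "C = from_nat_into ?\<C>"
  have C: "?\<C> = range C"
    unfolding C_def by (rule range_from_nat_into[symmetric, OF insert_not_empty countable])
  have "x \<in> (\<Union>i. C i)" if x: "x \<in> U" for x
  proof -
    have "neighbourhood_base_of (closedin T) T"
      using assms(1) by (simp add: neighbourhood_base_of_closedin)
    then obtain W K where W: "openin T W" "closedin T K" "x \<in> W" "W \<subseteq> K" "K \<subseteq> U"
      using U x unfolding neighbourhood_base_of by meson
    then obtain V where V: "V \<in> \<B>" "x \<in> V" "V \<subseteq> W" using \<B>(3) by meson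
    have "T closure_of V \<subseteq> U"
      using closure_of_minimal[of V K T] V(3) W by auto
    then have "T closure_of V \<in> range C" unfolding C[symmetric] using V(1) by blast
    moreover have "V \<subseteq> T closure_of V" using \<B>(2)[OF V(1)] by (intro closure_of_subset openin_subset)
    ultimately show ?thesis using V(2) by blast
  qed
  moreover have "C i \<subseteq> U" "closedin T (C i)" for i
  proof -
    have "C i \<in> ?\<C>" unfolding C by simp
    then show "C i \<subseteq> U" "closedin T (C i)" by auto
  qed
  ultimately show ?thesis by (intro that[of C]) auto
qed

text \<open>The sets that can be squeezed between a closed and an open set form a \<sigma>-algebra,
  and open sets belong to it because they are countable unions of closed ones.\<close>

lemma (in finite_measure) closed_open_approx:
  assumes T: "regular_space T" "second_countable T" "topspace T = UNIV"
    and sets: "sets M = sigma_sets UNIV {U. openin T U}" and "A \<in> sets M" "e > 0"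
  shows "\<exists>C U. closedin T C \<and> openin T U \<and> C \<subseteq> A \<and> A \<subseteq> U \<and> measure M (U - C) < e"
  using assms(5,6) unfolding sets
proof (induction arbitrary: e rule: sigma_sets.induct)
  case (Basic A)
  then have A: "openin T A" by simp
  obtain C :: "nat \<Rightarrow> 'a set" where C: "\<And>i. closedin T (C i)" "A = (\<Union>i. C i)"
    using second_countable_open_Union_closed[OF T(1,2) A] by metis
  have *: "B \<in> sets M" if "closedin T B" for B
    using sigma_sets.Compl[OF sigma_sets.Basic, of "UNIV - B" "{U. openin T U}" UNIV] that
    by (auto simp: sets closedin_def T(3) double_diff)
  obtain n where n: "measure M ((\<Union>i. C i) - (\<Union>i<n. C i)) < e"
    using finite_union_approx[of C e, OF *[OF C(1)] Basic(2)] by blast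
  have "closedin T (\<Union>i<n. C i)" by (intro closedin_Union) (use C(1) in auto)
  then show ?case using n A C(2) by (intro exI[of _ "\<Union>i<n. C i"] exI[of _ A]) auto
next
  case Empty
  then show ?case by (intro exI[of _ "{}"]) auto
next
  case (Compl A)
  obtain C U where CU: "closedin T C" "openin T U" "C \<subseteq> A" "A \<subseteq> U" "measure M (U - C) < e"
    using Compl.IH[OF Compl.prems] by blast
  have "(UNIV - C) - (UNIV - U) = U - C" by auto
  moreover have "openin T (UNIV - C)" "closedin T (UNIV - U)"
    using CU(1,2) by (simp_all add: closedin_def T(3) double_diff)
  moreover have "UNIV - U \<subseteq> UNIV - A" "UNIV - A \<subseteq> UNIV - C" using CU(3,4) by blast+
  ultimately show ?case using CU(5) by metis
next
  case (Union A)
  \<comment> \<open>These errors sum to e / 2. The rest of e pays for cutting the countable union of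
    closed sets, which need not be closed, down to a finite one.\<close>
  have "\<forall>i. \<exists>C U. closedin T C \<and> openin T U \<and> C \<subseteq> A i \<and> A i \<subseteq> U \<and> measure M (U - C) < e / 4 * (1 / 2) ^ i"
    using Union.prems by (intro allI Union.IH) simp
  then obtain C U where CU: "\<And>i. closedin T (C i)" "\<And>i. openin T (U i)" "\<And>i. C i \<subseteq> A i" "\<And>i. A i \<subseteq> U i"
    "\<And>i. measure M (U i - C i) < e / 4 * (1 / 2) ^ i" by metis
  have openM: "B \<in> sets M" if "openin T B" for B using that by (auto simp: sets)
  have closedM: "B \<in> sets M" if "closedin T B" for B
    using sigma_sets.Compl[OF sigma_sets.Basic, of "UNIV - B" "{U. openin T U}" UNIV] that
    by (auto simp: sets closedin_def T(3) double_diff)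
  note [measurable] = openM[OF CU(2)] closedM[OF CU(1)]
  obtain n where n: "measure M ((\<Union>i. C i) - (\<Union>i<n. C i)) < e / 2"
    using finite_union_approx[of C "e / 2", OF closedM[OF CU(1)]] Union.prems by auto
  have sum: "summable (\<lambda>i. e / 4 * (1 / 2 :: real) ^ i)" by (intro summable_mult summable_geometric) auto
  have sumU: "summable (\<lambda>i. measure M (U i - C i))"
    by (rule summable_comparison_test'[OF sum, of 0]) (use CU(5) less_imp_le in auto)
  have "measure M (\<Union>i. U i - C i) \<le> (\<Sum>i. measure M (U i - C i))"
    by (rule finite_measure_subadditive_countably) (use sumU in auto)
  also have "\<dots> \<le> (\<Sum>i. e / 4 * (1 / 2) ^ i)"
    by (intro suminf_le sum sumU less_imp_le CU(5))
  also have "\<dots> = e / 2" by (subst suminf_mult) (auto simp: suminf_geometric)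
  finally have 1: "measure M (\<Union>i. U i - C i) \<le> e / 2" .
  have "measure M ((\<Union>i. U i) - (\<Union>i<n. C i)) \<le> measure M ((\<Union>i. U i - C i) \<union> ((\<Union>i. C i) - (\<Union>i<n. C i)))"
    by (rule finite_measure_mono) auto
  also have "\<dots> \<le> measure M (\<Union>i. U i - C i) + measure M ((\<Union>i. C i) - (\<Union>i<n. C i))"
    by (rule measure_Un_le) auto
  also have "\<dots> < e" using 1 n by simp
  finally have "measure M ((\<Union>i. U i) - (\<Union>i<n. C i)) < e" .
  moreover have "closedin T (\<Union>i<n. C i)" by (intro closedin_Union) (use CU(1) in auto)
  moreover have "openin T (\<Union>i. U i)" using CU(2) by auto
  moreover have "(\<Union>i<n. C i) \<subseteq> \<Union>(range A)" "\<Union>(range A) \<subseteq> (\<Union>i. U i)" using CU(3,4) by blast+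
  ultimately show ?case by (intro exI[of _ "\<Union>i<n. C i"] exI[of _ "\<Union>i. U i"]) auto
qed

text \<open>No topology occurs here, since that of the extension is a value \<open>T\<close> rather
  than the one attached to its type.\<close>

locale invariant_group_measure = group mult one inv + sigma_finite_measure M
  for mult :: "'g \<Rightarrow> 'g \<Rightarrow> 'g" and one inv and M :: "'g measure" +
  assumes space_M [simp]: "space M = UNIV"
    and mult_measurable: "(\<lambda>(g, h). mult g h) \<in> M \<Otimes>\<^sub>M M \<rightarrow>\<^sub>M M"
    and inv_measurable [measurable]: "inv \<in> M \<rightarrow>\<^sub>M M"
    and distr_mult: "\<And>g. distr M M (mult g) = M"
begin

lemma measurable_mult [measurable (raw)]:
  assumes "f \<in> K \<rightarrow>\<^sub>M M" "h \<in> K \<rightarrow>\<^sub>M M"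
  shows "(\<lambda>x. mult (f x) (h x)) \<in> K \<rightarrow>\<^sub>M M"
  using measurable_compose[OF measurable_Pair[OF assms] mult_measurable] by simp

lemma emeasure_mult_vimage:
  assumes [measurable]: "A \<in> sets M"
  shows "emeasure M {x. mult g x \<in> A} = emeasure M A"
proof -
  have "{x. mult g x \<in> A} = mult g -` A \<inter> space M" by auto
  then show ?thesis by (subst (2) distr_mult[of g, symmetric], subst emeasure_distr) auto
qed

lemma sets_inv_vimage [measurable]: "A \<in> sets M \<Longrightarrow> inv -` A \<in> sets M"
  using measurable_sets[OF inv_measurable, of A] by simp

text \<open>Inversion turns the right factor \<open>x\<close> into a left translation, so left
  invariance applies although \<open>x\<close> stands on the right. The point is that the value does
  not depend on \<open>x\<close>.\<close>

lemma emeasure_quotient: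
  assumes [measurable]: "A \<in> sets M"
  shows "emeasure M {g. mult (inv g) x \<in> A} = emeasure M (inv -` A)"
proof -
  have "mult (inv g) x = inv (mult (inv x) g)" for g
    by (simp add: inverse_distrib_swap)
  then have "{g. mult (inv g) x \<in> A} = {g. mult (inv x) g \<in> inv -` A}" by simp
  then show ?thesis by (simp only: emeasure_mult_vimage[OF sets_inv_vimage[OF assms]])
qed

text \<open>The set on the left is the translate g A. Fubini's theorem integrates over g first, and
  \<open>emeasure_quotient\<close> makes the result constant in x.\<close>

lemma nn_integral_quotient:
  assumes N: "sigma_finite_measure N" "sets N = sets M" and A [measurable]: "A \<in> sets M"
  shows "(\<integral>\<^sup>+g. emeasure N {x. mult (inv g) x \<in> A} \<partial>M) = emeasure M (inv -` A) * emeasure N UNIV"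
proof -
  interpret N: sigma_finite_measure N by fact
  interpret P: pair_sigma_finite M N ..
  note [measurable_cong] = N(2)
  have sp: "space N = UNIV" using sets_eq_imp_space_eq[OF N(2)] by simp
  have [measurable]: "{x. mult (inv g) x \<in> A} \<in> sets N" for g
    using measurable_sets[of "\<lambda>x. mult (inv g) x" N M A] by (simp add: sp vimage_def)
  have [measurable]: "{g. mult (inv g) x \<in> A} \<in> sets M" for x
    using measurable_sets[of "\<lambda>g. mult (inv g) x" M M A] by (simp add: vimage_def)
  have indN: "(\<integral>\<^sup>+x. indicator A (mult (inv g) x) \<partial>N) = emeasure N {x. mult (inv g) x \<in> A}" for g
  proof -
    have "(\<integral>\<^sup>+x. indicator A (mult (inv g) x) \<partial>N) = (\<integral>\<^sup>+x. indicator {x. mult (inv g) x \<in> A} x \<partial>N)"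
      by (simp add: indicator_def)
    also have "\<dots> = emeasure N {x. mult (inv g) x \<in> A}" by (rule nn_integral_indicator) measurable
    finally show ?thesis .
  qed
  have indM: "(\<integral>\<^sup>+g. indicator A (mult (inv g) x) \<partial>M) = emeasure M {g. mult (inv g) x \<in> A}" for x
  proof -
    have "(\<integral>\<^sup>+g. indicator A (mult (inv g) x) \<partial>M) = (\<integral>\<^sup>+g. indicator {g. mult (inv g) x \<in> A} g \<partial>M)"
      by (simp add: indicator_def)
    also have "\<dots> = emeasure M {g. mult (inv g) x \<in> A}" by (rule nn_integral_indicator) measurable
    finally show ?thesis .
  qed
  have "(\<integral>\<^sup>+g. emeasure N {x. mult (inv g) x \<in> A} \<partial>M) =
      (\<integral>\<^sup>+g. \<integral>\<^sup>+x. indicator A (mult (inv g) x) \<partial>N \<partial>M)"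
    by (simp add: indN)
  also have "\<dots> = (\<integral>\<^sup>+x. \<integral>\<^sup>+g. indicator A (mult (inv g) x) \<partial>M \<partial>N)"
    by (subst P.Fubini') auto
  also have "\<dots> = (\<integral>\<^sup>+x. emeasure M {g. mult (inv g) x \<in> A} \<partial>N)"
    by (simp add: indM)
  finally show ?thesis by (simp add: emeasure_quotient sp)
qed

text \<open>All translates g A are null, so \<open>nn_integral_quotient\<close> with N = M reads 0 =
  M(A^{-1}) M(G).\<close>

lemma emeasure_inv_eq_0:
  assumes A: "A \<in> sets M" and 0: "emeasure M A = 0"
  shows "emeasure M (inv -` A) = 0"
proof (cases "emeasure M UNIV = 0")
  case True
  then show ?thesis using emeasure_mono[of "inv -` A" UNIV M] sets.top[of M] by auto
next
  case False
  have "emeasure M (inv -` A) * emeasure M UNIV = 0"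
    using nn_integral_quotient[OF sigma_finite_measure_axioms refl A]
    by (simp add: emeasure_mult_vimage[OF A] 0)
  then show ?thesis using False by simp
qed

text \<open>For a finite measure \<open>\<nu>\<close> equivalent to \<open>M\<close> and a closed set \<open>C\<close> of positive measure whose
  inverse has finite measure, \<open>g \<mapsto> \<nu> (g C)\<close> is positive, upper semicontinuous and integrable. By
  Baire's theorem it is bounded below on a nonempty open set, which therefore has finite measure.\<close>

lemma emeasure_compactin_finite:
  assumes T: "topspace T = UNIV" "Hausdorff_space T" "locally_compact_space T" "second_countable T"
    and cont: "continuous_map (prod_topology T T) T (\<lambda>(g, h). mult g h)" "continuous_map T T inv"
    and sets: "sets M = sigma_sets UNIV {U. openin T U}" and K: "compactin T K"
  shows "emeasure M K < \<infinity>"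
proof (cases "emeasure M UNIV = 0")
  case True
  then show ?thesis using emeasure_mono[of K UNIV M] sets.top[of M] by auto
next
  case nz: False
  have reg: "regular_space T" using T by (intro locally_compact_Hausdorff_imp_regular_space)
  have openM: "B \<in> sets M" if "openin T B" for B using that by (auto simp: sets)
  have closedM: "B \<in> sets M" if "closedin T B" for B
    using sigma_sets.Compl[OF sigma_sets.Basic, of "UNIV - B" "{U. openin T U}" UNIV] that
    by (auto simp: sets closedin_def T(1) double_diff)
  obtain h where h: "h \<in> borel_measurable M" "integral\<^sup>N M h \<noteq> \<infinity>" "\<And>x. 0 < h x"
    using Ex_finite_integrable_function by auto
  \<comment> \<open>A finite measure with the same null sets, from a positive integrable density;
    this is the measure to which \<open>closed_open_approx\<close> is applied.\<close>
  define \<nu> where "\<nu> = density M h"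
  have sets_\<nu> [measurable_cong, simp]: "sets \<nu> = sets M" and space_\<nu> [simp]: "space \<nu> = UNIV"
    by (simp_all add: \<nu>_def)
  have "emeasure \<nu> (space \<nu>) = integral\<^sup>N M h"
    unfolding \<nu>_def by (subst emeasure_density) (use h(1) sets.top[of M] in auto)
  then interpret \<nu>: finite_measure \<nu> using h(2) by (intro finite_measureI) simp
  have null: "emeasure \<nu> A = 0 \<longleftrightarrow> emeasure M A = 0" if "A \<in> sets M" for A
  proof -
    have "A \<in> null_sets \<nu> \<longleftrightarrow> A \<in> null_sets M"
      unfolding \<nu>_def null_sets_density_iff[OF h(1)] AE_iff_null_sets[OF that]
      using that h(3) by (auto simp: null_sets_def less_le AE_iff_null_sets)
    then show ?thesis using that by (simp add: null_sets_def)
  qed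
  obtain B0 where B0: "B0 \<in> sets M" "0 < emeasure M B0" "emeasure M B0 < \<infinity>"
    using exists_finite_positive[of UNIV] nz sets.top[of M] by auto
  have inv2: "inv -` (inv -` A) = A" for A by auto
  \<comment> \<open>A subset of the inverse of \<open>B0\<close> has its own inverse inside
    \<open>B0\<close>, hence of finite measure.\<close>
  define B where "B = inv -` B0"
  have B: "B \<in> sets M" unfolding B_def using B0(1) by simp
  have "emeasure M B \<noteq> 0"
    using emeasure_inv_eq_0[OF B] B0(2) by (auto simp: B_def inv2)
  then have "emeasure \<nu> B \<noteq> 0" using null[OF B] by simp
  then have Bpos: "measure \<nu> B > 0" by (simp add: \<nu>.emeasure_eq_measure zero_less_measure_iff)
  \<comment> \<open>An approximation error below \<nu>(B) forces \<nu>(C) > 0.\<close>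
  obtain C U where C: "closedin T C" "openin T U" "C \<subseteq> B" "B \<subseteq> U" "measure \<nu> (U - C) < measure \<nu> B"
    using \<nu>.closed_open_approx[OF reg T(4,1) _ _ Bpos, of B] B sets by auto
  note [measurable] = closedM[OF C(1)] openM[OF C(2)] B
  have "measure \<nu> B \<le> measure \<nu> (C \<union> (U - C))" using C(4) by (intro \<nu>.finite_measure_mono) auto
  also have "\<dots> \<le> measure \<nu> C + measure \<nu> (U - C)" by (intro measure_Un_le) auto
  finally have "measure \<nu> C > 0" using C(5) by simp
  then have Cpos: "emeasure M C \<noteq> 0" using null[of C] by (auto simp: measure_def)
  have "emeasure M (inv -` C) \<le> emeasure M B0"
    using C(3) B0(1) by (intro emeasure_mono) (auto simp: B_def)
  then have Cfin: "emeasure M (inv -` C) < \<infinity>" using B0(3) by (rule le_less_trans)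
  have qcont: "continuous_map (prod_topology T T) T (\<lambda>z. mult (inv (fst z)) (snd z))"
    using continuous_map_compose[OF continuous_map_pairedI[OF
        continuous_map_compose[OF continuous_map_fst cont(2)] continuous_map_snd] cont(1)]
    by (simp add: o_def split_beta)
  define W where "W = {z. mult (inv (fst z)) (snd z) \<notin> C}"
  have W: "openin (prod_topology T T) W"
  proof -
    have "openin T (UNIV - C)" using C(1) by (simp add: closedin_def T(1))
    from openin_continuous_map_preimage[OF qcont this] show ?thesis by (simp add: W_def T(1))
  qed
  define L where "L g = measure \<nu> {x. (g, x) \<in> W}" for g
  obtain \<B> where \<B>: "countable \<B>" "\<And>V. V \<in> \<B> \<Longrightarrow> openin T V"
    "\<And>U x. openin T U \<Longrightarrow> x \<in> U \<Longrightarrow> \<exists>V\<in>\<B>. x \<in> V \<and> V \<subseteq> U"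
    using T(4) unfolding second_countable_def by metis
  have [measurable]: "{x. (g, x) \<in> W} \<in> sets M" "{x. mult (inv g) x \<in> C} \<in> sets M" for g
    using measurable_sets[of "\<lambda>x. mult (inv g) x" M M "UNIV - C"]
      measurable_sets[of "\<lambda>x. mult (inv g) x" M M C] sets.Diff[of UNIV M C] sets.top[of M]
    by (simp_all add: W_def vimage_def)
  \<comment> \<open>Lower semicontinuity: the section of \<open>W\<close> over \<open>g\<close> is a
    countable union of basic sets, each coming with a neighbourhood of \<open>g\<close>. Finitely
    many of them already have measure above \<open>c\<close>, and they stay inside the sections over
    the intersection of these neighbourhoods.\<close>
  have L_open: "openin T {g. L g > c}" if c: "c \<ge> 0" for c
  proof (subst openin_subopen, clarify)
    fix g assume g: "c < L g"
    let ?I = "{(V, V'). V \<in> \<B> \<and> V' \<in> \<B> \<and> g \<in> V \<and> V \<times> V' \<subseteq> W}"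
    have I: "countable ?I"
      by (rule countable_subset[OF _ countable_SIGMA[OF \<B>(1), of "\<lambda>_. \<B>"]]) (use \<B>(1) in auto)
    have Un: "{x. (g, x) \<in> W} = (\<Union>z\<in>?I. snd z)"
    proof (intro set_eqI iffI)
      fix x assume "x \<in> {x. (g, x) \<in> W}"
      then have gx: "(g, x) \<in> W" by simp
      obtain V0 V0' where V0: "openin T V0" "openin T V0'" "g \<in> V0" "x \<in> V0'" "V0 \<times> V0' \<subseteq> W"
        using W[unfolded openin_prod_topology_alt, rule_format, OF gx] by blast
      obtain V where V: "V \<in> \<B>" "g \<in> V" "V \<subseteq> V0" using \<B>(3)[OF V0(1,3)] by blast
      obtain V' where V': "V' \<in> \<B>" "x \<in> V'" "V' \<subseteq> V0'" using \<B>(3)[OF V0(2,4)] by blast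
      have "V \<times> V' \<subseteq> W" using V(3) V'(3) V0(5) by blast
      then have "(V, V') \<in> ?I" using V V' by blast
      then show "x \<in> (\<Union>z\<in>?I. snd z)" using V'(2) by (intro UN_I[of "(V, V')"]) simp_all
    next
      fix x assume "x \<in> (\<Union>z\<in>?I. snd z)"
      then obtain V V' where "g \<in> V" "V \<times> V' \<subseteq> W" "x \<in> V'" by auto
      then show "x \<in> {x. (g, x) \<in> W}" by blast
    qed
    have "?I \<noteq> {}"
    proof
      assume "?I = {}"
      then have U0: "(\<Union>z\<in>?I. snd z) = {}" by (simp only: UN_empty)
      have "L g = 0" unfolding L_def Un U0 by simp
      then show False using g c by simp
    qed
    note range = range_from_nat_into[OF this I]
    define p where "p = from_nat_into ?I"
    have p: "?I = range p" unfolding p_def by (rule range[symmetric])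
    have pI: "fst (p i) \<in> \<B> \<and> snd (p i) \<in> \<B> \<and> g \<in> fst (p i) \<and> fst (p i) \<times> snd (p i) \<subseteq> W" for i
    proof -
      have "p i \<in> ?I" unfolding p by simp
      then show ?thesis by (simp add: case_prod_beta)
    qed
    have Lg: "L g = measure \<nu> (\<Union>i. snd (p i))" unfolding L_def Un p by simp
    obtain n where n: "L g < measure \<nu> (\<Union>i<n. snd (p i)) + (L g - c)"
      using \<nu>.finite_union_approx[of "\<lambda>i. snd (p i)" "L g - c"] g pI openM \<B>(2) unfolding Lg sets_\<nu>
      by (metis (no_types, lifting) diff_gt_0_iff_gt)
    let ?N = "topspace T \<inter> (\<Inter>i<n. fst (p i))"
    have "openin T (topspace T \<inter> (\<Inter>i<k. fst (p i)))" for k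
    proof (induction k)
      case (Suc k)
      have "topspace T \<inter> (\<Inter>i<Suc k. fst (p i)) = (topspace T \<inter> (\<Inter>i<k. fst (p i))) \<inter> fst (p k)"
        by (auto simp: lessThan_Suc)
      then show ?case using Suc.IH \<B>(2)[of "fst (p k)"] pI[of k] by (simp only: openin_Int)
    qed simp
    then have "openin T ?N" .
    moreover have "g \<in> ?N" using pI by (simp add: T(1))
    moreover have "L g' > c" if g': "g' \<in> ?N" for g'
    proof -
      have "measure \<nu> (\<Union>i<n. snd (p i)) \<le> L g'"
        unfolding L_def
      proof (intro \<nu>.finite_measure_mono subsetI)
        fix x assume "x \<in> (\<Union>i<n. snd (p i))"
        then obtain i where i: "i < n" "x \<in> snd (p i)" by blast
        have "g' \<in> fst (p i)" using g' i(1) by blast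
        then have "(g', x) \<in> fst (p i) \<times> snd (p i)" using i(2) by simp
        then show "x \<in> {x. (g', x) \<in> W}" using pI[of i] by blast
      qed simp
      then show ?thesis using n by simp
    qed
    ultimately show "\<exists>S. openin T S \<and> g \<in> S \<and> S \<subseteq> {g. c < L g}" by blast
  qed
  define H where "H g = measure \<nu> {x. mult (inv g) x \<in> C}" for g
  define c where "c = measure \<nu> UNIV"
  have HL: "H g = c - L g" for g
  proof -
    have "{x. mult (inv g) x \<in> C} = space \<nu> - {x. (g, x) \<in> W}" by (auto simp: W_def)
    moreover have "{x. (g, x) \<in> W} \<in> sets \<nu>" by simp
    ultimately show ?thesis
      unfolding H_def L_def c_def using \<nu>.finite_measure_compl[of "{x. (g, x) \<in> W}"] by simp
  qed
  have H_pos: "H g > 0" for g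
  proof -
    have "emeasure M {x. mult (inv g) x \<in> C} \<noteq> 0" using Cpos by (simp add: emeasure_mult_vimage)
    then have "emeasure \<nu> {x. mult (inv g) x \<in> C} \<noteq> 0" by (simp add: null)
    then show ?thesis unfolding H_def by (simp add: \<nu>.emeasure_eq_measure zero_less_measure_iff)
  qed
  \<comment> \<open>These sets are closed by semicontinuity and exhaust the group because
    \<open>H\<close> is positive everywhere, so Baire's theorem gives one of them an interior
    point.\<close>
  define E where "E n = {g. inverse (real (Suc n)) \<le> H g}" for n
  have E_closed: "closedin T (E n)" for n
  proof -
    have "UNIV - E n = {g. L g > c - inverse (real (Suc n))}" by (auto simp: E_def HL not_le)
    moreover have "openin T {g. L g > d}" for d
    proof (cases "d \<ge> 0")
      case False
      moreover have "L g \<ge> 0" for g by (simp add: L_def)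
      ultimately have "{g. L g > d} = topspace T"
        unfolding T(1) by (intro set_eqI) (auto simp: not_le intro: less_le_trans)
      then show ?thesis by simp
    qed (rule L_open)
    ultimately show ?thesis by (simp add: closedin_def T(1))
  qed
  have "\<exists>n. T interior_of (E n) \<noteq> {}"
  proof (rule ccontr)
    assume "\<not> ?thesis"
    then have "T interior_of \<Union>(range E) = {}"
      using T reg E_closed by (intro Baire_category_alt) auto
    moreover have "g \<in> \<Union>(range E)" for g
      using reals_Archimedean[OF H_pos[of g]] by (auto simp: E_def intro: less_imp_le)
    then have Un: "\<Union>(range E) = topspace T" by (auto simp: T(1))
    have "T interior_of topspace T = topspace T" by (rule interior_of_openin) simp
    ultimately show False unfolding Un by (simp add: T(1))
  qed
  then obtain n where n: "T interior_of (E n) \<noteq> {}" ..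
  define O' where "O' = T interior_of (E n)"
  have O': "openin T O'" "O' \<noteq> {}" "O' \<subseteq> E n"
    using n by (auto simp: O'_def interior_of_subset)
  note [measurable] = openM[OF O'(1)]
  have "ennreal (inverse (real (Suc n))) * emeasure M O' = (\<integral>\<^sup>+g. ennreal (inverse (real (Suc n))) * indicator O' g \<partial>M)"
    by (simp add: nn_integral_cmult)
  also have "\<dots> \<le> (\<integral>\<^sup>+g. emeasure \<nu> {x. mult (inv g) x \<in> C} \<partial>M)"
    using O'(3) by (intro nn_integral_mono)
      (auto simp: indicator_def E_def H_def \<nu>.emeasure_eq_measure intro!: ennreal_leI)
  also have "\<dots> = emeasure M (inv -` C) * emeasure \<nu> UNIV"
    by (rule nn_integral_quotient[OF \<nu>.sigma_finite_measure_axioms]) simp_all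
  also have "\<dots> < \<infinity>" using Cfin by (simp add: ennreal_mult_less_top \<nu>.emeasure_eq_measure)
  finally have O'fin: "emeasure M O' < \<infinity>"
    by (auto simp: ennreal_mult_less_top ennreal_eq_0_iff)
  \<comment> \<open>Left translates of the open set of finite measure: they cover the group and all
    have the same measure, so a compact set is covered by finitely many.\<close>
  define V where "V a = {g. mult a g \<in> O'}" for a
  have V_open: "openin T (V a)" for a
  proof -
    have "continuous_map T T (\<lambda>g. mult a g)"
      using continuous_map_compose[OF continuous_map_pairedI[of T T "\<lambda>_. a" T "\<lambda>g. g"] cont(1)] T(1)
      by (simp add: o_def)
    from openin_continuous_map_preimage[OF this O'(1)] show ?thesis by (simp add: V_def T(1))
  qed
  obtain u where u: "u \<in> O'" using O'(2) by blast
  have "x \<in> V (mult u (inv x))" for x using u by (simp add: V_def assoc)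
  then have "K \<subseteq> \<Union>(range V)" by blast
  moreover have "\<forall>U\<in>range V. openin T U" using V_open by blast
  ultimately obtain F where F: "finite F" "F \<subseteq> range V" "K \<subseteq> \<Union>F"
    using K unfolding compactin_def by metis
  have Vfin: "emeasure M (V a) < \<infinity>" for a
    using O'fin by (simp add: V_def emeasure_mult_vimage)
  have FM: "F \<subseteq> sets M" using F(2) V_open openM by blast
  have "emeasure M K \<le> emeasure M (\<Union>F)"
    using F(1,3) FM by (intro emeasure_mono) auto
  also have "\<dots> \<le> (\<Sum>U\<in>F. emeasure M U)"
    using emeasure_subadditive_finite[OF F(1), of "\<lambda>U. U" M] FM by auto
  also have "\<dots> < \<infinity>" using F(1,2) Vfin by (auto simp: image_iff subset_iff)
  finally show ?thesis .
qed

end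

section \<open>Dense subspaces of L2\<close>

text \<open>Restrictions of \<open>f\<close> to an increasing exhaustion by sets of finite measure
  are integrable, because |f| \<le> |f|^2 + 1, and they converge to \<open>f\<close> by dominated
  convergence.\<close>

lemma (in sigma_finite_measure) L1_dense_L2:
  assumes f: "f \<in> L2 M" and e: "e > 0"
  obtains g where "g \<in> L2 M" "integrable M g" "l2dist M f g < e"
proof -
  obtain A :: "nat \<Rightarrow> 'a set" where A: "range A \<subseteq> sets M" "(\<Union>i. A i) = space M"
    "\<And>i. emeasure M (A i) \<noteq> \<infinity>" "incseq A"
    using sigma_finite_incseq by metis
  have [measurable]: "A i \<in> sets M" for i using A(1) by auto
  note [measurable] = L2_measurable[OF f]
  define s where "s i x = f x * indicator (A i) x" for i x
  have [measurable]: "s i \<in> borel_measurable M" for i unfolding s_def by measurable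
  have s: "s i \<in> L2 M" for i
    using f by (rule L2_bound[where c=1]) (auto simp: s_def indicator_def)
  have "integrable M (s i)" for i
  proof (rule Bochner_Integration.integrable_bound)
    show "integrable M (\<lambda>x. (cmod (f x))\<^sup>2 + indicator (A i) x :: real)"
      using L2_integrable[OF f] A(3)[of i] by (auto simp: less_top)
    have "norm (s i x) \<le> norm ((cmod (f x))\<^sup>2 + indicator (A i) x :: real)" for x
    proof (cases "x \<in> A i")
      case True
      have "0 \<le> (cmod (f x) - 1 / 2)\<^sup>2" by simp
      moreover have "(1 / 2 :: real)\<^sup>2 = 1 / 4" by (simp add: power2_eq_square)
      ultimately have "cmod (f x) \<le> (cmod (f x))\<^sup>2 + 1" by (simp add: power2_diff)
      then show ?thesis using True by (simp add: s_def)
    qed (simp add: s_def)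
    then show "AE x in M. norm (s i x) \<le> norm ((cmod (f x))\<^sup>2 + indicator (A i) x :: real)" by simp
  qed measurable
  moreover have "(\<lambda>i. l2dist M (s i) f) \<longlonglongrightarrow> 0"
  proof (rule l2dist_tendsto_dominated[OF f, where c=1])
    show "AE x in M. (\<lambda>i. s i x) \<longlonglongrightarrow> f x"
    proof (rule AE_I2)
      fix x assume "x \<in> space M"
      then obtain n where n: "x \<in> A n" using A(2) by blast
      have "s i x = f x" if "i \<ge> n" for i
      proof -
        have "x \<in> A i" using n that A(4) unfolding incseq_def by blast
        then show ?thesis by (simp add: s_def)
      qed
      then show "(\<lambda>i. s i x) \<longlonglongrightarrow> f x"
        by (intro tendsto_eventually) (auto simp: eventually_sequentially)
    qed
  qed (auto simp: s_def indicator_def)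
  then have "\<forall>\<^sub>F i in sequentially. l2dist M (s i) f < e" using e by (rule order_tendstoD)
  then obtain i where "l2dist M (s i) f < e" by (auto simp: eventually_sequentially)
  ultimately show ?thesis using that[of "s i"] s by (simp add: l2dist_commute)
qed

text \<open>Reduces a property stable under linear combinations and L2 limits to rectangles of
  finite measure. It is applied to approximability by partial Fourier transforms.\<close>

lemma L2_pair_induct [consumes 2, case_names rect add cmult lim]:
  fixes P :: "('a \<times> 'b \<Rightarrow> complex) \<Rightarrow> bool"
  assumes pair: "pair_sigma_finite M1 M2" and f: "f \<in> L2 (M1 \<Otimes>\<^sub>M M2)"
    and rect: "\<And>A B. A \<in> sets M1 \<Longrightarrow> B \<in> sets M2 \<Longrightarrow> emeasure M1 A < \<infinity> \<Longrightarrow> emeasure M2 B < \<infinity> \<Longrightarrow>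
      P (indicator (A \<times> B))"
    and add: "\<And>f g. f \<in> L2 (M1 \<Otimes>\<^sub>M M2) \<Longrightarrow> g \<in> L2 (M1 \<Otimes>\<^sub>M M2) \<Longrightarrow> P f \<Longrightarrow> P g \<Longrightarrow> P (\<lambda>x. f x + g x)"
    and cmult: "\<And>c f. f \<in> L2 (M1 \<Otimes>\<^sub>M M2) \<Longrightarrow> P f \<Longrightarrow> P (\<lambda>x. c * f x)"
    and lim: "\<And>s f. (\<And>i. s i \<in> L2 (M1 \<Otimes>\<^sub>M M2)) \<Longrightarrow> (\<And>i. P (s i)) \<Longrightarrow> f \<in> L2 (M1 \<Otimes>\<^sub>M M2) \<Longrightarrow>
      (\<lambda>i. l2dist (M1 \<Otimes>\<^sub>M M2) (s i) f) \<longlonglongrightarrow> 0 \<Longrightarrow> P f"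
  shows "P f"
proof -
  interpret P: pair_sigma_finite M1 M2 by fact
  let ?N = "M1 \<Otimes>\<^sub>M M2"
  have zero: "P (\<lambda>_. 0)"
    using rect[of "{}" "{}"] by (simp add: indicator_def[abs_def])
  have sum: "P (\<lambda>x. \<Sum>i\<in>I. s i x)" if "finite I" "\<And>i. i \<in> I \<Longrightarrow> s i \<in> L2 ?N" "\<And>i. i \<in> I \<Longrightarrow> P (s i)"
    for I and s :: "'i \<Rightarrow> _"
    using that
  proof (induction I rule: finite_induct)
    case (insert i I)
    have "P (\<lambda>x. s i x + (\<Sum>i\<in>I. s i x))"
    proof (rule add)
      show "P (\<lambda>x. \<Sum>i\<in>I. s i x)" by (rule insert.IH) (use insert.prems in auto)
    qed (use insert.prems in \<open>auto intro!: L2_sum\<close>)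
    then show ?case using insert.hyps by simp
  qed (simp add: zero)
  have indL2: "indicator S \<in> L2 ?N" if "S \<in> sets ?N" "emeasure ?N S < \<infinity>" for S
  proof -
    have eq: "(cmod (indicator S x))\<^sup>2 = indicator S x" for x by (simp add: indicator_def)
    show ?thesis using that by (simp add: L2_def eq)
  qed
  obtain A where A: "range A \<subseteq> sets M1" "(\<Union>i. A i) = space M1"
    "\<And>i. emeasure M1 (A i) \<noteq> \<infinity>" "incseq A"
    using P.M1.sigma_finite_incseq by metis
  obtain B where B: "range B \<subseteq> sets M2" "(\<Union>i. B i) = space M2"
    "\<And>i. emeasure M2 (B i) \<noteq> \<infinity>" "incseq B"
    using P.M2.sigma_finite_incseq by metis
  define R where "R n = A n \<times> B n" for n
  have AB: "A n \<in> sets M1" "B n \<in> sets M2" for n using A(1) B(1) by auto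
  have R [measurable]: "R n \<in> sets ?N" for n unfolding R_def using AB by auto
  have Rfin: "emeasure ?N (R n) < \<infinity>" for n
    unfolding R_def using AB A(3)[of n] B(3)[of n]
    by (simp add: P.M2.emeasure_pair_measure_Times ennreal_mult_less_top less_top)
  have fin: "emeasure ?N (S \<inter> R n) < \<infinity>" if "S \<in> sets ?N" for S n
    using emeasure_mono[of "S \<inter> R n" "R n" ?N] Rfin[of n] R[of n] by (auto intro: le_less_trans)
  have indR: "indicator (S \<inter> R n) \<in> L2 ?N" if S: "S \<in> sets ?N" for S n
    using S R[of n] fin[OF S] by (intro indL2) auto
  \<comment> \<open>The Dynkin argument is run inside a rectangle \<open>R n\<close> of finite
    measure, so that complements remain in L2.\<close>
  have cut: "P (indicator (S \<inter> R n))" if S: "S \<in> sets ?N" for S n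
    using Int_stable_pair_measure_generator pair_measure_closed S[unfolded sets_pair_measure]
  proof (induction S rule: sigma_sets_induct_disjoint)
    case (basic S)
    then obtain a b where ab: "S = a \<times> b" "a \<in> sets M1" "b \<in> sets M2" by auto
    have "emeasure M1 (a \<inter> A n) \<le> emeasure M1 (A n)" "emeasure M2 (b \<inter> B n) \<le> emeasure M2 (B n)"
      using AB by (auto intro!: emeasure_mono)
    then have "P (indicator ((a \<inter> A n) \<times> (b \<inter> B n)))"
      using ab AB[of n] A(3)[of n] B(3)[of n] by (intro rect) (auto simp: less_top intro: le_less_trans)
    also have "(a \<inter> A n) \<times> (b \<inter> B n) = S \<inter> R n" unfolding ab R_def by blast
    finally show ?case .
  next
    case empty
    show ?case using zero by (simp add: indicator_def[abs_def])
  next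
    case (compl S)
    have S: "S \<in> sets ?N" using compl.hyps by (simp add: sets_pair_measure)
    have RR: "P (indicator (R n))"
      unfolding R_def using AB A(3)[of n] B(3)[of n] by (intro rect) (auto simp: less_top)
    have RL: "indicator (R n) \<in> L2 ?N" using R Rfin by (rule indL2)
    have "P (\<lambda>x. indicator (R n) x + (- 1) * indicator (S \<inter> R n) x)"
      by (intro add cmult L2_cmult RR RL indR S compl.IH)
    also have "(\<lambda>x. indicator (R n) x + (- 1) * indicator (S \<inter> R n) x :: complex) =
        indicator ((space M1 \<times> space M2 - S) \<inter> R n)"
      using sets.sets_into_space[OF R[of n]] by (auto simp: fun_eq_iff indicator_def space_pair_measure)
    finally show ?case .
  next
    case (union S)
    have S: "S i \<in> sets ?N" for i using union.hyps(2) by (auto simp: sets_pair_measure)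
    then have US: "(\<Union>i. S i) \<in> sets ?N" by auto
    have ind: "(\<Sum>i<k. indicator (S i \<inter> R n) x :: complex) = indicator ((\<Union>i<k. S i) \<inter> R n) x" for k x
    proof -
      have "disjoint_family_on (\<lambda>i. S i \<inter> R n) {..<k}"
        using union.hyps(1) by (auto simp: disjoint_family_on_def)
      from indicator_UN_disjoint[OF _ this, symmetric] show ?thesis by (simp add: Int_UN_distrib2)
    qed
    show ?case
    proof (rule lim[of "\<lambda>k x. \<Sum>i<k. indicator (S i \<inter> R n) x"])
      show "(\<lambda>x. \<Sum>i<k. indicator (S i \<inter> R n) x) \<in> L2 ?N" for k
        by (intro L2_sum indR S)
      show "P (\<lambda>x. \<Sum>i<k. indicator (S i \<inter> R n) x)" for k
        by (intro sum indR S union.IH) auto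
      show "indicator (\<Union> (range S) \<inter> R n) \<in> L2 ?N" using US by (rule indR)
      then show "(\<lambda>k. l2dist ?N (\<lambda>x. \<Sum>i<k. indicator (S i \<inter> R n) x) (indicator (\<Union> (range S) \<inter> R n))) \<longlonglongrightarrow> 0"
        unfolding ind
      proof (rule l2dist_tendsto_dominated[where c=1])
        show "indicator ((\<Union>i<k. S i) \<inter> R n) \<in> borel_measurable ?N" for k
          using S R by (intro borel_measurable_indicator) auto
        show "AE x in ?N. (\<lambda>k. indicator ((\<Union>i<k. S i) \<inter> R n) x :: complex) \<longlonglongrightarrow> indicator (\<Union> (range S) \<inter> R n) x"
        proof (rule AE_I2, rule tendsto_eventually)
          fix x
          show "\<forall>\<^sub>F k in sequentially. (indicator ((\<Union>i<k. S i) \<inter> R n) x :: complex) = indicator (\<Union> (range S) \<inter> R n) x"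
          proof (cases "x \<in> \<Union> (range S)")
            case True
            then obtain i where "x \<in> S i" by blast
            then show ?thesis unfolding eventually_sequentially
              by (intro exI[of _ "Suc i"]) (auto simp: indicator_def)
          qed (auto simp: indicator_def)
        qed
      qed (auto simp: indicator_def)
    qed
  qed
  have finP: "P (indicator S)" if S: "S \<in> sets ?N" "emeasure ?N S < \<infinity>" for S
  proof (rule lim[of "\<lambda>n. indicator (S \<inter> R n)"])
    show SL: "indicator S \<in> L2 ?N" using S by (rule indL2)
    show "(\<lambda>n. l2dist ?N (indicator (S \<inter> R n)) (indicator S)) \<longlonglongrightarrow> 0"
    proof (rule l2dist_tendsto_dominated[OF SL, where c=1])
      show "indicator (S \<inter> R n) \<in> borel_measurable ?N" for n
        using S R by (intro borel_measurable_indicator) auto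
      show "AE x in ?N. (\<lambda>n. indicator (S \<inter> R n) x :: complex) \<longlonglongrightarrow> indicator S x"
      proof (rule AE_I2, rule tendsto_eventually)
        fix x assume "x \<in> space ?N"
        then have "fst x \<in> (\<Union>i. A i)" "snd x \<in> (\<Union>j. B j)"
          unfolding A(2) B(2) by (auto simp: space_pair_measure)
        then obtain i j where ij: "fst x \<in> A i" "snd x \<in> B j" by blast
        have "x \<in> R n" if n: "n \<ge> max i j" for n
        proof -
          have "A i \<subseteq> A n" "B j \<subseteq> B n" using n A(4) B(4) by (auto simp: incseq_def)
          then show ?thesis using ij unfolding R_def by (cases x) auto
        qed
        then show "\<forall>\<^sub>F n in sequentially. (indicator (S \<inter> R n) x :: complex) = indicator S x"
          unfolding eventually_sequentially by (intro exI[of _ "max i j"]) (auto simp: indicator_def)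
      qed
    qed (auto simp: indicator_def)
  qed (use cut indR S in auto)
  have simpleP: "P s" if s: "simple_function ?N s" "s \<in> L2 ?N" for s
  proof -
    \<comment> \<open>The value 0 is left out because its level set may have infinite
      measure.\<close>
    let ?Y = "s ` space ?N - {0}"
    have fY: "finite ?Y" using s(1) by (auto simp: simple_function_def)
    have mS: "s -` {y} \<inter> space ?N \<in> sets ?N" for y
      using s(1) by (rule simple_functionD)
    have Sfin: "emeasure ?N (s -` {y} \<inter> space ?N) < \<infinity>" if y: "y \<noteq> 0" for y
    proof -
      have "ennreal ((cmod y)\<^sup>2) * emeasure ?N (s -` {y} \<inter> space ?N) =
          (\<integral>\<^sup>+x. ennreal ((cmod y)\<^sup>2) * indicator (s -` {y} \<inter> space ?N) x \<partial>?N)"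
        by (rule nn_integral_cmult_indicator[symmetric, OF mS])
      also have "\<dots> \<le> (\<integral>\<^sup>+x. ennreal ((cmod (s x - 0))\<^sup>2) \<partial>?N)"
        by (intro nn_integral_mono) (auto simp: indicator_def)
      also have "\<dots> < \<infinity>" unfolding nn_integral_l2dist[OF s(2) L2_zero] by simp
      finally show ?thesis using y by (auto simp: ennreal_mult_less_top ennreal_eq_0_iff)
    qed
    define t where "t x = (\<Sum>y\<in>?Y. y * indicator (s -` {y} \<inter> space ?N) x)" for x
    have iL: "indicator (s -` {y} \<inter> space ?N) \<in> L2 ?N" "P (indicator (s -` {y} \<inter> space ?N))"
      if "y \<in> ?Y" for y
      using that Sfin[of y] mS[of y] by (simp_all add: indL2 finP)
    have t: "t \<in> L2 ?N" "P t"
      unfolding t_def[abs_def] by (intro sum fY L2_sum L2_cmult cmult iL; assumption)+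
    have "t x = s x" if x: "x \<in> space ?N" for x
    proof -
      have "t x = (\<Sum>y\<in>?Y. if s x = y then y else 0)"
        unfolding t_def using x by (intro sum.cong) (auto simp: indicator_def)
      then show ?thesis using fY x by (auto simp: sum.delta)
    qed
    \<comment> \<open>\<open>t\<close> and \<open>s\<close> may differ outside the space, so
      \<open>P s\<close> is reached as a limit of the constant sequence \<open>t\<close>.\<close>
    then have "l2dist ?N t s = 0"
      using l2dist_eq_0_iff[OF t(1) s(2)] by (simp add: AE_I2)
    then show "P s"
      by (intro lim[of "\<lambda>_. t", OF t s(2)]) simp
  qed
  obtain s where s: "\<And>i. simple_function ?N (s i)" "\<And>x. x \<in> space ?N \<Longrightarrow> (\<lambda>i. s i x) \<longlonglongrightarrow> f x"
    "\<And>i x. x \<in> space ?N \<Longrightarrow> dist (s i x) 0 \<le> 2 * dist (f x) 0"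
    using borel_measurable_implies_sequence_metric[OF L2_measurable[OF f], of 0] by metis
  have sL: "s i \<in> L2 ?N" for i
    by (rule L2_bound[OF f, where c=2]) (use s in \<open>auto intro: borel_measurable_simple_function\<close>)
  show "P f"
  proof (rule lim[OF sL simpleP[OF s(1) sL] f])
    show "(\<lambda>i. l2dist ?N (s i) f) \<longlonglongrightarrow> 0"
      by (rule l2dist_tendsto_dominated[OF f, where c=2]) (use s sL L2_measurable in auto)
  qed
qed

section \<open>The partial Fourier transform\<close>

lemma borel_measurable_cnj [measurable (raw)]:
  "f \<in> borel_measurable M \<Longrightarrow> (\<lambda>x. cnj (f x)) \<in> borel_measurable M"
  by (erule measurable_compose) (intro borel_measurable_continuous_onI continuous_intros)

lemma L2_nn_integral_iff:
  "f \<in> L2 M \<longleftrightarrow> f \<in> borel_measurable M \<and> (\<integral>\<^sup>+x. ennreal ((cmod (f x))\<^sup>2) \<partial>M) < \<infinity>"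
  by (auto simp: L2_def integrable_iff_bounded)

lemma integral_eq_nn_integral_L2:
  assumes "f \<in> L2 M" "g \<in> L2 N"
    and "(\<integral>\<^sup>+x. ennreal ((cmod (f x))\<^sup>2) \<partial>M) = (\<integral>\<^sup>+x. ennreal ((cmod (g x))\<^sup>2) \<partial>N)"
  shows "(\<integral>x. (cmod (f x))\<^sup>2 \<partial>M) = (\<integral>x. (cmod (g x))\<^sup>2 \<partial>N)"
  using assms by (subst (1 2) integral_eq_nn_integral) auto

locale plancherel_pair =
  fixes MV :: "'v::{topological_ab_group_add, second_countable_topology} measure"
    and MX :: "'v dual measure"
  assumes sigma_V: "sigma_finite_measure MV" and sigma_X: "sigma_finite_measure MX"
    and sets_V' [measurable_cong]: "sets MV = sets borel" and sets_X [measurable_cong]: "sets MX = sets borel"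
    and fourier_unitary: "fourier_unitary MV MX"
begin

sublocale PV: sigma_finite_measure MV by (rule sigma_V)
sublocale PX: sigma_finite_measure MX by (rule sigma_X)

lemma borel_measurable_fourier [measurable (raw)]:
  assumes [measurable]: "(\<lambda>(x, v). f x v) \<in> borel_measurable (K \<Otimes>\<^sub>M MV)" "g \<in> K \<rightarrow>\<^sub>M borel"
  shows "(\<lambda>x. fourier MV (f x) (g x)) \<in> borel_measurable K"
  unfolding fourier_def by measurable

lemma plancherel:
  assumes f: "f \<in> L2 MV" "integrable MV f"
  shows "(\<integral>\<^sup>+\<xi>. ennreal ((cmod (fourier MV f \<xi>))\<^sup>2) \<partial>MX) = (\<integral>\<^sup>+v. ennreal ((cmod (f v))\<^sup>2) \<partial>MV)"
    "fourier MV f \<in> L2 MX"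
proof -
  note [measurable] = L2_measurable[OF f(1)]
  obtain U where U: "unitary_L2 MV MX U" "\<And>f. f \<in> L2 MV \<Longrightarrow> integrable MV f \<Longrightarrow> AE \<xi> in MX. U f \<xi> = fourier MV f \<xi>"
    using fourier_unitary unfolding fourier_unitary_def by blast
  note UL = unitary_L2D(1)[OF U(1) f(1)]
  have "(\<integral>\<^sup>+\<xi>. ennreal ((cmod (fourier MV f \<xi>))\<^sup>2) \<partial>MX) = (\<integral>\<^sup>+\<xi>. ennreal ((cmod (U f \<xi>))\<^sup>2) \<partial>MX)"
    using U(2)[OF f] by (intro nn_integral_cong_AE) auto
  also have "\<dots> = ennreal (\<integral>\<xi>. (cmod (U f \<xi>))\<^sup>2 \<partial>MX)"
    by (rule nn_integral_eq_integral[OF L2_integrable[OF UL]]) simp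
  also have "\<dots> = ennreal (\<integral>v. (cmod (f v))\<^sup>2 \<partial>MV)"
    by (simp only: unitary_L2D(4)[OF U(1) f(1)])
  also have "\<dots> = (\<integral>\<^sup>+v. ennreal ((cmod (f v))\<^sup>2) \<partial>MV)"
    by (rule nn_integral_eq_integral[OF L2_integrable[OF f(1)], symmetric]) simp
  finally show eq: "(\<integral>\<^sup>+\<xi>. ennreal ((cmod (fourier MV f \<xi>))\<^sup>2) \<partial>MX) = (\<integral>\<^sup>+v. ennreal ((cmod (f v))\<^sup>2) \<partial>MV)" .
  have "(\<integral>\<^sup>+v. ennreal ((cmod (f v))\<^sup>2) \<partial>MV) < \<infinity>" using f(1) by (simp add: L2_nn_integral_iff)
  then show "fourier MV f \<in> L2 MX" unfolding L2_nn_integral_iff eq by simp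
qed

text \<open>Pull \<open>h\<close> back by the Plancherel unitary and approximate the preimage by
  integrable functions.\<close>

lemma fourier_dense:
  assumes h: "h \<in> L2 MX" and e: "e > 0"
  obtains f where "f \<in> L2 MV" "integrable MV f" "l2dist MX h (fourier MV f) < e"
proof -
  obtain U where U: "unitary_L2 MV MX U" "\<And>f. f \<in> L2 MV \<Longrightarrow> integrable MV f \<Longrightarrow> AE \<xi> in MX. U f \<xi> = fourier MV f \<xi>"
    using fourier_unitary unfolding fourier_unitary_def by blast
  obtain w where w: "w \<in> L2 MV" "AE \<xi> in MX. U w \<xi> = h \<xi>" using unitary_L2D(5)[OF U(1) h] by blast
  obtain f where f: "f \<in> L2 MV" "integrable MV f" "l2dist MV w f < e"
    using PV.L1_dense_L2[OF w(1) e] by blast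
  have "l2dist MX h (fourier MV f) = l2dist MX (U w) (U f)"
    using w(2) U(2)[OF f(1,2)] plancherel(2)[OF f(1,2)] h unitary_L2D(1)[OF U(1)] w(1) f(1)
    by (intro l2dist_cong_AE L2_measurable) auto
  also have "\<dots> = l2dist MV w f"
    using unitary_L2_imp_isometry[OF U(1)] w(1) f(1) by (simp add: l2_isometry_def)
  finally show ?thesis using that[OF f(1,2)] f(3) by simp
qed

lemma fourier_add:
  assumes "integrable MV f" "integrable MV g"
  shows "fourier MV (\<lambda>v. f v + g v) \<xi> = fourier MV f \<xi> + fourier MV g \<xi>"
proof -
  have "integrable MV (\<lambda>v. cnj (pairing \<xi> v) * h v)" if "integrable MV h" for h
    using that by (rule Bochner_Integration.integrable_bound)
      (use borel_measurable_integrable[OF that] in \<open>auto simp: norm_mult\<close>)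
  from this[OF assms(1)] this[OF assms(2)] show ?thesis
    by (simp add: fourier_def distrib_left)
qed

lemma fourier_cmult: "fourier MV (\<lambda>v. c * f v) \<xi> = c * fourier MV f \<xi>"
  by (simp add: fourier_def mult.left_commute[of _ c])

lemma borel_measurable_partial_fourier:
  assumes f [measurable]: "f \<in> borel_measurable (\<rho> \<Otimes>\<^sub>M MV)"
  shows "partial_fourier MV f \<in> borel_measurable (\<rho> \<Otimes>\<^sub>M MX)"
  unfolding partial_fourier_def split_beta'
  by (rule borel_measurable_fourier) measurable

text \<open>Plancherel on almost every fibre gives the isometry. For density of the range,
  \<open>L2_pair_induct\<close> leaves rectangles A \<times> B, where the indicator of A times a
  Fourier transform close to the indicator of B does it.\<close>

theorem partial_plancherel:
  assumes "sigma_finite_measure \<rho>"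
  obtains P where "unitary_L2 (\<rho> \<Otimes>\<^sub>M MV) (\<rho> \<Otimes>\<^sub>M MX) P"
    "\<And>f. f \<in> L2 (\<rho> \<Otimes>\<^sub>M MV) \<Longrightarrow> integrable (\<rho> \<Otimes>\<^sub>M MV) f \<Longrightarrow>
      AE z in \<rho> \<Otimes>\<^sub>M MX. P f z = partial_fourier MV f z"
proof -
  interpret R: sigma_finite_measure \<rho> by fact
  interpret RV: pair_sigma_finite \<rho> MV ..
  interpret RX: pair_sigma_finite \<rho> MX ..
  let ?M = "\<rho> \<Otimes>\<^sub>M MV" and ?N = "\<rho> \<Otimes>\<^sub>M MX" and ?K = "partial_fourier MV"
  define D where "D = {f \<in> L2 ?M. integrable ?M f}"
  have DL: "f \<in> L2 ?M" "integrable ?M f" if "f \<in> D" for f using that by (auto simp: D_def)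
  have DI: "f \<in> D" if "f \<in> L2 ?M" "integrable ?M f" for f using that by (auto simp: D_def)
  have slice: "AE q in \<rho>. (\<lambda>v. f (q, v)) \<in> L2 MV \<and> integrable MV (\<lambda>v. f (q, v))" if f: "f \<in> D" for f
  proof -
    note [measurable] = L2_measurable[OF DL(1)[OF f]]
    have "AE q in \<rho>. integrable MV (\<lambda>v. f (q, v))"
      using DL(2)[OF f] by (rule RV.AE_integrable_fst')
    moreover have "AE q in \<rho>. integrable MV (\<lambda>v. (cmod (f (q, v)))\<^sup>2)"
      using L2_integrable[OF DL(1)[OF f]] by (rule RV.AE_integrable_fst')
    ultimately show ?thesis
      by eventually_elim (simp add: L2_def borel_measurable_integrable)
  qed
  have Kmeas: "?K f \<in> borel_measurable ?N" if "f \<in> D" for f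
    using L2_measurable[OF DL(1)[OF that]] by (rule borel_measurable_partial_fourier)
  have Knn: "(\<integral>\<^sup>+z. ennreal ((cmod (?K f z))\<^sup>2) \<partial>?N) = (\<integral>\<^sup>+z. ennreal ((cmod (f z))\<^sup>2) \<partial>?M)" if f: "f \<in> D" for f
  proof -
    note [measurable] = L2_measurable[OF DL(1)[OF f]] Kmeas[OF f]
    have "(\<integral>\<^sup>+z. ennreal ((cmod (?K f z))\<^sup>2) \<partial>?N) = (\<integral>\<^sup>+q. \<integral>\<^sup>+\<xi>. ennreal ((cmod (?K f (q, \<xi>)))\<^sup>2) \<partial>MX \<partial>\<rho>)"
      by (rule PX.nn_integral_fst[symmetric]) measurable
    also have "\<dots> = (\<integral>\<^sup>+q. \<integral>\<^sup>+v. ennreal ((cmod (f (q, v)))\<^sup>2) \<partial>MV \<partial>\<rho>)"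
      by (rule nn_integral_cong_AE, use slice[OF f] in eventually_elim)
        (simp add: partial_fourier_def plancherel)
    also have "\<dots> = (\<integral>\<^sup>+z. ennreal ((cmod (f z))\<^sup>2) \<partial>?M)"
      by (rule PV.nn_integral_fst) measurable
    finally show ?thesis .
  qed
  have KL: "?K f \<in> L2 ?N" if f: "f \<in> D" for f
    using DL(1)[OF f] Kmeas[OF f] unfolding L2_nn_integral_iff Knn[OF f] by blast
  have D_add: "(\<lambda>x. f x + g x) \<in> D" if "f \<in> D" "g \<in> D" for f g
    using that by (auto simp: D_def L2_add)
  have D_cmult: "(\<lambda>x. c * f x) \<in> D" if "f \<in> D" for f c
    using that by (auto simp: D_def L2_cmult)
  have K_add: "AE z in ?N. ?K (\<lambda>x. f x + g x) z = ?K f z + ?K g z" if f: "f \<in> D" and g: "g \<in> D" for f g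
  proof (rule RX.AE_pair_measure)
    note [measurable] = Kmeas[OF f] Kmeas[OF g] Kmeas[OF D_add[OF f g]]
    show "{z \<in> space ?N. ?K (\<lambda>x. f x + g x) z = ?K f z + ?K g z} \<in> sets ?N" by measurable
    show "AE q in \<rho>. AE \<xi> in MX. ?K (\<lambda>x. f x + g x) (q, \<xi>) = ?K f (q, \<xi>) + ?K g (q, \<xi>)"
      using slice[OF f] slice[OF g]
      by eventually_elim (simp add: partial_fourier_def fourier_add)
  qed
  have K_cmult: "?K (\<lambda>x. c * f x) z = c * ?K f z" for c f z
    by (cases z) (simp add: partial_fourier_def fourier_cmult)
  have dense: "\<exists>g\<in>D. l2dist ?M f g < e" if "f \<in> L2 ?M" "e > 0" for f e
  proof -
    have "sigma_finite_measure ?M" by (rule RV.sigma_finite_measure_axioms)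
    from sigma_finite_measure.L1_dense_L2[OF this that] show ?thesis using DI by metis
  qed
  have range_dense: "\<forall>e>0. \<exists>g\<in>D. l2dist ?N h (?K g) < e" if h: "h \<in> L2 ?N" for h
  proof -
    have pair: "pair_sigma_finite \<rho> MX" ..
    show ?thesis using pair h
    proof (induction h rule: L2_pair_induct)
      case (rect A B)
      then have [measurable]: "A \<in> sets \<rho>" "B \<in> sets MX" by auto
      show ?case
      proof (intro allI impI)
        fix e :: real assume e: "e > 0"
        define a where "a = measure \<rho> A"
        have a: "emeasure \<rho> A = ennreal a" "a \<ge> 0"
          using rect(3) by (auto simp: a_def emeasure_eq_ennreal_measure)
        have sq: "sqrt a \<ge> 0" "sqrt a + 1 > 0" using a by (auto intro: add_nonneg_pos)
        have "integrable MX (indicator B :: _ \<Rightarrow> real)" using rect(4) by simp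
        moreover have "(cmod (indicator B x))\<^sup>2 = indicator B x" for x :: "'v dual" by (simp add: indicator_def)
        ultimately have BL: "indicator B \<in> L2 MX" by (simp add: L2_def)
        \<comment> \<open>On the product the error is multiplied by the square root of \<rho>(A),
          which is \<open>sqrt a\<close>; the added 1 allows for a null set
          \<open>A\<close>.\<close>
        obtain w where w: "w \<in> L2 MV" "integrable MV w" "l2dist MX (indicator B) (fourier MV w) < e / (sqrt a + 1)"
          using fourier_dense[OF BL, of "e / (sqrt a + 1)"] e sq by auto
        note [measurable] = L2_measurable[OF w(1)]
        define g where "g = (\<lambda>(q, v). indicator A q * w v)"
        have [measurable]: "g \<in> borel_measurable ?M" unfolding g_def by measurable
        \<comment> \<open>Used with the square for membership in L2 and with the identity for
          integrability.\<close>
        have nn: "(\<integral>\<^sup>+z. ennreal (\<phi> (cmod (g z))) \<partial>?M) < \<infinity>"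
          if [measurable]: "\<phi> \<in> borel_measurable borel" and 0: "\<phi> 0 = 0" and "(\<integral>\<^sup>+v. ennreal (\<phi> (cmod (w v))) \<partial>MV) < \<infinity>"
          for \<phi> :: "real \<Rightarrow> real"
        proof -
          have "(\<integral>\<^sup>+z. ennreal (\<phi> (cmod (g z))) \<partial>?M) = (\<integral>\<^sup>+q. \<integral>\<^sup>+v. ennreal (\<phi> (cmod (g (q, v)))) \<partial>MV \<partial>\<rho>)"
            by (rule PV.nn_integral_fst[symmetric]) measurable
          also have "\<dots> = (\<integral>\<^sup>+q. (\<integral>\<^sup>+v. ennreal (\<phi> (cmod (w v))) \<partial>MV) * indicator A q \<partial>\<rho>)"
            by (intro nn_integral_cong) (auto simp: g_def indicator_def 0)
          also have "\<dots> = (\<integral>\<^sup>+v. ennreal (\<phi> (cmod (w v))) \<partial>MV) * emeasure \<rho> A"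
            by (rule nn_integral_cmult_indicator) simp
          also have "\<dots> < \<infinity>" using that(3) rect(3) by (simp add: ennreal_mult_less_top)
          finally show ?thesis .
        qed
        have "g \<in> D"
        proof (rule DI)
          show "g \<in> L2 ?M"
            using nn[of "\<lambda>x. x\<^sup>2"] w(1) by (simp add: L2_nn_integral_iff)
          show "integrable ?M g"
            using nn[of "\<lambda>x. x"] w(2) by (simp add: integrable_iff_bounded)
        qed
        have IL: "indicator (A \<times> B) \<in> L2 ?N"
        proof -
          have "integrable ?N (indicator (A \<times> B) :: _ \<Rightarrow> real)"
            using rect by (simp add: PX.emeasure_pair_measure_Times ennreal_mult_less_top)
          moreover have "(cmod (indicator (A \<times> B) x))\<^sup>2 = indicator (A \<times> B) x" for x by (simp add: indicator_def)
          ultimately show ?thesis by (simp add: L2_def)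
        qed
        have WL: "fourier MV w \<in> L2 MX" using w(1,2) by (rule plancherel)
        note [measurable] = L2_measurable[OF WL] Kmeas[OF \<open>g \<in> D\<close>]
        have Kg: "?K g (q, \<xi>) = indicator A q * fourier MV w \<xi>" for q \<xi>
          by (simp add: partial_fourier_def g_def fourier_cmult)
        have "ennreal ((l2dist ?N (indicator (A \<times> B)) (?K g))\<^sup>2) =
            (\<integral>\<^sup>+z. ennreal ((cmod (indicator (A \<times> B) z - ?K g z))\<^sup>2) \<partial>?N)"
          by (rule nn_integral_l2dist[OF IL KL[OF \<open>g \<in> D\<close>], symmetric])
        also have "\<dots> = (\<integral>\<^sup>+q. \<integral>\<^sup>+\<xi>. ennreal ((cmod (indicator (A \<times> B) (q, \<xi>) - ?K g (q, \<xi>)))\<^sup>2) \<partial>MX \<partial>\<rho>)"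
          by (rule PX.nn_integral_fst[symmetric]) measurable
        also have "\<dots> = (\<integral>\<^sup>+q. (\<integral>\<^sup>+\<xi>. ennreal ((cmod (indicator B \<xi> - fourier MV w \<xi>))\<^sup>2) \<partial>MX) * indicator A q \<partial>\<rho>)"
          by (intro nn_integral_cong) (auto simp: Kg indicator_def)
        also have "\<dots> = (\<integral>\<^sup>+\<xi>. ennreal ((cmod (indicator B \<xi> - fourier MV w \<xi>))\<^sup>2) \<partial>MX) * emeasure \<rho> A"
          by (rule nn_integral_cmult_indicator) simp
        also have "\<dots> = ennreal ((l2dist MX (indicator B) (fourier MV w))\<^sup>2 * a)"
          unfolding nn_integral_l2dist[OF BL WL] a by (simp add: ennreal_mult a)
        finally have "(l2dist ?N (indicator (A \<times> B)) (?K g))\<^sup>2 = (l2dist MX (indicator B) (fourier MV w))\<^sup>2 * a"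
          using a by simp
        then have "l2dist ?N (indicator (A \<times> B)) (?K g) = l2dist MX (indicator B) (fourier MV w) * sqrt a"
          using a(2) l2dist_nonneg[of MX "indicator B" "fourier MV w"] l2dist_nonneg[of ?N "indicator (A \<times> B)" "?K g"]
          by (metis real_sqrt_mult real_sqrt_unique)
        also have "\<dots> \<le> l2dist MX (indicator B) (fourier MV w) * (sqrt a + 1)"
          by (intro mult_left_mono) auto
        also have "\<dots> < e" using w(3) sq by (simp add: pos_less_divide_eq)
        finally show "\<exists>g\<in>D. l2dist ?N (indicator (A \<times> B)) (?K g) < e" using \<open>g \<in> D\<close> by blast
      qed
    next
      case (add f g)
      show ?case
      proof (intro allI impI)
        fix e :: real assume e: "e > 0"
        obtain f' where f': "f' \<in> D" "l2dist ?N f (?K f') < e / 2" using add(3) half_gt_zero[OF e] by blast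
        obtain g' where g': "g' \<in> D" "l2dist ?N g (?K g') < e / 2" using add(4) half_gt_zero[OF e] by blast
        note L = KL[OF f'(1)] KL[OF g'(1)]
        have s: "(\<lambda>x. f' x + g' x) \<in> D" using f'(1) g'(1) by (rule D_add)
        have "l2dist ?N (\<lambda>x. f x + g x) (?K (\<lambda>x. f' x + g' x)) = l2dist ?N (\<lambda>x. f x + g x) (\<lambda>x. ?K f' x + ?K g' x)"
          using K_add[OF f'(1) g'(1)] by (intro l2dist_cong_AE L2_measurable L2_add add(1,2) L KL[OF s]) auto
        also have "\<dots> \<le> l2dist ?N f (?K f') + l2dist ?N g (?K g')" by (intro l2dist_add add(1,2) L)
        also have "\<dots> < e" using f' g' by simp
        finally show "\<exists>k\<in>D. l2dist ?N (\<lambda>x. f x + g x) (?K k) < e" using s by blast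
      qed
    next
      case (cmult c f)
      show ?case
      proof (intro allI impI)
        fix e :: real assume e: "e > 0"
        have c: "cmod c + 1 > 0" by (simp add: add_nonneg_pos)
        obtain f' where f': "f' \<in> D" "l2dist ?N f (?K f') < e / (cmod c + 1)"
          using cmult(2) divide_pos_pos[OF e c] by blast
        have "l2dist ?N (\<lambda>x. c * f x) (?K (\<lambda>x. c * f' x)) = cmod c * l2dist ?N f (?K f')"
          unfolding K_cmult l2dist_cmult ..
        also have "\<dots> \<le> (cmod c + 1) * l2dist ?N f (?K f')" by (intro mult_right_mono) auto
        also have "\<dots> < e" using f'(2) c by (simp add: pos_less_divide_eq mult.commute)
        finally show "\<exists>k\<in>D. l2dist ?N (\<lambda>x. c * f x) (?K k) < e" using D_cmult[OF f'(1)] by blast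
      qed
    next
      case (lim s f)
      show ?case
      proof (intro allI impI)
        fix e :: real assume e: "e > 0"
        have "\<forall>\<^sub>F i in sequentially. l2dist ?N (s i) f < e / 2"
          using lim(3) half_gt_zero[OF e] by (rule order_tendstoD)
        then obtain i where i: "l2dist ?N (s i) f < e / 2" by (auto simp: eventually_sequentially)
        obtain g where g: "g \<in> D" "l2dist ?N (s i) (?K g) < e / 2" using lim(4) half_gt_zero[OF e] by blast
        have "l2dist ?N f (?K g) \<le> l2dist ?N f (s i) + l2dist ?N (s i) (?K g)"
          by (intro l2dist_triangle lim(1,2) KL g(1))
        also have "\<dots> < e" using i g(2) l2dist_commute[of ?N f "s i"] by simp
        finally show "\<exists>g\<in>D. l2dist ?N f (?K g) < e" using g(1) by blast
      qed
    qed
  qed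
  have "\<exists>P. unitary_L2 ?M ?N P \<and> (\<forall>f\<in>D. AE z in ?N. P f z = ?K f z)"
  proof (rule unitary_L2_extension[of D ?M ?K ?N])
    show "D \<subseteq> L2 ?M" by (auto simp: D_def)
    show "(\<integral>z. (cmod (?K f z))\<^sup>2 \<partial>?N) = (\<integral>z. (cmod (f z))\<^sup>2 \<partial>?M)" if "f \<in> D" for f
      by (rule integral_eq_nn_integral_L2[OF KL[OF that] DL(1)[OF that] Knn[OF that]])
    show "\<exists>g\<in>D. l2dist ?N h (?K g) < e" if "h \<in> L2 ?N" "e > 0" for h e
      using range_dense[OF that(1)] that(2) by blast
    show "\<exists>P. unitary_L2 ?M ?N P \<and> (\<forall>f\<in>D. AE z in ?N. P f z = ?K f z)"
      if "unitary_L2 ?M ?N P" "\<And>f. f \<in> D \<Longrightarrow> AE z in ?N. P f z = ?K f z" for P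
      using that by blast
  qed (simp_all add: D_add D_cmult KL K_add K_cmult dense)
  then obtain P where P: "unitary_L2 ?M ?N P" "\<And>f. f \<in> D \<Longrightarrow> AE z in ?N. P f z = ?K f z" by blast
  show ?thesis using P(1) P(2)[OF DI] by (rule that)
qed

end

section \<open>The kernel of the quantization map\<close>

locale cocycle_pair = haar_action act MQ MV
  for act :: "'q::{topological_group_add, second_countable_topology, t2_space} \<Rightarrow>
                'v::{topological_ab_group_add, second_countable_topology, t2_space} \<Rightarrow> 'v"
    and MQ :: "'q measure" and MV :: "'v measure" +
  fixes \<beta> :: "'q \<Rightarrow> 'q \<Rightarrow> 'v" and \<eta> :: "'q \<Rightarrow> 'v dual" and b :: "'q \<Rightarrow> 'q \<Rightarrow> complex"
    and MX :: "'v dual measure"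
  assumes eta: "\<eta> \<in> Z1c act" and beta: "\<beta> \<in> Z2 act"
    and MX: "left_haar_measure MX" and ess: "essentially_bijective MQ MX \<eta>"
    and transfer: "\<And>h. h \<in> borel_measurable borel \<Longrightarrow>
           (\<integral>\<^sup>+ q. h (\<eta> q) * ennreal (inverse (modulus MV act q)) \<partial>MQ) = (\<integral>\<^sup>+ \<xi>. h \<xi> \<partial>MX)"
    and fourier: "fourier_unitary MV MX"
    and b: "b \<in> C2_circle" and psi: "psi \<eta> \<beta> = coboundary b"
begin

lemma measurable_eta [measurable]: "\<eta> \<in> borel \<rightarrow>\<^sub>M borel"
  using eta by (intro borel_measurable_continuous_onI) (simp add: Z1c_def)

lemma measurable_beta [measurable (raw)]:
  assumes "p \<in> K \<rightarrow>\<^sub>M borel" "r \<in> K \<rightarrow>\<^sub>M borel"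
  shows "(\<lambda>z. \<beta> (p z) (r z)) \<in> K \<rightarrow>\<^sub>M borel"
proof -
  have "(\<lambda>(q, r). \<beta> q r) \<in> borel \<Otimes>\<^sub>M borel \<rightarrow>\<^sub>M borel"
    using beta by (simp add: Z2_def borel_prod)
  from measurable_compose[OF measurable_Pair[OF assms] this] show ?thesis by simp
qed

lemma measurable_b [measurable (raw)]:
  assumes "p \<in> K \<rightarrow>\<^sub>M borel" "r \<in> K \<rightarrow>\<^sub>M borel"
  shows "(\<lambda>z. b (p z) (r z)) \<in> K \<rightarrow>\<^sub>M borel"
proof -
  have "(\<lambda>(q, r). b q r) \<in> borel \<Otimes>\<^sub>M borel \<rightarrow>\<^sub>M borel"
    using b by (simp add: C2_circle_def borel_prod)
  from measurable_compose[OF measurable_Pair[OF assms] this] show ?thesis by simp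
qed

lemma norm_b [simp]: "cmod (b q r) = 1"
  using b by (simp add: C2_circle_def)

lemma sets_X' [measurable_cong, simp]: "sets MX = sets borel"
  and distr_X: "distr MX borel ((+) \<xi>) = MX"
  using MX by (auto simp: left_haar_measure_def)

lemma space_X [simp]: "space MX = UNIV"
  using sets_eq_imp_space_eq[OF sets_X'] by simp

text \<open>Its product with dv is the Haar measure of the extension, and \<eta> carries it to
  d\<xi>.\<close>

definition \<rho> :: "'q measure" where
  "\<rho> = density MQ (\<lambda>q. ennreal (inverse (m q)))"

lemma sets_rho [measurable_cong, simp]: "sets \<rho> = sets borel" and space_rho [simp]: "space \<rho> = UNIV"
  by (simp_all add: \<rho>_def)

lemma nn_integral_rho:
  assumes [measurable]: "f \<in> borel_measurable borel"
  shows "(\<integral>\<^sup>+q. f q \<partial>\<rho>) = (\<integral>\<^sup>+q. ennreal (inverse (m q)) * f q \<partial>MQ)"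
  unfolding \<rho>_def by (rule nn_integral_density) measurable

lemma sigma_finite_rho: "sigma_finite_measure \<rho>"
  unfolding \<rho>_def by (subst Q.sigma_finite_iff_density_finite) auto

sublocale R: sigma_finite_measure \<rho> by (rule sigma_finite_rho)

text \<open>Turns the inverse between conull sets into a Borel map on the whole dual, so that later
  substitutions need no restricted measure spaces.\<close>

lemma eta_inverse:
  obtains \<theta> where "\<theta> \<in> borel \<rightarrow>\<^sub>M borel" "AE q in MQ. \<theta> (\<eta> q) = q"
proof -
  obtain A B where AB: "A \<in> null_sets MQ" "B \<in> null_sets MX" "bij_betw \<eta> (UNIV - A) (UNIV - B)"
    and inv: "the_inv_into (UNIV - A) \<eta> \<in>
       restrict_space MX (UNIV - B) \<rightarrow>\<^sub>M restrict_space MQ (UNIV - A)"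
    using ess unfolding essentially_bijective_def by auto
  \<comment> \<open>On the null set \<open>B\<close> any constant will do; it keeps
    \<open>\<theta>\<close> measurable.\<close>
  define \<theta> where "\<theta> \<xi> = (if \<xi> \<in> B then 0 else the_inv_into (UNIV - A) \<eta> \<xi>)" for \<xi>
  have inv': "the_inv_into (UNIV - A) \<eta> \<in> restrict_space MX (UNIV - B) \<rightarrow>\<^sub>M MQ"
    using inv by (simp add: measurable_restrict_space2_iff)
  have "\<theta> \<in> MX \<rightarrow>\<^sub>M MQ"
    unfolding \<theta>_def
  proof (subst measurable_If_restrict_space_iff)
    show "{x \<in> space MX. x \<in> B} \<in> sets MX" using AB(2) by auto
    have "{x. x \<notin> B} = UNIV - B" by auto
    with inv' show "(\<lambda>x. 0) \<in> restrict_space MX {x. x \<in> B} \<rightarrow>\<^sub>M MQ \<and>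
        the_inv_into (UNIV - A) \<eta> \<in> restrict_space MX {x. x \<notin> B} \<rightarrow>\<^sub>M MQ"
      by simp
  qed
  then have "\<theta> \<in> borel \<rightarrow>\<^sub>M borel" by (simp cong: measurable_cong_sets)
  moreover have "AE q in MQ. \<theta> (\<eta> q) = q"
    using AE_not_in[OF AB(1)]
  proof eventually_elim
    case (elim q)
    then have "\<eta> q \<notin> B" using AB(3) by (auto simp: bij_betw_def)
    then show ?case using elim AB(3) by (simp add: \<theta>_def bij_betw_def the_inv_into_f_f)
  qed
  ultimately show ?thesis by (rule that)
qed

text \<open>Transported from \<open>\<rho>\<close>: by the normalization of dq, the preimage of F
  under the almost everywhere inverse \<theta> of \<eta> has measure \<rho>(F).\<close>

lemma sigma_finite_X: "sigma_finite_measure MX"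
proof
  obtain \<theta> where \<theta> [measurable]: "\<theta> \<in> borel \<rightarrow>\<^sub>M borel" and inv: "AE q in MQ. \<theta> (\<eta> q) = q"
    by (rule eta_inverse)
  obtain F :: "nat \<Rightarrow> 'q set" where F: "range F \<subseteq> sets \<rho>" "(\<Union>i. F i) = space \<rho>" "\<And>i. emeasure \<rho> (F i) \<noteq> \<infinity>"
    using R.sigma_finite by metis
  have FM [measurable]: "F i \<in> sets borel" for i using F(1) by auto
  have G: "\<theta> -` F i \<in> sets MX" for i using measurable_sets[OF \<theta> FM[of i]] by simp
  have "emeasure MX (\<theta> -` F i) = emeasure \<rho> (F i)" for i
  proof -
    have "emeasure MX (\<theta> -` F i) = (\<integral>\<^sup>+\<xi>. indicator (\<theta> -` F i) \<xi> \<partial>MX)"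
      using G[of i] by (rule nn_integral_indicator[symmetric])
    also have "\<dots> = (\<integral>\<^sup>+\<xi>. indicator (F i) (\<theta> \<xi>) \<partial>MX)"
      by (simp add: indicator_def)
    also have "\<dots> = (\<integral>\<^sup>+q. indicator (F i) (\<theta> (\<eta> q)) * ennreal (inverse (m q)) \<partial>MQ)"
      by (rule transfer[symmetric]) measurable
    also have "\<dots> = (\<integral>\<^sup>+q. ennreal (inverse (m q)) * indicator (F i) q \<partial>MQ)"
      by (rule nn_integral_cong_AE, use inv in eventually_elim) (simp add: mult.commute)
    also have "\<dots> = (\<integral>\<^sup>+q. indicator (F i) q \<partial>\<rho>)" by (rule nn_integral_rho[symmetric]) measurable
    also have "\<dots> = emeasure \<rho> (F i)" by (rule nn_integral_indicator) simp
    finally show ?thesis .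
  qed
  then have fin: "emeasure MX (\<theta> -` F i) \<noteq> \<infinity>" for i using F(3) by simp
  show "\<exists>A. countable A \<and> A \<subseteq> sets MX \<and> \<Union>A = space MX \<and> (\<forall>a\<in>A. emeasure MX a \<noteq> \<infinity>)"
  proof (intro exI conjI)
    show "countable (range (\<lambda>i. \<theta> -` F i))" by simp
    show "range (\<lambda>i. \<theta> -` F i) \<subseteq> sets MX" using G by blast
    have "(\<Union>i. \<theta> -` F i) = \<theta> -` (\<Union>i. F i)" by blast
    then show "\<Union>(range (\<lambda>i. \<theta> -` F i)) = space MX" unfolding F(2) by simp
    show "\<forall>a\<in>range (\<lambda>i. \<theta> -` F i). emeasure MX a \<noteq> \<infinity>" using fin by blast
  qed
qed

sublocale plancherel_pair MV MX
  by (intro plancherel_pair.intro V.sigma_finite_measure_axioms sigma_finite_X sets_V sets_X' fourier)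

sublocale QQ: pair_sigma_finite MQ MQ ..
sublocale RV: pair_sigma_finite \<rho> MV ..
sublocale RX: pair_sigma_finite \<rho> MX ..

lemma nn_integral_reflect_X:
  assumes [measurable]: "h \<in> borel_measurable borel"
  shows "(\<integral>\<^sup>+\<xi>. h (\<zeta> - \<xi>) \<partial>MX) = (\<integral>\<^sup>+\<xi>. h \<xi> \<partial>MX)"
proof -
  have "(\<integral>\<^sup>+\<xi>. h (\<zeta> - \<xi>) \<partial>MX) = (\<integral>\<^sup>+\<xi>. (\<lambda>\<xi>. h (\<zeta> + \<xi>)) (- \<xi>) \<partial>MX)"
    by simp
  also have "\<dots> = (\<integral>\<^sup>+\<xi>. h (\<zeta> + \<xi>) \<partial>MX)"
    by (rule invariant_measure_uminus[OF sigma_finite_X sets_X' measurable_dual_add distr_X]) measurable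
  also have "\<dots> = (\<integral>\<^sup>+\<xi>. h \<xi> \<partial>MX)"
    by (subst (2) distr_X[of \<zeta>, symmetric], subst nn_integral_distr) auto
  finally show ?thesis .
qed

section \<open>The weighted substitution as a unitary onto kernels\<close>

definition kernel_weight :: "'q \<times> 'q \<Rightarrow> complex" where
  "kernel_weight = (\<lambda>(q\<^sub>0, q). complex_of_real (m (q\<^sub>0 + q) powr (- 1 / 2)) * b (- q\<^sub>0) q\<^sub>0 * cnj (b (- q) q\<^sub>0))"

definition kernel_map :: "('q \<times> 'v dual \<Rightarrow> complex) \<Rightarrow> 'q \<times> 'q \<Rightarrow> complex" where
  "kernel_map H = (\<lambda>(q\<^sub>0, q). kernel_weight (q\<^sub>0, q) * H (q\<^sub>0, \<eta> q\<^sub>0 - \<eta> q))"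

lemma Op_kernel_eq: "Op_kernel MV act \<eta> b f = kernel_map (partial_fourier MV f)"
  by (simp add: Op_kernel_def kernel_map_def kernel_weight_def fun_eq_iff)

lemma kernel_weight_measurable [measurable]: "kernel_weight \<in> borel_measurable (MQ \<Otimes>\<^sub>M MQ)"
  unfolding kernel_weight_def by measurable

lemma kernel_weight_norm: "(cmod (kernel_weight (q\<^sub>0, q)))\<^sup>2 = inverse (m q\<^sub>0) * inverse (m q)"
proof -
  have "(m (q\<^sub>0 + q) powr (- 1 / 2))\<^sup>2 = m (q\<^sub>0 + q) powr (- 1 / 2 + - 1 / 2)"
    unfolding power2_eq_square powr_add ..
  also have "\<dots> = inverse (m (q\<^sub>0 + q))" by (simp add: powr_neg_one inverse_eq_divide)
  finally have "(m (q\<^sub>0 + q) powr (- 1 / 2))\<^sup>2 = inverse (m (q\<^sub>0 + q))" .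
  then show ?thesis
    by (simp add: kernel_weight_def norm_mult power_mult_distrib modulus_add)
qed

lemma kernel_weight_neq_0: "kernel_weight z \<noteq> 0"
proof -
  have "(cmod (kernel_weight z))\<^sup>2 \<noteq> 0" by (cases z) (simp add: kernel_weight_norm)
  then show ?thesis by auto
qed

lemma kernel_map_measurable:
  assumes [measurable]: "H \<in> borel_measurable (\<rho> \<Otimes>\<^sub>M MX)"
  shows "kernel_map H \<in> borel_measurable (MQ \<Otimes>\<^sub>M MQ)"
  unfolding kernel_map_def split_beta' by measurable

text \<open>For fixed q_0 the factor |q|^{-1} of the squared weight turns dq into d\<xi>, and the
  reflection of \<xi> to \<eta>(q_0) - \<xi> preserves d\<xi>. The other factor |q_0|^{-1} turns
  dq_0 into \<open>\<rho>\<close>.\<close>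

lemma kernel_map_norm:
  assumes [measurable]: "H \<in> borel_measurable (\<rho> \<Otimes>\<^sub>M MX)"
  shows "(\<integral>\<^sup>+z. ennreal ((cmod (kernel_map H z))\<^sup>2) \<partial>(MQ \<Otimes>\<^sub>M MQ)) =
    (\<integral>\<^sup>+z. ennreal ((cmod (H z))\<^sup>2) \<partial>(\<rho> \<Otimes>\<^sub>M MX))"
proof -
  note [measurable] = kernel_map_measurable[OF assms]
  have "(\<integral>\<^sup>+z. ennreal ((cmod (kernel_map H z))\<^sup>2) \<partial>(MQ \<Otimes>\<^sub>M MQ)) =
      (\<integral>\<^sup>+q\<^sub>0. \<integral>\<^sup>+q. ennreal ((cmod (kernel_map H (q\<^sub>0, q)))\<^sup>2) \<partial>MQ \<partial>MQ)"
    by (rule Q.nn_integral_fst[symmetric]) measurable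
  also have "\<dots> = (\<integral>\<^sup>+q\<^sub>0. ennreal (inverse (m q\<^sub>0)) * (\<integral>\<^sup>+\<xi>. ennreal ((cmod (H (q\<^sub>0, \<xi>)))\<^sup>2) \<partial>MX) \<partial>MQ)"
  proof (rule nn_integral_cong)
    fix q\<^sub>0
    have "(\<integral>\<^sup>+q. ennreal ((cmod (kernel_map H (q\<^sub>0, q)))\<^sup>2) \<partial>MQ) =
        (\<integral>\<^sup>+q. ennreal (inverse (m q\<^sub>0)) *
          (ennreal ((cmod (H (q\<^sub>0, \<eta> q\<^sub>0 - \<eta> q)))\<^sup>2) * ennreal (inverse (m q))) \<partial>MQ)"
      by (intro nn_integral_cong)
        (simp add: kernel_map_def norm_mult power_mult_distrib kernel_weight_norm ennreal_mult mult_ac)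
    also have "\<dots> = ennreal (inverse (m q\<^sub>0)) *
        (\<integral>\<^sup>+q. ennreal ((cmod (H (q\<^sub>0, \<eta> q\<^sub>0 - \<eta> q)))\<^sup>2) * ennreal (inverse (m q)) \<partial>MQ)"
      by (rule nn_integral_cmult) measurable
    also have "(\<integral>\<^sup>+q. ennreal ((cmod (H (q\<^sub>0, \<eta> q\<^sub>0 - \<eta> q)))\<^sup>2) * ennreal (inverse (m q)) \<partial>MQ) =
        (\<integral>\<^sup>+\<xi>. ennreal ((cmod (H (q\<^sub>0, \<eta> q\<^sub>0 - \<xi>)))\<^sup>2) \<partial>MX)"
      by (rule transfer) measurable
    also have "\<dots> = (\<integral>\<^sup>+\<xi>. ennreal ((cmod (H (q\<^sub>0, \<xi>)))\<^sup>2) \<partial>MX)"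
      by (rule nn_integral_reflect_X) measurable
    finally show "(\<integral>\<^sup>+q. ennreal ((cmod (kernel_map H (q\<^sub>0, q)))\<^sup>2) \<partial>MQ) =
        ennreal (inverse (m q\<^sub>0)) * (\<integral>\<^sup>+\<xi>. ennreal ((cmod (H (q\<^sub>0, \<xi>)))\<^sup>2) \<partial>MX)" .
  qed
  also have "\<dots> = (\<integral>\<^sup>+q\<^sub>0. (\<integral>\<^sup>+\<xi>. ennreal ((cmod (H (q\<^sub>0, \<xi>)))\<^sup>2) \<partial>MX) \<partial>\<rho>)"
    by (rule nn_integral_rho[symmetric]) measurable
  also have "\<dots> = (\<integral>\<^sup>+z. ennreal ((cmod (H z))\<^sup>2) \<partial>(\<rho> \<Otimes>\<^sub>M MX))"
    by (rule PX.nn_integral_fst) measurable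
  finally show ?thesis .
qed

lemma kernel_map_L2: "H \<in> L2 (\<rho> \<Otimes>\<^sub>M MX) \<Longrightarrow> kernel_map H \<in> L2 (MQ \<Otimes>\<^sub>M MQ)"
  by (simp add: L2_nn_integral_iff kernel_map_norm kernel_map_measurable)

lemma unitary_kernel_map: "unitary_L2 (\<rho> \<Otimes>\<^sub>M MX) (MQ \<Otimes>\<^sub>M MQ) kernel_map"
  unfolding unitary_L2_def
proof (intro conjI ballI allI)
  fix H assume H: "H \<in> L2 (\<rho> \<Otimes>\<^sub>M MX)"
  show L: "kernel_map H \<in> L2 (MQ \<Otimes>\<^sub>M MQ)" using H by (rule kernel_map_L2)
  show "(\<integral>z. (cmod (kernel_map H z))\<^sup>2 \<partial>(MQ \<Otimes>\<^sub>M MQ)) = (\<integral>z. (cmod (H z))\<^sup>2 \<partial>(\<rho> \<Otimes>\<^sub>M MX))"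
    by (rule integral_eq_nn_integral_L2[OF L H kernel_map_norm[OF L2_measurable[OF H]]])
next
  fix h assume h: "h \<in> L2 (MQ \<Otimes>\<^sub>M MQ)"
  note [measurable] = L2_measurable[OF h]
  obtain \<theta> where \<theta> [measurable]: "\<theta> \<in> borel \<rightarrow>\<^sub>M borel" and inv: "AE q in MQ. \<theta> (\<eta> q) = q"
    by (rule eta_inverse)
  define k where "k z = h z / kernel_weight z" for z
  have [measurable]: "k \<in> borel_measurable (MQ \<Otimes>\<^sub>M MQ)" unfolding k_def by measurable
  \<comment> \<open>Solves \<xi> = \<eta>(q_0) - \<eta>(q) for q by means of the left inverse
    \<theta>.\<close>
  define H where "H = (\<lambda>(q, \<xi>). k (q, \<theta> (\<eta> q - \<xi>)))"
  have H [measurable]: "H \<in> borel_measurable (\<rho> \<Otimes>\<^sub>M MX)" unfolding H_def split_beta' by measurable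
  note [measurable] = kernel_map_measurable[OF H]
  have eq: "AE z in MQ \<Otimes>\<^sub>M MQ. kernel_map H z = h z"
  proof (rule QQ.AE_pair_measure)
    show "{z \<in> space (MQ \<Otimes>\<^sub>M MQ). kernel_map H z = h z} \<in> sets (MQ \<Otimes>\<^sub>M MQ)" by measurable
    show "AE q\<^sub>0 in MQ. AE q in MQ. kernel_map H (q\<^sub>0, q) = h (q\<^sub>0, q)"
      by (rule AE_I2, use inv in eventually_elim)
        (simp add: kernel_map_def H_def k_def kernel_weight_neq_0)
  qed
  have "(\<integral>\<^sup>+z. ennreal ((cmod (H z))\<^sup>2) \<partial>(\<rho> \<Otimes>\<^sub>M MX)) = (\<integral>\<^sup>+z. ennreal ((cmod (h z))\<^sup>2) \<partial>(MQ \<Otimes>\<^sub>M MQ))"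
    unfolding kernel_map_norm[OF H, symmetric]
    by (rule nn_integral_cong_AE, use eq in eventually_elim) simp
  then have "H \<in> L2 (\<rho> \<Otimes>\<^sub>M MX)" using h H by (simp add: L2_nn_integral_iff)
  then show "\<exists>H\<in>L2 (\<rho> \<Otimes>\<^sub>M MX). AE z in MQ \<Otimes>\<^sub>M MQ. kernel_map H z = h z" using eq by blast
qed (simp_all add: kernel_map_def split_beta' algebra_simps)

lemma ext_haar_eq: "ext_haar MQ MV act = \<rho> \<Otimes>\<^sub>M MV"
proof -
  have "\<rho> \<Otimes>\<^sub>M density MV (\<lambda>_. 1) = density (MQ \<Otimes>\<^sub>M MV) (\<lambda>(x, y). ennreal (inverse (m x)) * 1)"
    unfolding \<rho>_def
    by (rule pair_measure_density) (simp_all add: density_1 V.sigma_finite_measure_axioms)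
  then show ?thesis by (simp add: ext_haar_def density_1)
qed

theorem quantization_unitary:
  obtains U where "unitary_L2 (\<rho> \<Otimes>\<^sub>M MV) (MQ \<Otimes>\<^sub>M MQ) U"
    "\<And>f. f \<in> L2 (\<rho> \<Otimes>\<^sub>M MV) \<Longrightarrow> integrable (\<rho> \<Otimes>\<^sub>M MV) f \<Longrightarrow>
      AE z in MQ \<Otimes>\<^sub>M MQ. U f z = Op_kernel MV act \<eta> b f z"
proof -
  obtain P where P: "unitary_L2 (\<rho> \<Otimes>\<^sub>M MV) (\<rho> \<Otimes>\<^sub>M MX) P"
    "\<And>f. f \<in> L2 (\<rho> \<Otimes>\<^sub>M MV) \<Longrightarrow> integrable (\<rho> \<Otimes>\<^sub>M MV) f \<Longrightarrow>
      AE z in \<rho> \<Otimes>\<^sub>M MX. P f z = partial_fourier MV f z"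
    using partial_plancherel[OF sigma_finite_rho] by blast
  have "AE z in MQ \<Otimes>\<^sub>M MQ. kernel_map (P f) z = Op_kernel MV act \<eta> b f z"
    if f: "f \<in> L2 (\<rho> \<Otimes>\<^sub>M MV)" "integrable (\<rho> \<Otimes>\<^sub>M MV) f" for f
  proof -
    have PL: "P f \<in> L2 (\<rho> \<Otimes>\<^sub>M MX)" using f(1) by (rule unitary_L2D(1)[OF P(1)])
    have FL: "partial_fourier MV f \<in> L2 (\<rho> \<Otimes>\<^sub>M MX)"
      by (rule L2_bound[OF PL borel_measurable_partial_fourier[OF L2_measurable[OF f(1)]], where c=1])
        (use P(2)[OF f] in eventually_elim, simp)
    \<comment> \<open>\<open>P f\<close> and the Fourier integral differ on a null set for
      \<open>\<rho> \<Otimes>\<^sub>M MX\<close>, which would have to be pulled back through \<eta>;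
      isometry of \<open>kernel_map\<close> does this at once.\<close>
    have "l2dist (MQ \<Otimes>\<^sub>M MQ) (kernel_map (P f)) (kernel_map (partial_fourier MV f)) =
        l2dist (\<rho> \<Otimes>\<^sub>M MX) (P f) (partial_fourier MV f)"
      using unitary_L2_imp_isometry[OF unitary_kernel_map] PL FL by (simp add: l2_isometry_def)
    also have "\<dots> = 0" using P(2)[OF f] l2dist_eq_0_iff[OF PL FL] by simp
    finally show ?thesis
      using l2dist_eq_0_iff[OF kernel_map_L2[OF PL] kernel_map_L2[OF FL]] by (simp add: Op_kernel_eq)
  qed
  with unitary_L2_compose[OF P(1) unitary_kernel_map] show ?thesis by (rule that)
qed

end

section \<open>The extension group and the intertwining relation\<close>

lemma cnj_eq_inverse: "cmod z = 1 \<Longrightarrow> cnj z = inverse z"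
  by (metis complex_norm_square inverse_unique mult.commute of_real_1 one_power2)

context cocycle_pair
begin

abbreviation "G \<equiv> \<rho> \<Otimes>\<^sub>M MV"

section \<open>The extension as a measured group, and its compactly supported functions\<close>

lemma space_G: "space G = UNIV" by (simp add: space_pair_measure)

lemma sets_G: "sets G = sets (borel :: ('q \<times> 'v) measure)"
proof -
  have "sets G = sets (borel \<Otimes>\<^sub>M borel :: ('q \<times> 'v) measure)"
    by (rule sets_pair_measure_cong) simp_all
  then show ?thesis unfolding borel_prod .
qed

lemma measurable_ext_mult [measurable (raw)]:
  assumes [measurable]: "f \<in> K \<rightarrow>\<^sub>M G" "h \<in> K \<rightarrow>\<^sub>M G"
  shows "(\<lambda>z. ext_mult act \<beta> (f z) (h z)) \<in> K \<rightarrow>\<^sub>M G"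
proof -
  have [measurable]: "(\<lambda>z. fst (f z)) \<in> K \<rightarrow>\<^sub>M borel" "(\<lambda>z. fst (h z)) \<in> K \<rightarrow>\<^sub>M borel"
    "(\<lambda>z. snd (f z)) \<in> K \<rightarrow>\<^sub>M borel" "(\<lambda>z. snd (h z)) \<in> K \<rightarrow>\<^sub>M borel"
    using assms[THEN measurable_compose, OF measurable_fst] assms[THEN measurable_compose, OF measurable_snd]
    unfolding measurable_cong_sets[OF refl sets_rho] measurable_cong_sets[OF refl sets_V] .
  show ?thesis unfolding ext_mult_def split_beta' by measurable
qed

lemma measurable_ext_inv: "ext_inv act \<beta> \<in> G \<rightarrow>\<^sub>M G"
  unfolding ext_inv_def split_beta' by measurable

text \<open>On the fibre, left multiplication is \<open>act r\<close> followed by a translation that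
  absorbs the value of \<beta>, and it contributes |r|^{-1}. Together with |q|^{-1} this is the
  density at the product r q, and left invariance of dq finishes.\<close>

lemma nn_integral_ext_mult:
  assumes [measurable]: "f \<in> borel_measurable G"
  shows "(\<integral>\<^sup>+z. f (ext_mult act \<beta> g z) \<partial>G) = (\<integral>\<^sup>+z. f z \<partial>G)"
proof -
  obtain r w where g: "g = (r, w)" by (cases g)
  define F where "F q = (\<integral>\<^sup>+v. f (q, v) \<partial>MV)" for q
  have [measurable]: "F \<in> borel_measurable borel" unfolding F_def by measurable
  have "(\<integral>\<^sup>+z. f (ext_mult act \<beta> g z) \<partial>G) = (\<integral>\<^sup>+q. \<integral>\<^sup>+v. f (ext_mult act \<beta> g (q, v)) \<partial>MV \<partial>\<rho>)"
    by (rule V.nn_integral_fst[symmetric]) (simp add: g, measurable)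
  also have "\<dots> = (\<integral>\<^sup>+q. ennreal (inverse (m r)) * F (r + q) \<partial>\<rho>)"
  proof (rule nn_integral_cong)
    fix q
    have "(\<integral>\<^sup>+v. f (ext_mult act \<beta> g (q, v)) \<partial>MV) = (\<integral>\<^sup>+v. (\<lambda>v. f (r + q, (w + \<beta> r q) + v)) (act r v) \<partial>MV)"
      by (simp add: g ext_mult_def ac_simps)
    also have "\<dots> = ennreal (inverse (m r)) * (\<integral>\<^sup>+v. f (r + q, (w + \<beta> r q) + v) \<partial>MV)"
      by (rule nn_integral_act) measurable
    also have "(\<integral>\<^sup>+v. f (r + q, (w + \<beta> r q) + v) \<partial>MV) = F (r + q)"
      unfolding F_def by (rule nn_integral_translate_V) measurable
    finally show "(\<integral>\<^sup>+v. f (ext_mult act \<beta> g (q, v)) \<partial>MV) = ennreal (inverse (m r)) * F (r + q)" .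
  qed
  also have "\<dots> = (\<integral>\<^sup>+q. (\<lambda>q. ennreal (inverse (m q)) * F q) (r + q) \<partial>MQ)"
    by (subst nn_integral_rho)
      (auto intro!: nn_integral_cong simp: modulus_add ennreal_mult mult_ac)
  also have "\<dots> = (\<integral>\<^sup>+q. ennreal (inverse (m q)) * F q \<partial>MQ)"
    by (rule nn_integral_translate_Q) measurable
  also have "\<dots> = (\<integral>\<^sup>+q. F q \<partial>\<rho>)" by (rule nn_integral_rho[symmetric]) measurable
  also have "\<dots> = (\<integral>\<^sup>+z. f z \<partial>G)" unfolding F_def by (rule V.nn_integral_fst) measurable
  finally show ?thesis .
qed

lemma distr_ext_mult: "distr G G (ext_mult act \<beta> g) = G"
proof (rule measure_eqI)
  fix A assume "A \<in> sets (distr G G (ext_mult act \<beta> g))"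
  then have A [measurable]: "A \<in> sets G" by (simp only: sets_distr)
  have g: "g \<in> space G" by (simp add: space_G)
  have [measurable]: "ext_mult act \<beta> g \<in> G \<rightarrow>\<^sub>M G"
    using measurable_ext_mult[OF measurable_const[OF g] measurable_ident] by simp
  have "emeasure (distr G G (ext_mult act \<beta> g)) A = (\<integral>\<^sup>+z. indicator A z \<partial>distr G G (ext_mult act \<beta> g))"
    by (rule nn_integral_indicator[symmetric]) (simp only: sets_distr A)
  also have "\<dots> = (\<integral>\<^sup>+z. indicator A (ext_mult act \<beta> g z) \<partial>G)"
    by (rule nn_integral_distr) measurable
  also have "\<dots> = (\<integral>\<^sup>+z. indicator A z \<partial>G)" by (rule nn_integral_ext_mult) measurable
  finally show "emeasure (distr G G (ext_mult act \<beta> g)) A = emeasure G A"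
    by (simp only: nn_integral_indicator[OF A])
qed simp

sublocale ext: invariant_group_measure "ext_mult act \<beta>" "ext_one \<beta>" "ext_inv act \<beta>" G
proof (rule invariant_group_measure.intro[OF group_ext[OF act beta]])
  show "sigma_finite_measure G" by (rule RV.sigma_finite_measure_axioms)
  have "(\<lambda>z. ext_mult act \<beta> (fst z) (snd z)) \<in> G \<Otimes>\<^sub>M G \<rightarrow>\<^sub>M G"
    by (rule measurable_ext_mult[OF measurable_fst measurable_snd])
  then show "invariant_group_measure_axioms (ext_mult act \<beta>) (ext_inv act \<beta>) G"
    by unfold_locales (simp_all add: space_G measurable_ext_inv distr_ext_mult split_beta')
qed

lemma ext_translate:
  assumes f: "f \<in> L2 G"
  shows "ext_regular act \<beta> g f \<in> L2 G"
    "integrable G f \<Longrightarrow> integrable G (ext_regular act \<beta> g f)"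
    "f' \<in> L2 G \<Longrightarrow> l2dist G (ext_regular act \<beta> g f) (ext_regular act \<beta> g f') = l2dist G f f'"
proof -
  have [measurable]: "ext_mult act \<beta> h \<in> G \<rightarrow>\<^sub>M G" for h
    using measurable_ext_mult[OF measurable_const[of h] measurable_ident] by (simp add: space_G)
  have L2: "ext_regular act \<beta> g f \<in> L2 G" if f: "f \<in> L2 G" for f
  proof -
    note [measurable] = L2_measurable[OF f]
    have "(\<integral>\<^sup>+z. ennreal ((cmod (ext_regular act \<beta> g f z))\<^sup>2) \<partial>G) = (\<integral>\<^sup>+z. ennreal ((cmod (f z))\<^sup>2) \<partial>G)"
      unfolding ext_regular_def by (rule nn_integral_ext_mult) measurable
    moreover have "ext_regular act \<beta> g f \<in> borel_measurable G"
      unfolding ext_regular_def by measurable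
    ultimately show ?thesis using f by (simp add: L2_nn_integral_iff)
  qed
  from f show "ext_regular act \<beta> g f \<in> L2 G" by (rule L2)
  note [measurable] = L2_measurable[OF f]
  show "integrable G (ext_regular act \<beta> g f)" if "integrable G f"
  proof -
    have "(\<integral>\<^sup>+z. ennreal (norm (ext_regular act \<beta> g f z)) \<partial>G) = (\<integral>\<^sup>+z. ennreal (norm (f z)) \<partial>G)"
      unfolding ext_regular_def by (rule nn_integral_ext_mult) measurable
    then show ?thesis using that L2_measurable[OF L2[OF f]] by (simp add: integrable_iff_bounded)
  qed
  show "l2dist G (ext_regular act \<beta> g f) (ext_regular act \<beta> g f') = l2dist G f f'" if f': "f' \<in> L2 G"
  proof -
    note [measurable] = L2_measurable[OF f']
    have "ennreal ((l2dist G (ext_regular act \<beta> g f) (ext_regular act \<beta> g f'))\<^sup>2) =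
        (\<integral>\<^sup>+z. ennreal ((cmod (ext_regular act \<beta> g f z - ext_regular act \<beta> g f' z))\<^sup>2) \<partial>G)"
      by (rule nn_integral_l2dist[OF L2[OF f] L2[OF f'], symmetric])
    also have "\<dots> = (\<integral>\<^sup>+z. ennreal ((cmod (f z - f' z))\<^sup>2) \<partial>G)"
      unfolding ext_regular_def by (rule nn_integral_ext_mult) measurable
    also have "\<dots> = ennreal ((l2dist G f f')\<^sup>2)" by (rule nn_integral_l2dist[OF f f'])
    finally show ?thesis by (simp add: power2_eq_iff_nonneg)
  qed
qed

text \<open>Such a function is bounded by a multiple of the indicator of a compact set K. This set
  is measurable since it is closed for \<open>T\<close>, and
  \<open>emeasure_compactin_finite\<close> makes its measure finite.\<close>

lemma Cc_ext:
  assumes T: "ext_topology act \<beta> T" and f: "f \<in> Cc T"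
  shows "f \<in> L2 G" "integrable G f"
proof -
  have top: "topspace T = UNIV" "Hausdorff_space T" "locally_compact_space T" "second_countable T"
    "continuous_map (prod_topology T T) T (\<lambda>(g, h). ext_mult act \<beta> g h)"
    "continuous_map T T (ext_inv act \<beta>)"
    and sets: "sigma_sets UNIV {U. openin T U} = sets (borel :: ('q \<times> 'v) measure)"
    using T unfolding ext_topology_def by auto
  have openG: "U \<in> sets G" if "openin T U" for U
    unfolding sets_G sets[symmetric] using that by (intro sigma_sets.Basic) simp
  obtain K where cont: "continuous_map T euclidean f" and K: "compactin T K" "\<And>x. x \<notin> K \<Longrightarrow> f x = 0"
    using f unfolding Cc_def top(1) by auto
  have [measurable]: "f \<in> borel_measurable G"
  proof (rule borel_measurableI)
    fix S :: "complex set" assume "open S"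
    then have "openin T {x \<in> topspace T. f x \<in> S}"
      by (intro openin_continuous_map_preimage[OF cont]) simp
    then show "f -` S \<inter> space G \<in> sets G"
      using openG by (simp add: top(1) space_G vimage_def)
  qed
  have "closedin T K" using K(1) top(2) by (rule compactin_imp_closedin[rotated])
  then have "openin T (UNIV - K)" by (simp add: closedin_def top(1))
  then have "UNIV - (UNIV - K) \<in> sets G" using openG sets.Diff[of UNIV G] sets.top[of G] space_G by metis
  then have KG [measurable]: "K \<in> sets G" by (simp add: double_diff)
  have "sets G = sigma_sets UNIV {U. openin T U}" unfolding sets_G sets ..
  then have fin: "emeasure G K < \<infinity>"
    using top K(1) by (intro ext.emeasure_compactin_finite)
  have "compactin euclidean (f ` K)" using K(1) cont by (rule image_compactin)
  then have "bounded (f ` K)" by (simp add: compact_imp_bounded)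
  then obtain C where C: "\<And>x. x \<in> K \<Longrightarrow> cmod (f x) \<le> C" by (auto simp: bounded_iff)
  have le: "cmod (f x) \<le> max C 0 * indicator K x" for x
    by (cases "x \<in> K") (use C[of x] K(2)[of x] in \<open>simp_all add: le_max_iff_disj\<close>)
  have int: "integrable G (indicator K :: _ \<Rightarrow> real)" using KG fin by (rule integrable_real_indicator)
  have sq: "(cmod (indicator K x))\<^sup>2 = indicator K x" for x :: "'q \<times> 'v" by (simp add: indicator_def)
  have IL: "indicator K \<in> L2 G"
    unfolding L2_def mem_Collect_eq sq using int KG by (intro conjI borel_measurable_indicator)
  have abs: "cmod (indicator K x) = indicator K x" for x :: "'q \<times> 'v" by (simp add: indicator_def)
  show "f \<in> L2 G" by (rule L2_bound[OF IL, where c="max C 0"]) (use le in \<open>auto simp: abs\<close>)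
  show "integrable G f"
  proof (rule Bochner_Integration.integrable_bound)
    show "integrable G (\<lambda>x. max C 0 * indicator K x)" using int by (rule integrable_mult_right)
    show "AE x in G. norm (f x) \<le> norm (max C 0 * indicator K x :: real)"
      using le by (auto intro: order_trans)
  qed measurable
qed

text \<open>The kernel of the conjugate of T by \<pi>(g) when k is the kernel of T. The last factor
  is the phase of the adjoint, expressed in the shifted variable y.\<close>

definition conj_kernel :: "'q \<times> 'v \<Rightarrow> ('q \<times> 'q \<Rightarrow> complex) \<Rightarrow> 'q \<times> 'q \<Rightarrow> complex" where
  "conj_kernel = (\<lambda>(q, v) k (x, y). cnj (pairing (\<eta> x) v) * b (- x) q * k (- q + x, - q + y) *
     (pairing (\<eta> y) v * cnj (b (- y) q)))"

lemma conj_kernel_measurable: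
  assumes [measurable]: "k \<in> borel_measurable (MQ \<Otimes>\<^sub>M MQ)"
  shows "conj_kernel g k \<in> borel_measurable (MQ \<Otimes>\<^sub>M MQ)"
  unfolding conj_kernel_def split_beta' by measurable

lemma nn_integral_translate_QQ:
  assumes [measurable]: "h \<in> borel_measurable (MQ \<Otimes>\<^sub>M MQ)"
  shows "(\<integral>\<^sup>+z. h (r + fst z, r + snd z) \<partial>(MQ \<Otimes>\<^sub>M MQ)) = (\<integral>\<^sup>+z. h z \<partial>(MQ \<Otimes>\<^sub>M MQ))"
proof -
  have "(\<integral>\<^sup>+z. h (r + fst z, r + snd z) \<partial>(MQ \<Otimes>\<^sub>M MQ)) = (\<integral>\<^sup>+x. \<integral>\<^sup>+y. h (r + x, r + y) \<partial>MQ \<partial>MQ)"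
    by (subst Q.nn_integral_fst[symmetric]) simp_all
  also have "\<dots> = (\<integral>\<^sup>+x. \<integral>\<^sup>+y. h (r + x, y) \<partial>MQ \<partial>MQ)"
    by (intro nn_integral_cong nn_integral_translate_Q) measurable
  also have "\<dots> = (\<integral>\<^sup>+x. \<integral>\<^sup>+y. h (x, y) \<partial>MQ \<partial>MQ)"
    by (rule nn_integral_translate_Q[of "\<lambda>x. \<integral>\<^sup>+y. h (x, y) \<partial>MQ"]) measurable
  also have "\<dots> = (\<integral>\<^sup>+z. h z \<partial>(MQ \<Otimes>\<^sub>M MQ))" by (rule Q.nn_integral_fst) measurable
  finally show ?thesis .
qed

lemma conj_kernel_norm:
  assumes [measurable]: "k \<in> borel_measurable (MQ \<Otimes>\<^sub>M MQ)"
  shows "(\<integral>\<^sup>+z. ennreal ((cmod (conj_kernel g k z))\<^sup>2) \<partial>(MQ \<Otimes>\<^sub>M MQ)) =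
    (\<integral>\<^sup>+z. ennreal ((cmod (k z))\<^sup>2) \<partial>(MQ \<Otimes>\<^sub>M MQ))"
proof -
  obtain q v where g: "g = (q, v)" by (cases g)
  have "(\<integral>\<^sup>+z. ennreal ((cmod (conj_kernel g k z))\<^sup>2) \<partial>(MQ \<Otimes>\<^sub>M MQ)) =
      (\<integral>\<^sup>+z. (\<lambda>z. ennreal ((cmod (k z))\<^sup>2)) (- q + fst z, - q + snd z) \<partial>(MQ \<Otimes>\<^sub>M MQ))"
    by (intro nn_integral_cong) (simp add: conj_kernel_def g split_beta' norm_mult)
  also have "\<dots> = (\<integral>\<^sup>+z. ennreal ((cmod (k z))\<^sup>2) \<partial>(MQ \<Otimes>\<^sub>M MQ))"
    by (rule nn_integral_translate_QQ) measurable
  finally show ?thesis .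
qed

lemma conj_kernel_isometry: "l2_isometry (MQ \<Otimes>\<^sub>M MQ) (MQ \<Otimes>\<^sub>M MQ) (conj_kernel g)"
proof -
  have L: "conj_kernel g k \<in> L2 (MQ \<Otimes>\<^sub>M MQ)" if "k \<in> L2 (MQ \<Otimes>\<^sub>M MQ)" for k
    using that by (simp add: L2_nn_integral_iff conj_kernel_norm conj_kernel_measurable)
  have "l2dist (MQ \<Otimes>\<^sub>M MQ) (conj_kernel g k) (conj_kernel g k') = l2dist (MQ \<Otimes>\<^sub>M MQ) k k'"
    if k: "k \<in> L2 (MQ \<Otimes>\<^sub>M MQ)" and k': "k' \<in> L2 (MQ \<Otimes>\<^sub>M MQ)" for k k'
  proof -
    have diff: "conj_kernel g k z - conj_kernel g k' z = conj_kernel g (\<lambda>z. k z - k' z) z" for z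
      by (simp add: conj_kernel_def split_beta' algebra_simps)
    have "ennreal ((l2dist (MQ \<Otimes>\<^sub>M MQ) (conj_kernel g k) (conj_kernel g k'))\<^sup>2) =
        (\<integral>\<^sup>+z. ennreal ((cmod (k z - k' z))\<^sup>2) \<partial>(MQ \<Otimes>\<^sub>M MQ))"
      unfolding nn_integral_l2dist[OF L[OF k] L[OF k'], symmetric] diff
      by (rule conj_kernel_norm[OF L2_measurable[OF L2_diff[OF k k']]])
    also have "\<dots> = ennreal ((l2dist (MQ \<Otimes>\<^sub>M MQ) k k')\<^sup>2)" by (rule nn_integral_l2dist[OF k k'])
    finally show ?thesis by (simp add: power2_eq_iff_nonneg)
  qed
  with L show ?thesis by (simp add: l2_isometry_def)
qed

section \<open>Covariance of the kernel under translation\<close>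

lemma beta_cocycle: "\<beta> q r + \<beta> (q + r) s = act q (\<beta> r s) + \<beta> q (r + s)"
  using beta by (simp add: Z2_def)

lemma beta_zero: "\<beta> 0 r = \<beta> 0 0"
  using beta_cocycle[of 0 0 r] by (simp add: act_simps(3))

text \<open>Coordinates of a quotient in the form that the Fourier integral calls for: a translation
  of w followed by the action of q^{-1}. The cocycle identity at (q^{-1}, q, q^{-1} x) removes all
  other values of \<beta>, including \<open>\<beta> 0 0\<close>.\<close>

lemma ext_translate_eq:
  "ext_mult act \<beta> (ext_inv act \<beta> (q, v)) (x, w) = (- q + x, act (- q) (w - (v + \<beta> q (- q + x))))"
proof -
  have "\<beta> (- q) q + \<beta> 0 0 = act (- q) (\<beta> q (- q + x)) + \<beta> (- q) x"
    using beta_cocycle[of "- q" q "- q + x"] beta_zero[of "- q + x"] by (simp flip: add.assoc)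
  then have "\<beta> (- q) x = \<beta> (- q) q + \<beta> 0 0 - act (- q) (\<beta> q (- q + x))"
    by (simp add: algebra_simps)
  then show ?thesis by (simp add: ext_mult_def ext_inv_def act_diff act_simps(1))
qed

text \<open>The cocycle identity expands \<eta>(q^{-1} z) into \<eta>(q^{-1}) plus the dual action
  of q^{-1} on \<eta>(z). The first summand is common to z = x and z = y and cancels in the
  difference.\<close>

lemma pairing_eta_act:
  "pairing (\<eta> x - \<eta> y) (act q u) = pairing (\<eta> (- q + x) - \<eta> (- q + y)) u"
proof -
  have "pairing (\<eta> (- q + z)) u = pairing (\<eta> (- q)) u * pairing (\<eta> z) (act q u)" for z
    using eta by (simp add: Z1c_def pairing_plus pairing_dual_act[OF act])
  moreover have "pairing (\<eta> (- q)) u * cnj (pairing (\<eta> (- q)) u) = 1"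
    by (simp flip: complex_norm_square)
  ultimately show ?thesis by (simp add: pairing_minus mult_ac)
qed

text \<open>Translating w gives the phase, and substituting w = q u gives the factor |q|. Both
  substitutions are valid for every Borel function, so the identity holds at every point.\<close>

lemma partial_fourier_translate:
  assumes [measurable]: "f \<in> borel_measurable G"
  shows "partial_fourier MV (ext_regular act \<beta> (q, v) f) (x, \<eta> x - \<eta> y) =
    cnj (pairing (\<eta> x - \<eta> y) (v + \<beta> q (- q + x))) * of_real (m q) *
    partial_fourier MV f (- q + x, \<eta> (- q + x) - \<eta> (- q + y))"
proof -
  let ?\<xi> = "\<eta> x - \<eta> y" and ?s = "v + \<beta> q (- q + x)"
  have "partial_fourier MV (ext_regular act \<beta> (q, v) f) (x, ?\<xi>) =
      (\<integral>w. cnj (pairing ?\<xi> w) * f (- q + x, act (- q) (w - ?s)) \<partial>MV)"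
    by (simp add: partial_fourier_def fourier_def ext_regular_def ext_translate_eq)
  also have "\<dots> = (\<integral>w. cnj (pairing ?\<xi> (?s + w)) * f (- q + x, act (- q) (?s + w - ?s)) \<partial>MV)"
    by (rule integral_translate_V[symmetric]) measurable
  also have "\<dots> = cnj (pairing ?\<xi> ?s) * (\<integral>w. cnj (pairing ?\<xi> w) * f (- q + x, act (- q) w) \<partial>MV)"
    by (simp add: pairing_add_right mult.assoc)
  also have "(\<integral>w. cnj (pairing ?\<xi> w) * f (- q + x, act (- q) w) \<partial>MV) =
      (\<integral>w. (\<lambda>u. cnj (pairing ?\<xi> (act q u)) * f (- q + x, u)) (act (- q) w) \<partial>MV)"
    by simp
  also have "\<dots> = of_real (inverse (m (- q))) * (\<integral>u. cnj (pairing ?\<xi> (act q u)) * f (- q + x, u) \<partial>MV)"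
    by (rule integral_act) measurable
  finally show ?thesis
    by (simp add: partial_fourier_def fourier_def pairing_eta_act modulus_uminus mult.assoc)
qed

text \<open>The relation \<psi> = \<partial>b at (x^{-1}, q, r) with denominators cleared; inverting
  the first argument makes \<eta>(x) appear.\<close>

lemma psi_eq: "pairing (\<eta> x) (\<beta> q r) * (b (- x) q * b (- x + q) r) = b q r * b (- x) (q + r)"
proof -
  have "b (- x) q \<noteq> 0" "b (- x + q) r \<noteq> 0" using norm_b by (metis norm_zero zero_neq_one)+
  moreover have "psi \<eta> \<beta> (- x) q r = coboundary b (- x) q r" using psi by simp
  ultimately show ?thesis by (simp add: psi_def coboundary_def field_simps)
qed

lemma Op_kernel_translate:
  assumes f: "f \<in> borel_measurable G"
  shows "Op_kernel MV act \<eta> b (ext_regular act \<beta> g f) = conj_kernel g (Op_kernel MV act \<eta> b f)"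
proof (rule ext)
  fix z :: "'q \<times> 'q"
  obtain q v x y where g: "g = (q, v)" and z: "z = (x, y)" by (metis surj_pair)
  define r where "r = - q + x"
  have qr: "q + r = x" by (simp add: r_def flip: add.assoc)
  have nz: "b s t \<noteq> 0" for s t using norm_b[of s t] by (metis norm_zero zero_neq_one)
  have pnz: "pairing \<xi> u \<noteq> 0" for \<xi> :: "'v dual" and u using norm_pairing[of \<xi> u] by (metis norm_zero zero_neq_one)
  note inv = cnj_eq_inverse[OF norm_b] cnj_eq_inverse[OF norm_pairing]
  have px: "pairing (\<eta> x) (\<beta> q r) = b q r * b (- x) x / (b (- x) q * b (- x + q) r)"
    using psi_eq[of x q r] nz by (simp add: qr field_simps)
  have py: "pairing (\<eta> y) (\<beta> q r) = b q r * b (- y) x / (b (- y) q * b (- y + q) r)"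
    using psi_eq[of y q r] nz by (simp add: qr field_simps)
  \<comment> \<open>The factor \<open>b q r\<close>, common to \<open>px\<close> and
    \<open>py\<close>, cancels. Beside the phases of the conjugation there remain exactly the two
    values of \<open>b\<close> in the kernel at the shifted point.\<close>
  have phase: "b (- x) x * cnj (b (- y) x) * cnj (pairing (\<eta> x - \<eta> y) (v + \<beta> q r)) =
      cnj (pairing (\<eta> x) v) * b (- x) q * (pairing (\<eta> y) v * cnj (b (- y) q)) *
        (b (- x + q) r * cnj (b (- y + q) r))"
    unfolding pairing_minus pairing_add_right complex_cnj_mult complex_cnj_divide complex_cnj_cnj inv px py
    using nz pnz by (simp add: inv field_simps)
  \<comment> \<open>Both arguments are shifted by q^{-1}, so the power -1/2 of the modulus gains a
    factor |q|, the same that the Fourier transform of the translate produces.\<close>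
  have "m (r + (- q + y)) = m (x + y) * inverse (m q) ^ 2"
    by (simp add: r_def modulus_add modulus_uminus power2_eq_square mult_ac)
  then have "m (r + (- q + y)) powr (- 1 / 2) = m (x + y) powr (- 1 / 2) * (inverse (m q) ^ 2) powr (- 1 / 2)"
    by (simp only: powr_mult)
  also have "(inverse (m q) ^ 2) powr (- 1 / 2) = m q"
    by (simp add: powr_minus powr_half_sqrt)
  finally have md: "m (r + (- q + y)) powr (- 1 / 2) = m (x + y) powr (- 1 / 2) * m q" .
  have "Op_kernel MV act \<eta> b (ext_regular act \<beta> g f) z =
      of_real (m (x + y) powr (- 1 / 2) * m q) *
      (b (- x) x * cnj (b (- y) x) * cnj (pairing (\<eta> x - \<eta> y) (v + \<beta> q r))) *
      partial_fourier MV f (r, \<eta> r - \<eta> (- q + y))"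
    by (simp add: Op_kernel_def g z partial_fourier_translate[OF f] r_def mult_ac)
  also have "\<dots> = conj_kernel g (Op_kernel MV act \<eta> b f) z"
    unfolding phase md[symmetric]
    by (simp add: conj_kernel_def Op_kernel_def g z r_def minus_add mult_ac)
  finally show "Op_kernel MV act \<eta> b (ext_regular act \<beta> g f) z = conj_kernel g (Op_kernel MV act \<eta> b f) z" .
qed

text \<open>Both sides are isometric in \<open>f\<close>, so it is enough to compare them on the
  dense space of integrable functions, where \<open>Op_kernel_translate\<close> applies.\<close>

lemma intertwining_kernel:
  assumes U: "unitary_L2 G (MQ \<Otimes>\<^sub>M MQ) U"
    and UK: "\<And>f. f \<in> L2 G \<Longrightarrow> integrable G f \<Longrightarrow> AE z in MQ \<Otimes>\<^sub>M MQ. U f z = Op_kernel MV act \<eta> b f z"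
    and f: "f \<in> L2 G"
  shows "AE z in MQ \<Otimes>\<^sub>M MQ. U (ext_regular act \<beta> g f) z = conj_kernel g (U f) z"
proof (rule l2_isometry_unique[where D="{f \<in> L2 G. integrable G f}", OF _ _ _ _ _ f])
  note iU = unitary_L2_imp_isometry[OF U]
  note UL = unitary_L2D(1)[OF U]
  show "l2_isometry G (MQ \<Otimes>\<^sub>M MQ) (\<lambda>f. U (ext_regular act \<beta> g f))"
    using iU ext_translate(1,3) by (simp add: l2_isometry_def)
  show "l2_isometry G (MQ \<Otimes>\<^sub>M MQ) (\<lambda>f. conj_kernel g (U f))"
    using iU conj_kernel_isometry[of g] by (simp add: l2_isometry_def)
  show "{f \<in> L2 G. integrable G f} \<subseteq> L2 G" by blast
  show "\<exists>h\<in>{f \<in> L2 G. integrable G f}. l2dist G f h < e" if "e > 0" for e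
    using RV.L1_dense_L2[OF f that] by (metis (mono_tags, lifting) mem_Collect_eq)
  fix h assume "h \<in> {f \<in> L2 G. integrable G f}"
  then have h: "h \<in> L2 G" "integrable G h" by auto
  \<comment> \<open>Membership in L2 is inherited from \<open>U h\<close>, with which the kernel
    agrees almost everywhere.\<close>
  have KL: "Op_kernel MV act \<eta> b h \<in> L2 (MQ \<Otimes>\<^sub>M MQ)"
  proof (rule L2_bound[OF UL[OF h(1)], where c=1])
    show "Op_kernel MV act \<eta> b h \<in> borel_measurable (MQ \<Otimes>\<^sub>M MQ)"
      unfolding Op_kernel_eq
      by (rule kernel_map_measurable[OF borel_measurable_partial_fourier[OF L2_measurable[OF h(1)]]])
  qed (use UK[OF h] in eventually_elim, simp)
  have "l2dist (MQ \<Otimes>\<^sub>M MQ) (conj_kernel g (U h)) (conj_kernel g (Op_kernel MV act \<eta> b h)) = 0"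
    using conj_kernel_isometry[of g] UL[OF h(1)] KL l2dist_eq_0_iff[OF UL[OF h(1)] KL] UK[OF h]
    by (simp add: l2_isometry_def)
  then have "AE z in MQ \<Otimes>\<^sub>M MQ. conj_kernel g (U h) z = conj_kernel g (Op_kernel MV act \<eta> b h) z"
    using conj_kernel_isometry[of g] UL[OF h(1)] KL
    by (subst (asm) l2dist_eq_0_iff) (simp_all add: l2_isometry_def)
  moreover have "AE z in MQ \<Otimes>\<^sub>M MQ. U (ext_regular act \<beta> g h) z = Op_kernel MV act \<eta> b (ext_regular act \<beta> g h) z"
    using ext_translate(1)[OF h(1)] ext_translate(2)[OF h] by (rule UK)
  ultimately show "AE z in MQ \<Otimes>\<^sub>M MQ. U (ext_regular act \<beta> g h) z = conj_kernel g (U h) z"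
    unfolding Op_kernel_translate[OF L2_measurable[OF h(1)]] by eventually_elim simp
qed

text \<open>Ties \<open>conj_kernel\<close> to conjugation of operators: replacing y by q y in the
  integral makes its second phase that of the adjoint.\<close>

lemma kernel_op_conj_kernel:
  assumes k [measurable]: "k \<in> borel_measurable (MQ \<Otimes>\<^sub>M MQ)" and [measurable]: "\<phi> \<in> borel_measurable MQ"
  shows "kernel_op MQ (conj_kernel g k) \<phi> x = proj_rep \<eta> b g (kernel_op MQ k (proj_rep_adj \<eta> b g \<phi>)) x"
proof -
  obtain q v where g: "g = (q, v)" by (cases g)
  let ?F = "\<lambda>y. k (- q + x, - q + y) * (pairing (\<eta> y) v * cnj (b (- y) q) * \<phi> y)"
  have "kernel_op MQ (conj_kernel g k) \<phi> x = cnj (pairing (\<eta> x) v) * b (- x) q * (\<integral>y. ?F y \<partial>MQ)"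
    unfolding kernel_op_def integral_mult_right_zero[symmetric]
    by (simp add: conj_kernel_def g mult.assoc)
  also have "(\<integral>y. ?F y \<partial>MQ) = (\<integral>y. ?F (q + y) \<partial>MQ)"
    by (rule integral_translate_Q[symmetric]) measurable
  also have "\<dots> = kernel_op MQ k (proj_rep_adj \<eta> b g \<phi>) (- q + x)"
    by (simp add: kernel_op_def proj_rep_adj_def g flip: add.assoc)
  finally show ?thesis by (simp add: proj_rep_def g)
qed

lemma intertwining:
  assumes U: "unitary_L2 G (MQ \<Otimes>\<^sub>M MQ) U"
    and UK: "\<And>f. f \<in> L2 G \<Longrightarrow> integrable G f \<Longrightarrow> AE z in MQ \<Otimes>\<^sub>M MQ. U f z = Op_kernel MV act \<eta> b f z"
    and f: "f \<in> L2 G" and \<phi>: "\<phi> \<in> L2 MQ"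
  shows "AE x in MQ. kernel_op MQ (U (ext_regular act \<beta> g f)) \<phi> x =
    proj_rep \<eta> b g (kernel_op MQ (U f) (proj_rep_adj \<eta> b g \<phi>)) x"
proof -
  note mU = L2_measurable[OF unitary_L2D(1)[OF U f]]
  note [measurable] = L2_measurable[OF unitary_L2D(1)[OF U ext_translate(1)[OF f]]] mU
    L2_measurable[OF \<phi>] conj_kernel_measurable[OF mU]
  \<comment> \<open>A null set of Q \<times> Q has null sections for almost every x, and changing
    the kernel on such a section does not alter the integral over y.\<close>
  have "AE x in MQ. AE y in MQ. U (ext_regular act \<beta> g f) (x, y) = conj_kernel g (U f) (x, y)"
    using QQ.AE_pair[OF intertwining_kernel[OF U UK f]] .
  then show ?thesis
  proof eventually_elim
    case (elim x)
    have "kernel_op MQ (U (ext_regular act \<beta> g f)) \<phi> x = kernel_op MQ (conj_kernel g (U f)) \<phi> x"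
      unfolding kernel_op_def
      by (rule integral_cong_AE) (measurable, use elim in eventually_elim, simp)
    then show ?case by (simp add: kernel_op_conj_kernel[OF mU L2_measurable[OF \<phi>]])
  qed
qed

end

section \<open>The sesquilinear form\<close>

lemma Cc_euclidean_bound:
  fixes \<phi> :: "'a::topological_space \<Rightarrow> complex"
  assumes "\<phi> \<in> Cc euclidean"
  obtains C K where "C \<ge> 0" "compact K" "\<And>x. cmod (\<phi> x) \<le> C" "\<And>x. x \<notin> K \<Longrightarrow> \<phi> x = 0"
    "\<phi> \<in> borel_measurable borel"
proof -
  obtain K where K: "continuous_on UNIV \<phi>" "compact K" "\<And>x. x \<notin> K \<Longrightarrow> \<phi> x = 0"
    using assms by (auto simp: Cc_def)
  have "compact (\<phi> ` K)"
    using K(2) by (intro compact_continuous_image continuous_on_subset[OF K(1)]) auto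
  then obtain C where C: "\<And>x. x \<in> K \<Longrightarrow> cmod (\<phi> x) \<le> C"
    using compact_imp_bounded bounded_iff by (metis image_eqI)
  have "cmod (\<phi> x) \<le> max C 0" for x
    by (cases "x \<in> K") (use C[of x] K(3)[of x] in \<open>simp_all add: le_max_iff_disj\<close>)
  then show ?thesis
    using K(2,3) borel_measurable_continuous_onI[OF K(1)] by (intro that[of "max C 0" K]) auto
qed

context cocycle_pair
begin

text \<open>The powers 1/2 and -1/2 arise when |q_0|^{-1/2} is split in the inner integral of
  \<open>Op\<close>. On the compact support of \<phi> they are controlled by
  \<open>modulus_bounded\<close>.\<close>

lemma Cc_modulus_bound:
  assumes "\<phi> \<in> Cc euclidean"
  obtains C K where "C \<ge> 0" "compact K" "\<phi> \<in> borel_measurable borel"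
    "\<And>q. cmod (\<phi> q) * m q powr (1 / 2) \<le> C"
    "\<And>q. cmod (\<phi> q) * m q powr (- 1 / 2) \<le> C * indicator K q"
proof -
  obtain C K where C: "C \<ge> 0" "compact K" "\<And>x. cmod (\<phi> x) \<le> C" "\<And>x. x \<notin> K \<Longrightarrow> \<phi> x = 0"
    "\<phi> \<in> borel_measurable borel" using assms by (rule Cc_euclidean_bound) blast
  obtain c where c: "c > 0" "\<And>q. q \<in> K \<Longrightarrow> m q \<le> c" "\<And>q. q \<in> K \<Longrightarrow> inverse (m q) \<le> c"
    using C(2) by (rule modulus_bounded) blast
  show ?thesis
  proof (rule that[of "C * c powr (1 / 2)" K])
    show "cmod (\<phi> q) * m q powr (1 / 2) \<le> C * c powr (1 / 2)" for q
    proof (cases "q \<in> K")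
      case True
      have "m q powr (1 / 2) \<le> c powr (1 / 2)" using c(2)[OF True] by (intro powr_mono2) auto
      then show ?thesis using C(1,3) by (intro mult_mono) auto
    qed (use C c in simp)
    show "cmod (\<phi> q) * m q powr (- 1 / 2) \<le> C * c powr (1 / 2) * indicator K q" for q
    proof (cases "q \<in> K")
      case True
      have "m q powr (- 1 / 2) = inverse (m q) powr (1 / 2)"
        by (simp add: powr_minus inverse_powr)
      also have "\<dots> \<le> c powr (1 / 2)" using c(3)[OF True] by (intro powr_mono2) auto
      finally show ?thesis using C(1,3) True by (simp add: mult_mono)
    qed (use C c in simp)
  qed (use C in auto)
qed

text \<open>The inner integrand of \<open>Op\<close> in the variable y = q q_0, without the factor
  |q|^{1/2} that is constant in y.\<close>

definition orbit_integrand :: "('q \<Rightarrow> complex) \<Rightarrow> 'q \<times> 'v \<Rightarrow> 'q \<Rightarrow> complex" where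
  "orbit_integrand \<phi> = (\<lambda>(q, v) y.
     pairing (\<eta> y) v * cnj (b (- y) q) * \<phi> y * complex_of_real (m y powr (- 1 / 2)))"

lemma Op_inner_eq:
  "Op_inner MV act \<eta> b \<phi> (q, v) q\<^sub>0 = complex_of_real (m q powr (1 / 2)) * orbit_integrand \<phi> (q, v) (q + q\<^sub>0)"
proof -
  have "m q powr (1 / 2) * m (q + q\<^sub>0) powr (- 1 / 2) = m q powr (1 / 2) * m q powr (- 1 / 2) * m q\<^sub>0 powr (- 1 / 2)"
    by (simp add: modulus_add powr_mult)
  also have "\<dots> = m q\<^sub>0 powr (- 1 / 2)" by (simp flip: powr_add)
  finally have *: "complex_of_real (m q\<^sub>0 powr (- 1 / 2)) =
      complex_of_real (m q powr (1 / 2)) * complex_of_real (m (q + q\<^sub>0) powr (- 1 / 2))"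
    by (simp only: flip: of_real_mult)
  show ?thesis
    unfolding Op_inner_def proj_rep_adj_def orbit_integrand_def * by (simp add: mult_ac)
qed

lemma orbit_integrand_measurable:
  assumes [measurable]: "\<phi> \<in> borel_measurable borel"
  shows "orbit_integrand \<phi> g \<in> borel_measurable borel"
  unfolding orbit_integrand_def split_beta' by measurable

lemma integrable_indicator_compact: "compact K \<Longrightarrow> integrable MQ (indicator K :: 'q \<Rightarrow> real)"
  using MQ by (intro integrable_real_indicator) (auto simp: left_haar_measure_def borel_compact)

lemma integrable_Op_inner:
  assumes \<phi>: "\<phi> \<in> Cc euclidean"
  shows "integrable MQ (Op_inner MV act \<eta> b \<phi> g)"
proof -
  obtain q v where g: "g = (q, v)" by (cases g)
  obtain C K where C: "C \<ge> 0" "compact K" "\<phi> \<in> borel_measurable borel"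
    "\<And>q. cmod (\<phi> q) * m q powr (1 / 2) \<le> C"
    "\<And>q. cmod (\<phi> q) * m q powr (- 1 / 2) \<le> C * indicator K q"
    using Cc_modulus_bound[OF \<phi>] by blast
  note [measurable] = orbit_integrand_measurable[OF C(3)]
  have "integrable MQ (\<lambda>y. C * indicator K y)"
    using integrable_indicator_compact[OF C(2)] by (rule integrable_mult_right)
  then have "integrable MQ (orbit_integrand \<phi> g)"
  proof (rule Bochner_Integration.integrable_bound)
    have le: "norm (orbit_integrand \<phi> g y) \<le> C * indicator K y" for y
      using C(5)[of y] by (simp add: orbit_integrand_def g norm_mult)
    show "AE y in MQ. norm (orbit_integrand \<phi> g y) \<le> norm (C * indicator K y :: real)"
      unfolding real_norm_def by (rule AE_I2, rule order_trans[OF le abs_ge_self])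
  qed measurable
  then have "integrable (distr MQ borel ((+) q)) (orbit_integrand \<phi> g)" by (simp only: distr_Q)
  then have "integrable MQ (\<lambda>q\<^sub>0. orbit_integrand \<phi> g (q + q\<^sub>0))"
    by (subst (asm) integrable_distr_eq) auto
  then have "integrable MQ (\<lambda>q\<^sub>0. complex_of_real (m q powr (1 / 2)) * orbit_integrand \<phi> g (q + q\<^sub>0))"
    by (rule integrable_mult_right)
  then show ?thesis
    unfolding g Op_inner_eq[symmetric] .
qed

text \<open>After y = q q_0 the outer integrand is itself an integral over y, so \<open>Op\<close>
  is a double integral over G \<times> Q, and the kernel is what results from integrating over v
  alone. The modulus of the first variable has exponent 1/2 from the substitution and -1 from the
  Haar measure of G, together -1/2.\<close>

lemma Op_formula:
  assumes f: "f \<in> borel_measurable G" "integrable G f"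
    and \<phi>\<^sub>1: "\<phi>\<^sub>1 \<in> Cc euclidean" and \<phi>\<^sub>2: "\<phi>\<^sub>2 \<in> Cc euclidean"
  shows "integrable G (Op_outer MQ MV act \<eta> b f \<phi>\<^sub>1 \<phi>\<^sub>2)"
    "integrable (MQ \<Otimes>\<^sub>M MQ) (\<lambda>(q\<^sub>0, q). Op_kernel MV act \<eta> b f (q\<^sub>0, q) * \<phi>\<^sub>1 q * cnj (\<phi>\<^sub>2 q\<^sub>0))"
    "Op MQ MV act \<eta> b f \<phi>\<^sub>1 \<phi>\<^sub>2 = kernel_form MQ (Op_kernel MV act \<eta> b f) \<phi>\<^sub>1 \<phi>\<^sub>2"
proof -
  interpret GQ: pair_sigma_finite G MQ ..
  obtain C\<^sub>1 K where C\<^sub>1: "C\<^sub>1 \<ge> 0" "compact K" "\<phi>\<^sub>1 \<in> borel_measurable borel"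
    "\<And>q. cmod (\<phi>\<^sub>1 q) * m q powr (1 / 2) \<le> C\<^sub>1"
    "\<And>q. cmod (\<phi>\<^sub>1 q) * m q powr (- 1 / 2) \<le> C\<^sub>1 * indicator K q"
    using Cc_modulus_bound[OF \<phi>\<^sub>1] by blast
  obtain C\<^sub>2 L where C\<^sub>2: "C\<^sub>2 \<ge> 0" "compact L" "\<phi>\<^sub>2 \<in> borel_measurable borel"
    "\<And>q. cmod (\<phi>\<^sub>2 q) * m q powr (1 / 2) \<le> C\<^sub>2"
    "\<And>q. cmod (\<phi>\<^sub>2 q) * m q powr (- 1 / 2) \<le> C\<^sub>2 * indicator L q"
    using Cc_modulus_bound[OF \<phi>\<^sub>2] by blast
  note [measurable] = f(1) C\<^sub>1(3) C\<^sub>2(3)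
  have [measurable]: "K \<in> sets borel" using C\<^sub>1(2) by (rule borel_compact)
  \<comment> \<open>Collects the part of the double integrand that does not involve v.\<close>
  define \<kappa> where "\<kappa> x y = complex_of_real (m x powr (1 / 2) * m y powr (- 1 / 2)) *
      b (- x) x * cnj (b (- y) x) * \<phi>\<^sub>1 y * cnj (\<phi>\<^sub>2 x)" for x y
  define \<Theta> where "\<Theta> z y = \<kappa> (fst z) y * (cnj (pairing (\<eta> (fst z) - \<eta> y) (snd z)) * f z)" for z y
  define k where "k x y = Op_kernel MV act \<eta> b f (x, y) * \<phi>\<^sub>1 y * cnj (\<phi>\<^sub>2 x)" for x y
  have f' [measurable]: "(\<lambda>v. f (x, v)) \<in> borel_measurable MV" for x by measurable
  \<comment> \<open>\<phi>_1 confines y to the compact set \<open>K\<close>, while \<phi>_2 enters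
    as a bounded factor: integrability in the first variable will come from f.\<close>
  have \<kappa>_le: "cmod (\<kappa> x y) \<le> C\<^sub>2 * (C\<^sub>1 * indicator K y)" for x y
  proof -
    have "cmod (\<kappa> x y) = (cmod (\<phi>\<^sub>2 x) * m x powr (1 / 2)) * (cmod (\<phi>\<^sub>1 y) * m y powr (- 1 / 2))"
      by (simp add: \<kappa>_def norm_mult mult_ac)
    also have "\<dots> \<le> C\<^sub>2 * (C\<^sub>1 * indicator K y)"
      by (rule mult_mono[OF C\<^sub>2(4) C\<^sub>1(5)]) (use C\<^sub>2(1) in auto)
    finally show ?thesis .
  qed
  have \<Theta>_le: "cmod (\<Theta> z y) \<le> C\<^sub>2 * (C\<^sub>1 * indicator K y) * cmod (f z)" for z y
    unfolding \<Theta>_def norm_mult using \<kappa>_le[of "fst z" y] by (simp add: mult_right_mono)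
  have \<Theta>_meas [measurable]: "(\<lambda>z. \<Theta> (fst z) (snd z)) \<in> borel_measurable (G \<Otimes>\<^sub>M MQ)"
    unfolding \<Theta>_def \<kappa>_def by measurable
  have outer: "Op_outer MQ MV act \<eta> b f \<phi>\<^sub>1 \<phi>\<^sub>2 z = (\<integral>y. \<Theta> z y \<partial>MQ)" for z
  proof -
    obtain q v where z: "z = (q, v)" by (cases z)
    note [measurable] = orbit_integrand_measurable[OF C\<^sub>1(3)]
    have "(\<integral>q\<^sub>0. Op_inner MV act \<eta> b \<phi>\<^sub>1 z q\<^sub>0 \<partial>MQ) =
        complex_of_real (m q powr (1 / 2)) * (\<integral>q\<^sub>0. orbit_integrand \<phi>\<^sub>1 z (q + q\<^sub>0) \<partial>MQ)"
      by (simp add: z Op_inner_eq)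
    also have "(\<integral>q\<^sub>0. orbit_integrand \<phi>\<^sub>1 z (q + q\<^sub>0) \<partial>MQ) = (\<integral>y. orbit_integrand \<phi>\<^sub>1 z y \<partial>MQ)"
      by (rule integral_translate_Q) measurable
    finally have "Op_outer MQ MV act \<eta> b f \<phi>\<^sub>1 \<phi>\<^sub>2 z =
        (f z * complex_of_real (m q powr (1 / 2)) * cnj (proj_rep_adj \<eta> b z \<phi>\<^sub>2 0)) *
        (\<integral>y. orbit_integrand \<phi>\<^sub>1 z y \<partial>MQ)"
      by (simp add: Op_outer_def mult_ac)
    also have "\<dots> = (\<integral>y. (f z * complex_of_real (m q powr (1 / 2)) * cnj (proj_rep_adj \<eta> b z \<phi>\<^sub>2 0)) *
        orbit_integrand \<phi>\<^sub>1 z y \<partial>MQ)"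
      by (rule integral_mult_right_zero[symmetric])
    also have "\<dots> = (\<integral>y. \<Theta> z y \<partial>MQ)"
      by (intro Bochner_Integration.integral_cong refl)
        (simp add: \<Theta>_def \<kappa>_def z proj_rep_adj_def orbit_integrand_def pairing_minus mult_ac)
    finally show ?thesis .
  qed
  have kernel: "k x y = complex_of_real (inverse (m x)) * (\<integral>v. \<Theta> (x, v) y \<partial>MV)" for x y
  proof -
    have inv: "inverse (m x) = m x powr (- 1)" by (simp add: powr_neg_one inverse_eq_divide)
    have "inverse (m x) * (m x powr (1 / 2) * m y powr (- 1 / 2)) =
        m x powr (- 1 + 1 / 2) * m y powr (- 1 / 2)"
      unfolding inv powr_add by (simp only: mult.assoc)
    also have "\<dots> = m x powr (- 1 / 2) * m y powr (- 1 / 2)" by simp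
    also have "\<dots> = m (x + y) powr (- 1 / 2)" by (simp add: modulus_add powr_mult)
    finally have *: "complex_of_real (m (x + y) powr (- 1 / 2)) =
        complex_of_real (inverse (m x)) * complex_of_real (m x powr (1 / 2) * m y powr (- 1 / 2))"
      by (simp only: flip: of_real_mult)
    have "(\<integral>v. \<Theta> (x, v) y \<partial>MV) = \<kappa> x y * partial_fourier MV f (x, \<eta> x - \<eta> y)"
      by (simp add: \<Theta>_def partial_fourier_def fourier_def)
    then show ?thesis
      unfolding k_def \<kappa>_def Op_kernel_def prod.case * by (simp add: mult_ac)
  qed
  have int_K: "integrable MQ (\<lambda>y. C\<^sub>2 * (C\<^sub>1 * indicator K y) :: real)"
    using integrable_indicator_compact[OF C\<^sub>1(2)] by (intro integrable_mult_right)
  \<comment> \<open>One finite majorant serves both applications of Fubini's theorem, on G \<times>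
    Q and on Q \<times> Q.\<close>
  have fin: "(\<integral>\<^sup>+y. (\<integral>\<^sup>+z. ennreal (C\<^sub>2 * (C\<^sub>1 * indicator K y) * cmod (f z)) \<partial>G) \<partial>MQ) < \<infinity>"
  proof -
    have "(\<integral>\<^sup>+y. (\<integral>\<^sup>+z. ennreal (C\<^sub>2 * (C\<^sub>1 * indicator K y) * cmod (f z)) \<partial>G) \<partial>MQ) =
        (\<integral>\<^sup>+y. ennreal (C\<^sub>2 * (C\<^sub>1 * indicator K y)) * (\<integral>\<^sup>+z. ennreal (cmod (f z)) \<partial>G) \<partial>MQ)"
      using C\<^sub>1(1) C\<^sub>2(1) by (intro nn_integral_cong) (subst nn_integral_cmult[symmetric], auto simp: ennreal_mult)
    also have "\<dots> = (\<integral>\<^sup>+y. ennreal (C\<^sub>2 * (C\<^sub>1 * indicator K y)) \<partial>MQ) * (\<integral>\<^sup>+z. ennreal (cmod (f z)) \<partial>G)"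
      by (rule nn_integral_multc) measurable
    also have "\<dots> < \<infinity>"
    proof -
      have "(\<integral>\<^sup>+y. ennreal (C\<^sub>2 * (C\<^sub>1 * indicator K y)) \<partial>MQ) < \<infinity>"
        using nn_integral_eq_integral[OF int_K] C\<^sub>1(1) C\<^sub>2(1) by simp
      then show ?thesis using f(2) by (simp add: integrable_iff_bounded ennreal_mult_less_top)
    qed
    finally show ?thesis .
  qed
  have int_\<Theta>: "integrable (G \<Otimes>\<^sub>M MQ) (\<lambda>z. \<Theta> (fst z) (snd z))"
    unfolding integrable_iff_bounded
  proof
    have "(\<integral>\<^sup>+z. ennreal (norm (\<Theta> (fst z) (snd z))) \<partial>(G \<Otimes>\<^sub>M MQ)) =
        (\<integral>\<^sup>+y. \<integral>\<^sup>+z. ennreal (norm (\<Theta> z y)) \<partial>G \<partial>MQ)"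
      using GQ.nn_integral_snd[of "\<lambda>z. ennreal (norm (\<Theta> (fst z) (snd z)))"] by simp
    also have "\<dots> \<le> (\<integral>\<^sup>+y. \<integral>\<^sup>+z. ennreal (C\<^sub>2 * (C\<^sub>1 * indicator K y) * cmod (f z)) \<partial>G \<partial>MQ)"
      by (intro nn_integral_mono ennreal_leI \<Theta>_le)
    also note fin
    finally show "(\<integral>\<^sup>+z. ennreal (norm (\<Theta> (fst z) (snd z))) \<partial>(G \<Otimes>\<^sub>M MQ)) < \<infinity>" .
  qed (rule \<Theta>_meas)
  show "integrable G (Op_outer MQ MV act \<eta> b f \<phi>\<^sub>1 \<phi>\<^sub>2)"
    unfolding outer using GQ.integrable_fst'[OF int_\<Theta>] by simp
  have k_meas [measurable]: "(\<lambda>z. k (fst z) (snd z)) \<in> borel_measurable (MQ \<Otimes>\<^sub>M MQ)"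
  proof -
    have [measurable]: "Op_kernel MV act \<eta> b f \<in> borel_measurable (MQ \<Otimes>\<^sub>M MQ)"
      unfolding Op_kernel_eq
      by (rule kernel_map_measurable[OF borel_measurable_partial_fourier[OF f(1)]])
    show ?thesis unfolding k_def by measurable
  qed
  \<comment> \<open>Proved for every y, so that the integral over the extension can be split into v
    and x with y held fixed.\<close>
  have \<Theta>_int_G: "integrable G (\<lambda>z. \<Theta> z y)" for y
  proof (rule Bochner_Integration.integrable_bound)
    show "integrable G (\<lambda>z. C\<^sub>2 * (C\<^sub>1 * indicator K y) * cmod (f z))"
      using f(2) by (intro integrable_mult_right integrable_norm)
    show "(\<lambda>z. \<Theta> z y) \<in> borel_measurable G"
      unfolding \<Theta>_def \<kappa>_def by measurable
    show "AE z in G. norm (\<Theta> z y) \<le> norm (C\<^sub>2 * (C\<^sub>1 * indicator K y) * cmod (f z))"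
      unfolding real_norm_def by (rule AE_I2, rule order_trans[OF \<Theta>_le abs_ge_self])
  qed
  have slice: "(\<integral>x. k x y \<partial>MQ) = (\<integral>z. \<Theta> z y \<partial>G)" for y
  proof -
    have "(\<integral>z. \<Theta> z y \<partial>G) = (\<integral>x. \<integral>v. \<Theta> (x, v) y \<partial>MV \<partial>\<rho>)"
      using RV.integral_fst'[OF \<Theta>_int_G[of y]] by simp
    also have "\<dots> = (\<integral>x. inverse (m x) *\<^sub>R (\<integral>v. \<Theta> (x, v) y \<partial>MV) \<partial>MQ)"
    proof -
      have "(\<lambda>x. \<integral>v. \<Theta> (x, v) y \<partial>MV) \<in> borel_measurable MQ"
        unfolding \<Theta>_def \<kappa>_def by measurable
      then show ?thesis unfolding \<rho>_def by (intro integral_density) (auto intro: less_imp_le)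
    qed
    finally show ?thesis by (simp add: kernel scaleR_conv_of_real)
  qed
  have int_k: "integrable (MQ \<Otimes>\<^sub>M MQ) (\<lambda>z. k (fst z) (snd z))"
    unfolding integrable_iff_bounded
  proof
    have "(\<integral>\<^sup>+z. ennreal (norm (k (fst z) (snd z))) \<partial>(MQ \<Otimes>\<^sub>M MQ)) =
        (\<integral>\<^sup>+y. \<integral>\<^sup>+x. ennreal (norm (k x y)) \<partial>MQ \<partial>MQ)"
      using QQ.nn_integral_snd[of "\<lambda>z. ennreal (norm (k (fst z) (snd z)))"] by simp
    also have "\<dots> \<le> (\<integral>\<^sup>+y. \<integral>\<^sup>+z. ennreal (C\<^sub>2 * (C\<^sub>1 * indicator K y) * cmod (f z)) \<partial>G \<partial>MQ)"
    proof (rule nn_integral_mono)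
      fix y
      have "(\<integral>\<^sup>+x. ennreal (norm (k x y)) \<partial>MQ) \<le>
          (\<integral>\<^sup>+x. ennreal (inverse (m x)) * (\<integral>\<^sup>+v. ennreal (C\<^sub>2 * (C\<^sub>1 * indicator K y) * cmod (f (x, v))) \<partial>MV) \<partial>MQ)"
      proof (rule nn_integral_mono)
        fix x
        have "ennreal (norm (\<integral>v. \<Theta> (x, v) y \<partial>MV)) \<le> (\<integral>\<^sup>+v. ennreal (norm (\<Theta> (x, v) y)) \<partial>MV)"
        \<comment> \<open>A slice that is not integrable has integral 0, so the bound is trivial
          there.\<close>
        proof (cases "integrable MV (\<lambda>v. \<Theta> (x, v) y)")
          case True
          then show ?thesis by (rule integral_norm_bound_ennreal)
        qed (simp add: not_integrable_integral_eq)
        also have "\<dots> \<le> (\<integral>\<^sup>+v. ennreal (C\<^sub>2 * (C\<^sub>1 * indicator K y) * cmod (f (x, v))) \<partial>MV)"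
          by (intro nn_integral_mono ennreal_leI \<Theta>_le)
        finally have le: "ennreal (norm (\<integral>v. \<Theta> (x, v) y \<partial>MV)) \<le>
            (\<integral>\<^sup>+v. ennreal (C\<^sub>2 * (C\<^sub>1 * indicator K y) * cmod (f (x, v))) \<partial>MV)" .
        have "norm (k x y) = inverse (m x) * norm (\<integral>v. \<Theta> (x, v) y \<partial>MV)"
          unfolding kernel norm_mult norm_of_real by (simp add: less_imp_le)
        then show "ennreal (norm (k x y)) \<le> ennreal (inverse (m x)) *
            (\<integral>\<^sup>+v. ennreal (C\<^sub>2 * (C\<^sub>1 * indicator K y) * cmod (f (x, v))) \<partial>MV)"
          using le by (simp add: ennreal_mult mult_left_mono)
      qed
      also have "\<dots> = (\<integral>\<^sup>+x. \<integral>\<^sup>+v. ennreal (C\<^sub>2 * (C\<^sub>1 * indicator K y) * cmod (f (x, v))) \<partial>MV \<partial>\<rho>)"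
        by (rule nn_integral_rho[symmetric]) measurable
      also have "\<dots> = (\<integral>\<^sup>+z. ennreal (C\<^sub>2 * (C\<^sub>1 * indicator K y) * cmod (f z)) \<partial>G)"
        by (rule V.nn_integral_fst) measurable
      finally show "(\<integral>\<^sup>+x. ennreal (norm (k x y)) \<partial>MQ) \<le>
          (\<integral>\<^sup>+z. ennreal (C\<^sub>2 * (C\<^sub>1 * indicator K y) * cmod (f z)) \<partial>G)" .
    qed
    also note fin
    finally show "(\<integral>\<^sup>+z. ennreal (norm (k (fst z) (snd z))) \<partial>(MQ \<Otimes>\<^sub>M MQ)) < \<infinity>" .
  qed (rule k_meas)
  then show "integrable (MQ \<Otimes>\<^sub>M MQ) (\<lambda>(q\<^sub>0, q). Op_kernel MV act \<eta> b f (q\<^sub>0, q) * \<phi>\<^sub>1 q * cnj (\<phi>\<^sub>2 q\<^sub>0))"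
    unfolding k_def split_beta' by simp
  have "Op MQ MV act \<eta> b f \<phi>\<^sub>1 \<phi>\<^sub>2 = (\<integral>z. \<integral>y. \<Theta> z y \<partial>MQ \<partial>G)"
    unfolding Op_def ext_haar_eq outer ..
  also have "\<dots> = (\<integral>y. \<integral>z. \<Theta> z y \<partial>G \<partial>MQ)"
    by (rule GQ.Fubini_integral[symmetric]) (use int_\<Theta> in \<open>simp add: split_beta'\<close>)
  also have "\<dots> = (\<integral>y. \<integral>x. k x y \<partial>MQ \<partial>MQ)" unfolding slice ..
  also have "\<dots> = (\<integral>(x, y). k x y \<partial>(MQ \<Otimes>\<^sub>M MQ))"
    by (rule QQ.integral_snd) (use int_k in \<open>simp add: split_beta'\<close>)
  also have "\<dots> = kernel_form MQ (Op_kernel MV act \<eta> b f) \<phi>\<^sub>1 \<phi>\<^sub>2"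
    by (simp add: kernel_form_def k_def)
  finally show "Op MQ MV act \<eta> b f \<phi>\<^sub>1 \<phi>\<^sub>2 = kernel_form MQ (Op_kernel MV act \<eta> b f) \<phi>\<^sub>1 \<phi>\<^sub>2" .
qed

lemma kernel_form_cong:
  assumes [measurable]: "k \<in> borel_measurable (MQ \<Otimes>\<^sub>M MQ)" "k' \<in> borel_measurable (MQ \<Otimes>\<^sub>M MQ)"
    "\<phi>\<^sub>1 \<in> borel_measurable borel" "\<phi>\<^sub>2 \<in> borel_measurable borel"
    and "AE z in MQ \<Otimes>\<^sub>M MQ. k z = k' z"
  shows "kernel_form MQ k \<phi>\<^sub>1 \<phi>\<^sub>2 = kernel_form MQ k' \<phi>\<^sub>1 \<phi>\<^sub>2"
  unfolding kernel_form_def split_beta'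
  by (rule integral_cong_AE) (measurable, use assms(5) in eventually_elim, simp)

end

theorem proposition2p3:
  fixes act :: "'q::{topological_group_add, second_countable_topology, t2_space} \<Rightarrow>
                'v::{topological_ab_group_add, second_countable_topology, t2_space} \<Rightarrow> 'v"
    and \<beta> :: "'q \<Rightarrow> 'q \<Rightarrow> 'v"
    and \<eta> :: "'q \<Rightarrow> 'v dual"
    and b :: "'q \<Rightarrow> 'q \<Rightarrow> complex"
    and T :: "('q \<times> 'v) topology"
    and MQ :: "'q measure" and MV :: "'v measure" and MX :: "'v dual measure"
  assumes "locally_compact_space (euclidean :: 'q topology)"
    and "locally_compact_space (euclidean :: 'v topology)"
    and "continuous_action act"
    and "\<eta> \<in> Z1c act" and "\<beta> \<in> Z2 act" and "compatible \<eta> \<beta>"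
    and "ext_topology act \<beta> T"
    and "left_haar_measure MX" and "left_haar_measure MQ" and "left_haar_measure MV"
    and "essentially_bijective MQ MX \<eta>"
    and "\<And>h. h \<in> borel_measurable borel \<Longrightarrow>
           (\<integral>\<^sup>+ q. h (\<eta> q) * ennreal (inverse (modulus MV act q)) \<partial>MQ) = (\<integral>\<^sup>+ \<xi>. h \<xi> \<partial>MX)"
    and "fourier_unitary MV MX"
    and "b \<in> C2_circle" and "psi \<eta> \<beta> = coboundary b"
  shows "(\<forall>f\<in>Cc T. \<forall>\<phi>\<^sub>1\<in>Cc euclidean. \<forall>\<phi>\<^sub>2\<in>Cc euclidean.
           (\<forall>g. integrable MQ (Op_inner MV act \<eta> b \<phi>\<^sub>1 g)) \<and>
           integrable (ext_haar MQ MV act) (Op_outer MQ MV act \<eta> b f \<phi>\<^sub>1 \<phi>\<^sub>2) \<and>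
           integrable (MQ \<Otimes>\<^sub>M MQ)
             (\<lambda>(q\<^sub>0, q). Op_kernel MV act \<eta> b f (q\<^sub>0, q) * \<phi>\<^sub>1 q * cnj (\<phi>\<^sub>2 q\<^sub>0)) \<and>
           Op MQ MV act \<eta> b f \<phi>\<^sub>1 \<phi>\<^sub>2 = kernel_form MQ (Op_kernel MV act \<eta> b f) \<phi>\<^sub>1 \<phi>\<^sub>2) \<and>
         (\<exists>U. unitary_L2 (ext_haar MQ MV act) (MQ \<Otimes>\<^sub>M MQ) U \<and>
           (\<forall>f\<in>Cc T. f \<in> L2 (ext_haar MQ MV act) \<and> (\<forall>\<phi>\<^sub>1\<in>Cc euclidean. \<forall>\<phi>\<^sub>2\<in>Cc euclidean.
              kernel_form MQ (U f) \<phi>\<^sub>1 \<phi>\<^sub>2 = Op MQ MV act \<eta> b f \<phi>\<^sub>1 \<phi>\<^sub>2)) \<and>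
           (\<forall>g. \<forall>f\<in>L2 (ext_haar MQ MV act). \<forall>\<phi>\<in>L2 MQ. AE q\<^sub>0 in MQ.
              kernel_op MQ (U (ext_regular act \<beta> g f)) \<phi> q\<^sub>0 =
              proj_rep \<eta> b g (kernel_op MQ (U f) (proj_rep_adj \<eta> b g \<phi>)) q\<^sub>0))"
proof -
  interpret cocycle_pair act MQ MV \<beta> \<eta> b MX
    by unfold_locales (fact assms)+
  note Cc = Cc_ext[OF assms(7)]
  have first: "(\<forall>g. integrable MQ (Op_inner MV act \<eta> b \<phi>\<^sub>1 g)) \<and>
           integrable (ext_haar MQ MV act) (Op_outer MQ MV act \<eta> b f \<phi>\<^sub>1 \<phi>\<^sub>2) \<and>
           integrable (MQ \<Otimes>\<^sub>M MQ)
             (\<lambda>(q\<^sub>0, q). Op_kernel MV act \<eta> b f (q\<^sub>0, q) * \<phi>\<^sub>1 q * cnj (\<phi>\<^sub>2 q\<^sub>0)) \<and>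
           Op MQ MV act \<eta> b f \<phi>\<^sub>1 \<phi>\<^sub>2 = kernel_form MQ (Op_kernel MV act \<eta> b f) \<phi>\<^sub>1 \<phi>\<^sub>2"
    if f: "f \<in> Cc T" and \<phi>: "\<phi>\<^sub>1 \<in> Cc euclidean" "\<phi>\<^sub>2 \<in> Cc euclidean" for f \<phi>\<^sub>1 \<phi>\<^sub>2
    unfolding ext_haar_eq
    by (intro conjI allI integrable_Op_inner Op_formula L2_measurable[OF Cc(1)] Cc(2) f \<phi>)
  obtain U where U: "unitary_L2 G (MQ \<Otimes>\<^sub>M MQ) U"
    "\<And>f. f \<in> L2 G \<Longrightarrow> integrable G f \<Longrightarrow> AE z in MQ \<Otimes>\<^sub>M MQ. U f z = Op_kernel MV act \<eta> b f z"
    by (rule quantization_unitary) (rule that)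
  \<comment> \<open>\<open>U f\<close> and the explicit kernel agree only almost everywhere, a
    difference to which the sesquilinear form is blind.\<close>
  have form: "kernel_form MQ (U f) \<phi>\<^sub>1 \<phi>\<^sub>2 = Op MQ MV act \<eta> b f \<phi>\<^sub>1 \<phi>\<^sub>2"
    if f: "f \<in> Cc T" and \<phi>: "\<phi>\<^sub>1 \<in> Cc euclidean" "\<phi>\<^sub>2 \<in> Cc euclidean" for f \<phi>\<^sub>1 \<phi>\<^sub>2
  proof -
    have m\<phi>: "\<phi> \<in> borel_measurable borel" if "\<phi> \<in> Cc euclidean" for \<phi> :: "'q \<Rightarrow> complex"
      using Cc_euclidean_bound[OF that] by metis
    have "Op_kernel MV act \<eta> b f \<in> borel_measurable (MQ \<Otimes>\<^sub>M MQ)"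
      unfolding Op_kernel_eq
      by (rule kernel_map_measurable[OF borel_measurable_partial_fourier[OF L2_measurable[OF Cc(1)[OF f]]]])
    then have "kernel_form MQ (U f) \<phi>\<^sub>1 \<phi>\<^sub>2 = kernel_form MQ (Op_kernel MV act \<eta> b f) \<phi>\<^sub>1 \<phi>\<^sub>2"
      by (intro kernel_form_cong L2_measurable[OF unitary_L2D(1)[OF U(1) Cc(1)[OF f]]] m\<phi> \<phi> U(2) Cc f)
    then show ?thesis using first[OF f \<phi>] by simp
  qed
  show ?thesis
  proof (intro conjI ballI exI[of _ U] allI)
    show "unitary_L2 (ext_haar MQ MV act) (MQ \<Otimes>\<^sub>M MQ) U" unfolding ext_haar_eq by (rule U(1))
    show "f \<in> L2 (ext_haar MQ MV act)" if "f \<in> Cc T" for f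
      unfolding ext_haar_eq using that by (rule Cc(1))
    show "AE q\<^sub>0 in MQ. kernel_op MQ (U (ext_regular act \<beta> g f)) \<phi> q\<^sub>0 =
              proj_rep \<eta> b g (kernel_op MQ (U f) (proj_rep_adj \<eta> b g \<phi>)) q\<^sub>0"
      if "f \<in> L2 (ext_haar MQ MV act)" "\<phi> \<in> L2 MQ" for g f \<phi>
      using U that(1)[unfolded ext_haar_eq] that(2) by (rule intertwining)
  qed (use first form in blast)+
qed

end
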